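(* There exist infinitely many quadratic fields $\mathbb{K}$ such that for each of them there exist infinitely many Diophantine triples over $\mathbb{K}$ whose induced elliptic curves have torsion group $E(\mathbb{K})_{\mathrm{tors}}\cong \mathbb{Z}/2\mathbb{Z}\times\mathbb{Z}/12\mathbb{Z}$.
   Context: For a field $\mathbb{K}$, a Diophantine triple over $\mathbb{K}$ is a set $\{a,b,c\}$ of three distinct nonzero elements of $\mathbb{K}$ such that $ab+1$, $ac+1$ and $bc+1$ are all squares in $\mathbb{K}$. The elliptic curve induced by the Diophantine triple $\{a,b,c\}$ is $E:\ y^2=(ax+1)(bx+1)(cx+1)$ over $\mathbb{K}$. A quadratic field is a field extension of $\mathbb{Q}$ of degree $2$. *)

theory Defs
  imports Complex_Main
begin

text \<open>Number fields are realised as subfields of the complex numbers.\<close>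

definition subfield_of_complex :: "complex set \<Rightarrow> bool" where
  "subfield_of_complex K \<longleftrightarrow> 0 \<in> K \<and> 1 \<in> K \<and>
     (\<forall>x\<in>K. \<forall>y\<in>K. x + y \<in> K \<and> x - y \<in> K \<and> x * y \<in> K) \<and>
     (\<forall>x\<in>K. x \<noteq> 0 \<longrightarrow> inverse x \<in> K)"

definition quadratic_field :: "complex set \<Rightarrow> bool" where
  "quadratic_field K \<longleftrightarrow> subfield_of_complex K \<and>
     (\<exists>u\<in>K. \<exists>v\<in>K.
        (\<forall>q1 q2 :: rat. of_rat q1 * u + of_rat q2 * v = 0 \<longrightarrow> q1 = 0 \<and> q2 = 0) \<and>
        K = {of_rat q1 * u + of_rat q2 * v | q1 q2 :: rat. True})"

definition is_square_in :: "complex set \<Rightarrow> complex \<Rightarrow> bool" where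
  "is_square_in K z \<longleftrightarrow> (\<exists>r\<in>K. z = r ^ 2)"

definition diophantine_triple :: "complex set \<Rightarrow> complex \<Rightarrow> complex \<Rightarrow> complex \<Rightarrow> bool" where
  "diophantine_triple K a b c \<longleftrightarrow>
     a \<in> K \<and> b \<in> K \<and> c \<in> K \<and> a \<noteq> 0 \<and> b \<noteq> 0 \<and> c \<noteq> 0 \<and>
     a \<noteq> b \<and> a \<noteq> c \<and> b \<noteq> c \<and>
     is_square_in K (a * b + 1) \<and> is_square_in K (a * c + 1) \<and> is_square_in K (b * c + 1)"

text \<open>Points of a curve y^2 = A x^3 + B x^2 + C x + D (A nonzero):
  None is the point at infinity, Some (x, y) an affine point.\<close>

type_synonym point = "(complex \<times> complex) option"

text \<open>Chord-and-tangent addition law for y^2 = A x^3 + B x^2 + C x + D.\<close>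

fun cubic_add :: "complex \<Rightarrow> complex \<Rightarrow> complex \<Rightarrow> point \<Rightarrow> point \<Rightarrow> point" where
  "cubic_add A B C None Q = Q"
| "cubic_add A B C (Some p) None = Some p"
| "cubic_add A B C (Some (x1, y1)) (Some (x2, y2)) =
     (if x1 = x2 \<and> y1 = - y2 then None
      else (let l = (if x1 \<noteq> x2 then (y2 - y1) / (x2 - x1)
                     else (3 * A * x1 ^ 2 + 2 * B * x1 + C) / (2 * y1));
                x3 = (l ^ 2 - B) / A - x1 - x2;
                y3 = l * (x1 - x3) - y1
            in Some (x3, y3)))"

fun cubic_mult :: "complex \<Rightarrow> complex \<Rightarrow> complex \<Rightarrow> nat \<Rightarrow> point \<Rightarrow> point" where
  "cubic_mult A B C 0 P = None"
| "cubic_mult A B C (Suc n) P = cubic_add A B C P (cubic_mult A B C n P)"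

text \<open>The elliptic curve induced by the triple {a,b,c}:
  y^2 = (ax+1)(bx+1)(cx+1) = abc x^3 + (ab+ac+bc) x^2 + (a+b+c) x + 1.\<close>

definition dt_add :: "complex \<Rightarrow> complex \<Rightarrow> complex \<Rightarrow> point \<Rightarrow> point \<Rightarrow> point" where
  "dt_add a b c = cubic_add (a * b * c) (a * b + a * c + b * c) (a + b + c)"

definition dt_mult :: "complex \<Rightarrow> complex \<Rightarrow> complex \<Rightarrow> nat \<Rightarrow> point \<Rightarrow> point" where
  "dt_mult a b c = cubic_mult (a * b * c) (a * b + a * c + b * c) (a + b + c)"

definition dt_points :: "complex set \<Rightarrow> complex \<Rightarrow> complex \<Rightarrow> complex \<Rightarrow> point set" where
  "dt_points K a b c = {None} \<union>
     {Some (x, y) | x y. x \<in> K \<and> y \<in> K \<and> y ^ 2 = (a * x + 1) * (b * x + 1) * (c * x + 1)}"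

definition dt_torsion :: "complex set \<Rightarrow> complex \<Rightarrow> complex \<Rightarrow> complex \<Rightarrow> point set" where
  "dt_torsion K a b c = {P \<in> dt_points K a b c. \<exists>n>0. dt_mult a b c n P = None}"

definition torsion_Z2_Z12 :: "complex set \<Rightarrow> complex \<Rightarrow> complex \<Rightarrow> complex \<Rightarrow> bool" where
  "torsion_Z2_Z12 K a b c \<longleftrightarrow>
     (\<exists>\<phi> :: nat \<times> nat \<Rightarrow> point.
        bij_betw \<phi> ({..<2} \<times> {..<12}) (dt_torsion K a b c) \<and>
        (\<forall>i\<in>{..<2}. \<forall>j\<in>{..<12}. \<forall>i'\<in>{..<2}. \<forall>j'\<in>{..<12}.
           \<phi> ((i + i') mod 2, (j + j') mod 12) = dt_add a b c (\<phi> (i, j)) (\<phi> (i', j'))))"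

end

theory Submission
  imports Defs "HOL-Algebra.Group" "HOL-Computational_Algebra.Primes"
begin

text \<open>
  For rational \<open>t\<close> put \<open>w = - 2 t (1 + t)\<close>, \<open>q = 1 + 2 t\<close> and
  \<open>\<alpha>\<^sup>2 = w\<^sup>2 - 2 w = 4 t (1 + t) (1 + t + t\<^sup>2)\<close>. Then \<open>{\<alpha>, - 1 / \<alpha>, (w\<^sup>2 - 1) / \<alpha>}\<close> is a Diophantine
  triple over \<open>\<rat>(\<alpha>)\<close>, and its curve is isomorphic to \<open>E: y\<^sup>2 = x (x + w\<^sup>2 \<alpha>\<^sup>2) (x + q\<^sup>2)\<close>, which has a
  rational point of order 3, full 2-torsion, and a point of order 4 with \<open>x = w q \<alpha>\<close>.

  If \<open>t \<equiv> 1\<close> modulo 7, then \<open>E\<close> has good reduction with 12 points over the field with 7 elements,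
  and its twist by the nonresidue \<open>\<alpha>\<^sup>2\<close> has 4. Since reduction is injective on torsion, a torsion
  point \<open>P\<close> over \<open>\<rat>(\<alpha>)\<close> with conjugate \<open>P'\<close> has \<open>P + P'\<close> among 12 known points and \<open>P - P'\<close> among
  4, so that \<open>2 P\<close> is known; halving is controlled because \<open>- 1\<close> is not a square in the real field
  \<open>\<rat>(\<alpha>)\<close>.

  For fixed \<open>\<rat>(\<alpha>)\<close> the admissible \<open>t\<close> are the rational points on a twist of the elliptic curve
  \<open>s\<^sup>2 = t (1 + t) (1 + t + t\<^sup>2)\<close>. Tripling points preserves \<open>t \<equiv> 1\<close> modulo 7 and increases the
  3-adic valuation of \<open>t\<close>, which gives infinitely many triples. Starting from integers \<open>t\<close> exactly
  divisible by a prime \<open>l\<close> gives infinitely many fields, as \<open>l\<close> ramifies.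
\<close>

section \<open>The group law\<close>

text \<open>Taking the first two entries with product -1 makes one square condition trivial; the
  others give w^2 and (q/\<alpha>)^2 with q^2 = \<alpha>^2 - w^2 + 1. Imposing \<alpha>^2 = w^2 - 2w
  turns both 1 + \<alpha>^2 and w^2 + q^2 into (w - 1)^2, which puts a rational point over x = w^2,
  the one of order 3. It leaves q^2 = 1 - 2w, solved by q = 1 + 2t. The residue 1 of t makes
  \<alpha>^2 congruent to 3, so 7 is inert. Reducing over the residue field with 49 elements would
  only bound the torsion by 12 * 4 = 48, twice the true order; the missing factor 2 has to come from
  the real embedding. Splitting 2P into sum and difference with the conjugate also keeps every
  p-adic argument over the rationals. No reduction map is constructed. If two congruent torsion
  points were different, their difference would have a nonintegral abscissa and would be a torsion
  point of the formal group. There the parameter x/y is additive up to third order, which excludes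
  torsion.\<close>

definition ell_points :: "complex \<Rightarrow> complex \<Rightarrow> point set" where
  "ell_points a b = {None} \<union> {Some (x, y) | x y. y ^ 2 = x ^ 3 + a * x ^ 2 + b * x}"

fun ell_neg :: "point \<Rightarrow> point" where
  "ell_neg None = None"
| "ell_neg (Some (x, y)) = Some (x, - y)"

abbreviation ell_group :: "complex \<Rightarrow> complex \<Rightarrow> point monoid" where
  "ell_group a b \<equiv> \<lparr>carrier = ell_points a b, monoid.mult = cubic_add 1 a b, one = None\<rparr>"

lemma ell_points_Some [simp]:
  "Some (x, y) \<in> ell_points a b \<longleftrightarrow> y ^ 2 = x ^ 3 + a * x ^ 2 + b * x"
  by (simp add: ell_points_def)

lemma ell_points_None [simp]: "None \<in> ell_points a b"
  by (simp add: ell_points_def)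

lemma cubic_add_None_right [simp]: "cubic_add A B C P None = P"
  by (cases P) auto

text \<open>The two equations determine the slope of the line through two points in the
  secant and in the tangent case alike.\<close>

definition is_slope :: "complex \<Rightarrow> complex \<Rightarrow> complex \<Rightarrow> complex \<Rightarrow> complex \<Rightarrow> complex \<Rightarrow> complex \<Rightarrow> bool" where
  "is_slope a b x1 y1 x2 y2 l \<longleftrightarrow> l * (x2 - x1) = y2 - y1 \<and>
     l * (y1 + y2) = x1 ^ 2 + x1 * x2 + x2 ^ 2 + a * (x1 + x2) + b"

lemma cubic_add_slope:
  assumes "is_slope a b x1 y1 x2 y2 l" "\<not> (x1 = x2 \<and> y1 = - y2)"
  shows "cubic_add 1 a b (Some (x1, y1)) (Some (x2, y2)) =
    Some (l ^ 2 - a - x1 - x2, l * (x1 - (l ^ 2 - a - x1 - x2)) - y1)"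
proof -
  have "l = (if x1 \<noteq> x2 then (y2 - y1) / (x2 - x1) else (3 * 1 * x1 ^ 2 + 2 * a * x1 + b) / (2 * y1))"
  proof (cases "x1 = x2")
    case True
    with assms have "y2 = y1" "y1 \<noteq> 0" by (auto simp: is_slope_def)
    with True assms(1) show ?thesis
      by (simp add: is_slope_def field_simps power2_eq_square)
  next
    case False
    with assms(1) show ?thesis by (simp add: is_slope_def field_simps)
  qed
  with assms(2) show ?thesis by (auto simp: Let_def)
qed

lemma is_slope_exists:
  assumes "y1 ^ 2 = x1 ^ 3 + a * x1 ^ 2 + b * x1" "y2 ^ 2 = x2 ^ 3 + a * x2 ^ 2 + b * x2"
    and "\<not> (x1 = x2 \<and> y1 = - y2)"
  obtains l where "is_slope a b x1 y1 x2 y2 l"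
proof (cases "x1 = x2")
  case True
  have "(y1 - y2) * (y1 + y2) = 0" using assms True by algebra
  with assms(3) True have "y2 = y1" "y1 \<noteq> 0" by (auto simp: add_eq_0_iff2)
  with True have "is_slope a b x1 y1 x2 y2 ((3 * x1 ^ 2 + 2 * a * x1 + b) / (2 * y1))"
    by (simp add: is_slope_def field_simps power2_eq_square)
  then show ?thesis by (rule that)
next
  case False
  have "(y2 - y1) * (y1 + y2) = (x2 - x1) * (x1 ^ 2 + x1 * x2 + x2 ^ 2 + a * (x1 + x2) + b)"
    using assms(1,2) by algebra
  with False have "is_slope a b x1 y1 x2 y2 ((y2 - y1) / (x2 - x1))"
    by (simp add: is_slope_def field_simps)
  then show ?thesis by (rule that)
qed

lemma is_slope_sym: "is_slope a b x1 y1 x2 y2 l \<Longrightarrow> is_slope a b x2 y2 x1 y1 l"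
  unfolding is_slope_def by (intro conjI; algebra)

lemma cubic_add_commute:
  assumes "P \<in> ell_points a b" "Q \<in> ell_points a b"
  shows "cubic_add 1 a b P Q = cubic_add 1 a b Q P"
proof (cases P; cases Q)
  fix p q assume "P = Some p" "Q = Some q"
  then obtain x1 y1 x2 y2 where PQ: "P = Some (x1, y1)" "Q = Some (x2, y2)"
    by (cases p; cases q) auto
  show ?thesis
  proof (cases "x1 = x2 \<and> y1 = - y2")
    case False
    with assms PQ obtain l where l: "is_slope a b x1 y1 x2 y2 l"
      using is_slope_exists by (metis ell_points_Some)
    have x: "l ^ 2 - a - x2 - x1 = l ^ 2 - a - x1 - x2" by simp
    have "l * x2 - l * x1 = y2 - y1" using l by (simp add: is_slope_def right_diff_distrib)
    then have "l * (x1 - X) - y1 = l * (x2 - X) - y2" for X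
      by (simp add: algebra_simps)
    moreover have "\<not> (x2 = x1 \<and> y2 = - y1)" using False by auto
    ultimately show ?thesis unfolding PQ
      using cubic_add_slope[OF l False] cubic_add_slope[OF is_slope_sym[OF l]] x by metis
  qed (auto simp: PQ)
qed auto

lemma slope_third_point:
  assumes "y1 ^ 2 = x1 ^ 3 + a * x1 ^ 2 + b * x1" "is_slope a b x1 y1 x2 y2 l"
    and "x3 = l ^ 2 - a - x1 - x2"
  shows "(l * (x1 - x3) - y1) ^ 2 = x3 ^ 3 + a * x3 ^ 2 + b * x3"
  using assms unfolding is_slope_def by algebra

lemma cubic_add_closed:
  assumes "P \<in> ell_points a b" "Q \<in> ell_points a b"
  shows "cubic_add 1 a b P Q \<in> ell_points a b"
proof (cases P; cases Q)
  fix p q assume "P = Some p" "Q = Some q"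
  then obtain x1 y1 x2 y2 where PQ: "P = Some (x1, y1)" "Q = Some (x2, y2)"
    by (cases p; cases q) auto
  show ?thesis
  proof (cases "x1 = x2 \<and> y1 = - y2")
    case False
    with assms PQ obtain l where l: "is_slope a b x1 y1 x2 y2 l"
      using is_slope_exists by (metis ell_points_Some)
    show ?thesis unfolding PQ
      using cubic_add_slope[OF l False] slope_third_point[OF _ l refl] assms(1) PQ
      by simp
  qed (auto simp: PQ)
qed (use assms in auto)

lemma ell_neg_closed: "P \<in> ell_points a b \<Longrightarrow> ell_neg P \<in> ell_points a b"
  by (cases P rule: ell_neg.cases) auto

lemma cubic_add_neg: "cubic_add A B C (ell_neg P) P = None"
  by (cases P rule: ell_neg.cases) auto

text \<open>The hypotheses force \<open>m + s\<close> and \<open>n + t\<close> to be the same number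
  \<open>(x3 - x1) / (t - s)\<close>. Given this linear relation between the four slopes, both
  coordinates agree by polynomial identities.\<close>

lemma slopes_associative:
  fixes x1 x2 x3 y1 y2 y3 :: complex
  assumes s: "is_slope a b x1 y1 x2 y2 s" and t: "is_slope a b x2 y2 x3 y3 t"
    and x12: "x12 = s ^ 2 - a - x1 - x2" and y12: "y12 = s * (x1 - x12) - y1"
    and x23: "x23 = t ^ 2 - a - x2 - x3" and y23: "y23 = t * (x2 - x23) - y2"
    and ne: "x12 \<noteq> x3" "x23 \<noteq> x1" "s \<noteq> t"
    and m: "m * (x3 - x12) = y3 - y12" and n: "n * (x23 - x1) = y23 - y1"
  shows "m ^ 2 - a - x12 - x3 = n ^ 2 - a - x1 - x23 \<and>
    m * (x12 - (m ^ 2 - a - x12 - x3)) - y12 = n * (x1 - (n ^ 2 - a - x1 - x23)) - y1"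
proof -
  have "(t - s) * (m + s) * (x3 - x12) = (x3 - x1) * (x3 - x12)"
    using s t x12 y12 m unfolding is_slope_def by algebra
  then have ms: "(t - s) * (m + s) = x3 - x1" using ne by simp
  have "(t - s) * (n + t) * (x23 - x1) = (x3 - x1) * (x23 - x1)"
    using s t x23 y23 n unfolding is_slope_def by algebra
  then have nt: "(t - s) * (n + t) = x3 - x1" using ne by simp
  have mn: "n = m + s - t" using ms nt ne(3)
    by (metis add_diff_cancel_right' mult_left_cancel right_minus_eq)
  have x: "m ^ 2 - a - x12 - x3 = n ^ 2 - a - x1 - x23"
    using ms mn x12 x23 by algebra
  define X where "X = m ^ 2 - a - x12 - x3"
  have y1: "y1 = y2 - s * (x2 - x1)" and y3: "y3 = y2 + t * (x3 - x2)"
    using s t unfolding is_slope_def by simp_all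
  have h: "(m + s) * (x3 - x12) = 2 * y2 + (s + t) * (x3 - x2)"
    using m unfolding y12 y1 y3 by algebra
  have "x1 - X = (m + s) * (2 * s - (m + s)) + (x3 - x2)"
    unfolding X_def x12 by algebra
  then have e: "(t - s) * (x1 - X) = (x3 - x1) * (2 * s - (m + s)) + (t - s) * (x3 - x2)"
    using ms by algebra
  have "m * (x12 - X) - y12 = n * (x1 - X) - y1"
    using h e ms unfolding mn y12 y1 by algebra
  then have "m * (x12 - (m ^ 2 - a - x12 - x3)) - y12 = n * (x1 - (n ^ 2 - a - x1 - x23)) - y1"
    using x unfolding X_def by metis
  with x show ?thesis by blast
qed

section \<open>Associativity of the addition on a nonsingular curve\<close>

locale elliptic =
  fixes a b :: complex
  assumes nonsingular: "b \<noteq> 0" "a ^ 2 \<noteq> 4 * b"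
begin

abbreviation E :: "point set" where "E \<equiv> ell_points a b"
abbreviation add :: "point \<Rightarrow> point \<Rightarrow> point" (infixl "\<oplus>\<^sub>E" 65) where "P \<oplus>\<^sub>E Q \<equiv> cubic_add 1 a b P Q"

text \<open>The discriminant \<open>b ^ 2 * (a ^ 2 - 4 * b)\<close> of the cubic lies in the ideal
  generated by the cubic and its derivative.\<close>

lemma simple_roots:
  assumes "x ^ 3 + a * x ^ 2 + b * x = 0"
  shows "3 * x ^ 2 + 2 * a * x + b \<noteq> 0"
proof
  assume d: "3 * x ^ 2 + 2 * a * x + b = 0"
  have "b ^ 2 * (a ^ 2 - 4 * b) = 0" using assms d by algebra
  with nonsingular show False by simp
qed

text \<open>Reflecting the line through \<open>V\<close> and \<open>W\<close> in the x-axis gives a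
  line of slope \<open>- t\<close> through \<open>ell_neg V\<close>,
  \<open>V \<oplus>\<^sub>E W\<close> and \<open>ell_neg W\<close>; reading the sum off this line
  returns \<open>W\<close>.\<close>

lemma neg_add_cancel:
  assumes "V \<in> E" "W \<in> E"
  shows "ell_neg V \<oplus>\<^sub>E (V \<oplus>\<^sub>E W) = W"
proof (cases V; cases W)
  fix v w' assume "V = Some v" "W = Some w'"
  then obtain x2 y2 x3 y3 where VW: "V = Some (x2, y2)" "W = Some (x3, y3)"
    by (cases v; cases w') auto
  show ?thesis
  proof (cases "x2 = x3 \<and> y2 = - y3")
    case False
    with assms VW obtain t where t: "is_slope a b x2 y2 x3 y3 t"
      using is_slope_exists by (metis ell_points_Some)
    define x where "x = t ^ 2 - a - x2 - x3"
    define y where "y = t * (x2 - x) - y2"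
    have sum: "V \<oplus>\<^sub>E W = Some (x, y)"
      using cubic_add_slope[OF t False] by (simp add: VW x_def y_def)
    have on: "y2 ^ 2 = x2 ^ 3 + a * x2 ^ 2 + b * x2" using assms VW by simp
    \<comment> \<open>If the third intersection lies over \<open>x2\<close>, it is \<open>V\<close>
      itself, and the line is tangent at \<open>V\<close> even when it was drawn as a
      secant.\<close>
    have tan: "2 * t * y2 = 3 * x2 ^ 2 + 2 * a * x2 + b" if "x = x2"
      using t that x_def unfolding is_slope_def by algebra
    have "is_slope a b x2 (- y2) x y (- t)"
    proof (cases "x = x2")
      case True
      have y: "y = - y2" using True y_def by simp
      show ?thesis using tan[OF True] unfolding is_slope_def y True
        by (simp add: power2_eq_square algebra_simps)
    next
      case False
      have "t * (y2 - y) * (x - x2) = (x ^ 2 + x * x2 + x2 ^ 2 + a * (x + x2) + b) * (x - x2)"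
        using t on x_def y_def unfolding is_slope_def by algebra
      with False have "t * (y2 - y) = x ^ 2 + x * x2 + x2 ^ 2 + a * (x + x2) + b" by simp
      then show ?thesis using y_def unfolding is_slope_def by (intro conjI; algebra)
    qed
    moreover have "\<not> (x2 = x \<and> - y2 = - y)"
    proof
      assume *: "x2 = x \<and> - y2 = - y"
      then have "y2 = 0" using y_def by auto
      with * tan on simple_roots show False by force
    qed
    ultimately have "ell_neg V \<oplus>\<^sub>E (V \<oplus>\<^sub>E W) = Some ((- t) ^ 2 - a - x2 - x, - t * (x2 - ((- t) ^ 2 - a - x2 - x)) - (- y2))"
      unfolding sum unfolding VW ell_neg.simps by (rule cubic_add_slope)
    also have "\<dots> = W"
      using t unfolding VW is_slope_def x_def by (simp add: algebra_simps)
    finally show ?thesis .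
  qed (auto simp: VW)
qed (use cubic_add_neg in auto)

lemma add_left_cancel:
  assumes "V \<in> E" "W \<in> E" "W' \<in> E" "V \<oplus>\<^sub>E W = V \<oplus>\<^sub>E W'"
  shows "W = W'"
  using assms neg_add_cancel by metis

text \<open>Direct computation is only attempted for generic \<open>W\<close>. Finitely many
  exceptions are harmless because the curve has infinitely many points, among which a generic
  auxiliary point can be chosen.\<close>

lemma finite_not_assoc:
  assumes U: "U \<in> E" and V: "V \<in> E"
  shows "finite {W \<in> E. (U \<oplus>\<^sub>E V) \<oplus>\<^sub>E W \<noteq> U \<oplus>\<^sub>E (V \<oplus>\<^sub>E W)}"
proof (cases "U = None \<or> V = None \<or> U = ell_neg V")
  case True
  have "{W \<in> E. (U \<oplus>\<^sub>E V) \<oplus>\<^sub>E W \<noteq> U \<oplus>\<^sub>E (V \<oplus>\<^sub>E W)} = {}"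
    using True V neg_add_cancel by (auto simp: cubic_add_neg)
  then show ?thesis by (metis finite.emptyI)
next
  case False
  \<comment> \<open>The entries exclude in turn: \<open>W\<close> at infinity, \<open>V + W\<close>
    at infinity, \<open>W\<close> over the abscissa of \<open>U + V\<close> (two points), and the
    solutions of \<open>V + W = U\<close> and \<open>V + W = - U\<close>. The last four are exactly
    the cases \<open>x12 = x3\<close> and \<open>x23 = x1\<close>.\<close>
  let ?bad = "{None, ell_neg V, U \<oplus>\<^sub>E V, ell_neg (U \<oplus>\<^sub>E V), ell_neg V \<oplus>\<^sub>E U, ell_neg V \<oplus>\<^sub>E ell_neg U}"
  have "(U \<oplus>\<^sub>E V) \<oplus>\<^sub>E W = U \<oplus>\<^sub>E (V \<oplus>\<^sub>E W)" if W: "W \<in> E" and bad: "W \<notin> ?bad" for W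
  proof -
    obtain x1 y1 x2 y2 x3 y3 where c: "U = Some (x1, y1)" "V = Some (x2, y2)" "W = Some (x3, y3)"
      using False bad by (cases U; cases V; cases W) auto
    have UV: "\<not> (x1 = x2 \<and> y1 = - y2)" using False c by auto
    have VW: "\<not> (x2 = x3 \<and> y2 = - y3)" using bad c by auto
    obtain s where s: "is_slope a b x1 y1 x2 y2 s"
      using is_slope_exists UV U V c by (metis ell_points_Some)
    obtain t where t: "is_slope a b x2 y2 x3 y3 t"
      using is_slope_exists VW W V c by (metis ell_points_Some)
    define x12 where "x12 = s ^ 2 - a - x1 - x2"
    define y12 where "y12 = s * (x1 - x12) - y1"
    define x23 where "x23 = t ^ 2 - a - x2 - x3"
    define y23 where "y23 = t * (x2 - x23) - y2"
    have UV': "U \<oplus>\<^sub>E V = Some (x12, y12)"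
      using cubic_add_slope[OF s UV] by (simp add: c x12_def y12_def)
    have VW': "V \<oplus>\<^sub>E W = Some (x23, y23)"
      using cubic_add_slope[OF t VW] by (simp add: c x23_def y23_def)
    have eq_pm: "y = y' \<or> y = - y'" if "y ^ 2 = x ^ 3 + a * x ^ 2 + b * x" "y' ^ 2 = x ^ 3 + a * x ^ 2 + b * x" for x y y'
      using that by (metis power2_eq_iff)
    have x12: "x12 \<noteq> x3"
    proof
      assume "x12 = x3"
      moreover have "Some (x12, y12) \<in> E" using UV' cubic_add_closed U V by metis
      ultimately have "y3 = y12 \<or> y3 = - y12" using eq_pm W c by simp
      with \<open>x12 = x3\<close> bad c UV' show False by auto
    qed
    have x23: "x23 \<noteq> x1"
    proof
      assume "x23 = x1"
      moreover have "Some (x23, y23) \<in> E" using VW' cubic_add_closed W V by metis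
      ultimately have "y23 = y1 \<or> y23 = - y1" using eq_pm U c by simp
      then have "V \<oplus>\<^sub>E W = U \<or> V \<oplus>\<^sub>E W = ell_neg U" using \<open>x23 = x1\<close> VW' c by auto
      then have "W = ell_neg V \<oplus>\<^sub>E U \<or> W = ell_neg V \<oplus>\<^sub>E ell_neg U"
        using neg_add_cancel[OF V W] by auto
      with bad show False by blast
    qed
    show ?thesis
    \<comment> \<open>Equal slopes put \<open>U\<close>, \<open>V\<close>, \<open>W\<close> on one
      line; since \<open>x3 \<noteq> x12\<close>, the point \<open>W\<close> must be
      \<open>U\<close>, and the claim reduces to commutativity.\<close>
    proof (cases "s = t")
      case True
      have "(x3 - x1) * (x3 - x12) = 0"
        using s t True x12_def unfolding is_slope_def by algebra
      then have "x3 = x1" using x12 by simp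
      moreover from this have "y3 = y1" using s t True
        unfolding is_slope_def by (auto simp: algebra_simps)
      ultimately have "U = W" using c by simp
      then show ?thesis using U V cubic_add_commute cubic_add_closed by metis
    next
      case False
      define m where "m = (y3 - y12) / (x3 - x12)"
      define n where "n = (y23 - y1) / (x23 - x1)"
      have "(U \<oplus>\<^sub>E V) \<oplus>\<^sub>E W = Some (m ^ 2 - a - x12 - x3, m * (x12 - (m ^ 2 - a - x12 - x3)) - y12)"
        unfolding UV' using x12 by (simp add: c m_def Let_def)
      moreover have "U \<oplus>\<^sub>E (V \<oplus>\<^sub>E W) = Some (n ^ 2 - a - x1 - x23, n * (x1 - (n ^ 2 - a - x1 - x23)) - y1)"
        unfolding VW' using x23 by (simp add: c n_def Let_def)
      moreover have "m * (x3 - x12) = y3 - y12" "n * (x23 - x1) = y23 - y1"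
        using x12 x23 by (simp_all add: m_def n_def)
      ultimately show ?thesis
        using slopes_associative[OF s t x12_def y12_def x23_def y23_def x12 x23 False] by metis
    qed
  qed
  then have "{W \<in> E. (U \<oplus>\<^sub>E V) \<oplus>\<^sub>E W \<noteq> U \<oplus>\<^sub>E (V \<oplus>\<^sub>E W)} \<subseteq> ?bad" by blast
  then show ?thesis by (rule finite_subset) simp
qed

lemma infinite_ell_points: "infinite E"
proof
  assume "finite E"
  have "inj (\<lambda>x. Some (x, csqrt (x ^ 3 + a * x ^ 2 + b * x)))" by (auto simp: inj_def)
  moreover have "range (\<lambda>x. Some (x, csqrt (x ^ 3 + a * x ^ 2 + b * x))) \<subseteq> E" by auto
  ultimately have "finite (UNIV :: complex set)"
    using \<open>finite E\<close> finite_subset finite_imageD by blast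
  then show False using infinite_UNIV_char_0 by blast
qed

text \<open>Adding a generic point \<open>S\<close> to both sides reduces associativity to the generic case.\<close>

lemma cubic_add_assoc:
  assumes A: "A \<in> E" and B: "B \<in> E" and C: "C \<in> E"
  shows "(A \<oplus>\<^sub>E B) \<oplus>\<^sub>E C = A \<oplus>\<^sub>E (B \<oplus>\<^sub>E C)"
proof -
  define bad where "bad = (\<lambda>U V. {W \<in> E. (U \<oplus>\<^sub>E V) \<oplus>\<^sub>E W \<noteq> U \<oplus>\<^sub>E (V \<oplus>\<^sub>E W)})"
  have fin: "finite (bad U V)" if "U \<in> E" "V \<in> E" for U V
    unfolding bad_def using finite_not_assoc that by blast
  note cl = cubic_add_closed
  have "finite (bad (A \<oplus>\<^sub>E B) C \<union> (\<lambda>W. ell_neg C \<oplus>\<^sub>E W) ` bad A B \<union> bad B C \<union> bad A (B \<oplus>\<^sub>E C))"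
    using fin A B C cl by simp
  then obtain S where S: "S \<in> E" and
    nb: "S \<notin> bad (A \<oplus>\<^sub>E B) C \<union> (\<lambda>W. ell_neg C \<oplus>\<^sub>E W) ` bad A B \<union> bad B C \<union> bad A (B \<oplus>\<^sub>E C)"
    using infinite_ell_points by (meson finite_subset subsetI)
  have CS: "C \<oplus>\<^sub>E S \<notin> bad A B"
    using nb neg_add_cancel[OF C S] by (metis UnI1 UnI2 image_eqI)
  have "((A \<oplus>\<^sub>E B) \<oplus>\<^sub>E C) \<oplus>\<^sub>E S = (A \<oplus>\<^sub>E B) \<oplus>\<^sub>E (C \<oplus>\<^sub>E S)"
    using nb S by (auto simp: bad_def)
  also have "\<dots> = A \<oplus>\<^sub>E (B \<oplus>\<^sub>E (C \<oplus>\<^sub>E S))"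
    using CS cl[OF C S] by (auto simp: bad_def)
  also have "B \<oplus>\<^sub>E (C \<oplus>\<^sub>E S) = (B \<oplus>\<^sub>E C) \<oplus>\<^sub>E S"
    using nb S by (auto simp: bad_def)
  also have "A \<oplus>\<^sub>E ((B \<oplus>\<^sub>E C) \<oplus>\<^sub>E S) = (A \<oplus>\<^sub>E (B \<oplus>\<^sub>E C)) \<oplus>\<^sub>E S"
    using nb S by (auto simp: bad_def)
  finally have "S \<oplus>\<^sub>E ((A \<oplus>\<^sub>E B) \<oplus>\<^sub>E C) = S \<oplus>\<^sub>E (A \<oplus>\<^sub>E (B \<oplus>\<^sub>E C))"
    using cubic_add_commute S A B C cl by metis
  then show ?thesis using add_left_cancel S A B C cl by metis
qed

lemma comm_group_ell: "comm_group (ell_group a b)"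
proof (rule comm_groupI; simp add: cubic_add_closed)
  fix P assume "P \<in> E"
  then show "\<exists>Q\<in>E. Q \<oplus>\<^sub>E P = None" using ell_neg_closed cubic_add_neg by blast
qed (use cubic_add_assoc cubic_add_commute in auto)

end

section \<open>Rational numbers p-adically\<close>

text \<open>This is \<open>p ^ k\<close> times the localization of the integers at \<open>p\<close>,
  inside the complex numbers. Membership encodes "valuation at least \<open>k\<close>", with 0
  needing no special treatment; elements are automatically rational.\<close>

definition padic :: "int \<Rightarrow> nat \<Rightarrow> complex set" where
  "padic p k = {of_int (p ^ k * m) / of_int n | m n. \<not> p dvd n}"

locale prime_int =
  fixes p :: int
  assumes prime_p: "prime p"
begin

lemma padicI: "x = of_int (p ^ k * m) / of_int n \<Longrightarrow> \<not> p dvd n \<Longrightarrow> x \<in> padic p k"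
  unfolding padic_def by blast

lemma padicE:
  assumes "x \<in> padic p k"
  obtains m n where "x = of_int (p ^ k * m) / of_int n" "\<not> p dvd n" "n \<noteq> 0"
  using assms unfolding padic_def by fastforce

lemma padic_of_int [simp]: "of_int m \<in> padic p 0"
  by (rule padicI[of _ _ m 1]) (use prime_p in auto)

lemma padic_numeral [simp]: "numeral m \<in> padic p 0"
  using padic_of_int[of "numeral m"] by simp

lemma padic_one [simp]: "1 \<in> padic p 0"
  using padic_of_int[of 1] by simp

lemma padic_zero [simp]: "0 \<in> padic p k"
  by (rule padicI[of _ _ 0 1]) (use prime_p in auto)

lemma padic_add: "x \<in> padic p k \<Longrightarrow> y \<in> padic p k \<Longrightarrow> x + y \<in> padic p k"
proof (elim padicE)
  fix m n m' n' assume *: "x = of_int (p ^ k * m) / of_int n" "\<not> p dvd n" "n \<noteq> 0"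
    "y = of_int (p ^ k * m') / of_int n'" "\<not> p dvd n'" "n' \<noteq> 0"
  show "x + y \<in> padic p k"
  proof (rule padicI)
    show "x + y = of_int (p ^ k * (m * n' + m' * n)) / of_int (n * n')"
      using * by (simp add: field_simps)
    show "\<not> p dvd n * n'" using * prime_p prime_dvd_mult_iff by blast
  qed
qed

lemma padic_minus: "x \<in> padic p k \<Longrightarrow> - x \<in> padic p k"
proof (elim padicE)
  fix m n assume *: "x = of_int (p ^ k * m) / of_int n" "\<not> p dvd n" "n \<noteq> 0"
  show "- x \<in> padic p k"
    by (rule padicI[of _ _ "- m" n]) (use * in auto)
qed

lemma padic_diff: "x \<in> padic p k \<Longrightarrow> y \<in> padic p k \<Longrightarrow> x - y \<in> padic p k"
  using padic_add[of x k "- y"] padic_minus by simp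

lemma padic_mult: "x \<in> padic p j \<Longrightarrow> y \<in> padic p k \<Longrightarrow> x * y \<in> padic p (j + k)"
proof (elim padicE)
  fix m n m' n' assume *: "x = of_int (p ^ j * m) / of_int n" "\<not> p dvd n" "n \<noteq> 0"
    "y = of_int (p ^ k * m') / of_int n'" "\<not> p dvd n'" "n' \<noteq> 0"
  show "x * y \<in> padic p (j + k)"
  proof (rule padicI)
    show "x * y = of_int (p ^ (j + k) * (m * m')) / of_int (n * n')"
      unfolding *(1) *(4) by (simp add: power_add)
    show "\<not> p dvd n * n'" using * prime_p prime_dvd_mult_iff by blast
  qed
qed

lemma padic_mult_left: "x \<in> padic p 0 \<Longrightarrow> y \<in> padic p k \<Longrightarrow> x * y \<in> padic p k"
  using padic_mult[of x 0 y k] by simp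

lemma padic_mult_right: "x \<in> padic p k \<Longrightarrow> y \<in> padic p 0 \<Longrightarrow> x * y \<in> padic p k"
  using padic_mult[of x k y 0] by simp

lemma padic_power: "x \<in> padic p k \<Longrightarrow> x ^ n \<in> padic p (n * k)"
  by (induction n) (auto simp: padic_mult)

lemma padic_power_0: "x \<in> padic p 0 \<Longrightarrow> x ^ n \<in> padic p 0"
  using padic_power[of x 0 n] by simp

lemma padic_mono: "x \<in> padic p k \<Longrightarrow> j \<le> k \<Longrightarrow> x \<in> padic p j"
proof (elim padicE)
  fix m n assume *: "j \<le> k" "x = of_int (p ^ k * m) / of_int n" "\<not> p dvd n" "n \<noteq> 0"
  show "x \<in> padic p j"
    by (rule padicI[of _ _ "p ^ (k - j) * m" n])
      (use * in \<open>simp_all add: mult.assoc[symmetric] power_add[symmetric]\<close>)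
qed

lemmas padic_intros = padic_add padic_diff padic_minus padic_mult_left padic_power_0

lemma of_int_padic_iff: "of_int m \<in> padic p k \<longleftrightarrow> p ^ k dvd m"
proof
  assume "of_int m \<in> padic p k"
  then obtain m' n where *: "(of_int m :: complex) = of_int (p ^ k * m') / of_int n" "\<not> p dvd n" "n \<noteq> 0"
    by (rule padicE)
  then have "(of_int (m * n) :: complex) = of_int (p ^ k * m')" by (simp add: field_simps)
  then have "m * n = p ^ k * m'" using of_int_eq_iff by blast
  then have "p ^ k dvd m * n" by simp
  moreover have "coprime (p ^ k) n" using * prime_p by (simp add: prime_imp_coprime)
  ultimately show "p ^ k dvd m" using coprime_dvd_mult_left_iff by blast
next
  assume "p ^ k dvd m"
  then obtain m' where "m = p ^ k * m'" by blast
  then show "of_int m \<in> padic p k"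
    by (intro padicI[of _ _ m' 1]) (use prime_p in auto)
qed

lemma one_not_padic [simp]: "1 \<notin> padic p (Suc k)"
proof
  assume "1 \<in> padic p (Suc k)"
  then have "p ^ Suc k dvd 1" using of_int_padic_iff[of 1 "Suc k"] by simp
  then have "p dvd 1" by (metis dvd_mult_left power_Suc)
  with prime_p show False using not_prime_unit by blast
qed

lemma padic_inverse:
  assumes "u \<in> padic p 0" "u \<notin> padic p 1"
  shows "inverse u \<in> padic p 0"
proof -
  obtain m n where *: "u = of_int (p ^ 0 * m) / of_int n" "\<not> p dvd n" "n \<noteq> 0"
    using assms(1) by (rule padicE)
  have "\<not> p dvd m"
  proof
    assume "p dvd m"
    then obtain m' where "m = p * m'" by blast
    then have "u \<in> padic p 1" using * by (intro padicI[of _ _ m' n]) auto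
    with assms show False by blast
  qed
  then show ?thesis using * by (intro padicI[of _ _ n m]) auto
qed

lemma padic_divide: "x \<in> padic p k \<Longrightarrow> u \<in> padic p 0 \<Longrightarrow> u \<notin> padic p 1 \<Longrightarrow> x / u \<in> padic p k"
  using padic_mult_right[OF _ padic_inverse] by (simp add: divide_inverse)

lemma one_plus_padic: "x \<in> padic p 1 \<Longrightarrow> 1 + x \<in> padic p 0 \<and> 1 + x \<notin> padic p 1"
  using padic_mono[of x 1 0] padic_add[of 1 0 x] padic_diff[of "1 + x" 1 x] one_not_padic[of 0] by auto

text \<open>Primality of \<open>p\<close> makes valuations exactly additive;
  \<open>padic_mult\<close> gives only the lower bound for a product.\<close>

lemma not_padic_mult:
  assumes "x \<in> padic p j" "x \<notin> padic p (Suc j)" "y \<in> padic p k" "y \<notin> padic p (Suc k)"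
  shows "x * y \<notin> padic p (Suc (j + k))"
proof -
  have p0: "p \<noteq> 0" using prime_p by auto
  obtain m n where *: "x = of_int (p ^ j * m) / of_int n" "\<not> p dvd n" "n \<noteq> 0"
    using assms(1) by (rule padicE)
  obtain m' n' where xy: "y = of_int (p ^ k * m') / of_int n'" "\<not> p dvd n'" "n' \<noteq> 0"
    using assms(3) by (rule padicE)
  have m: "\<not> p dvd m"
  proof
    assume "p dvd m"
    then obtain c where "m = p * c" by blast
    then have "x \<in> padic p (Suc j)" using * by (intro padicI[of _ _ c n]) auto
    with assms show False by blast
  qed
  have m': "\<not> p dvd m'"
  proof
    assume "p dvd m'"
    then obtain c where "m' = p * c" by blast
    then have "y \<in> padic p (Suc k)" using xy by (intro padicI[of _ _ c n']) auto
    with assms show False by blast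
  qed
  show ?thesis
  proof
    assume "x * y \<in> padic p (Suc (j + k))"
    then obtain c d where c: "x * y = of_int (p ^ Suc (j + k) * c) / of_int d" "\<not> p dvd d" "d \<noteq> 0"
      by (rule padicE)
    have "x * y = of_int (p ^ (j + k) * (m * m')) / of_int (n * n')"
      unfolding *(1) xy(1) by (simp add: power_add)
    with c(1) have "of_int (p ^ (j + k) * (m * m')) / of_int (n * n') = (of_int (p ^ Suc (j + k) * c) / of_int d :: complex)"
      by metis
    then have "(of_int (p ^ (j + k) * (m * m') * d) :: complex) = of_int (p ^ Suc (j + k) * c * (n * n'))"
      using *(3) xy(3) c(3) by (subst (asm) frac_eq_eq) auto
    then have "p ^ (j + k) * (m * m') * d = p ^ Suc (j + k) * c * (n * n')"
      using of_int_eq_iff by blast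
    then have "p ^ (j + k) * (m * m' * d) = p ^ (j + k) * (p * (c * (n * n')))"
      by (simp only: power_Suc ac_simps)
    then have "m * m' * d = p * (c * (n * n'))" using p0 by simp
    then have "p dvd m * m' * d" by simp
    with m m' c(2) prime_p show False by (simp add: prime_dvd_mult_iff)
  qed
qed

lemma padic_prime:
  "x \<in> padic p 0 \<Longrightarrow> y \<in> padic p 0 \<Longrightarrow> x * y \<in> padic p 1 \<Longrightarrow> x \<in> padic p 1 \<or> y \<in> padic p 1"
  using not_padic_mult[of x 0 y 0] by auto

lemma rational_cases:
  assumes "x \<in> \<rat>"
  shows "x \<in> padic p 0 \<or> x \<noteq> 0 \<and> inverse x \<in> padic p 1"
proof -
  obtain m n where q: "n > 0" "coprime m n" "x = of_int m / of_int n"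
    using Rats_cases'[OF assms] by metis
  show ?thesis
  proof (cases "p dvd n")
    case False
    then show ?thesis using q by (intro disjI1 padicI[of _ _ m n]) auto
  next
    case True
    then have m: "\<not> p dvd m" using q prime_p by (meson coprime_common_divisor not_prime_unit)
    obtain n' where "n = p * n'" using True by blast
    with m q show ?thesis by (intro disjI2 conjI padicI[of _ _ n' m]) auto
  qed
qed

lemma padic_exact:
  assumes "x \<in> padic p 0" "x \<noteq> 0"
  obtains k where "x \<in> padic p k" "x \<notin> padic p (Suc k)"
proof -
  obtain m n where *: "x = of_int (p ^ 0 * m) / of_int n" "\<not> p dvd n" "n \<noteq> 0"
    using assms(1) by (rule padicE)
  \<comment> \<open>The valuation is bounded because \<open>p ^ k\<close> divides the nonzero
    numerator \<open>m\<close> and \<open>k < 2 ^ k \<le> p ^ k\<close>; so a largest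
    \<open>k\<close> exists.\<close>
  have bnd: "k \<le> nat \<bar>m\<bar>" if "x \<in> padic p k" for k
  proof -
    have "of_int n * x \<in> padic p k" using that padic_mult_left by simp
    then have "of_int m \<in> padic p k" using * by simp
    then have "p ^ k dvd m" using of_int_padic_iff by blast
    moreover have "m \<noteq> 0" using * assms by auto
    ultimately have m: "\<bar>p ^ k\<bar> \<le> \<bar>m\<bar>" using dvd_imp_le_int by blast
    have "int k < 2 ^ k" by (rule of_nat_less_two_power)
    also have "2 ^ k \<le> p ^ k" using prime_p by (intro power_mono) (auto simp: prime_ge_2_int)
    also have "\<dots> \<le> \<bar>p ^ k\<bar>" by (rule abs_ge_self)
    also note m
    finally show ?thesis by simp
  qed
  define k where "k = Max {k. x \<in> padic p k}"
  have "{k. x \<in> padic p k} \<subseteq> {..nat \<bar>m\<bar>}" using bnd by blast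
  then have fin: "finite {k. x \<in> padic p k}" by (rule finite_subset) (rule finite_atMost)
  then have "x \<in> padic p k" unfolding k_def using Max_in[OF fin] assms(1) by blast
  moreover have "x \<notin> padic p (Suc k)"
  proof
    assume "x \<in> padic p (Suc k)"
    then have "Suc k \<le> k" unfolding k_def using Max_ge[OF fin] by blast
    then show False by simp
  qed
  ultimately show ?thesis by (rule that)
qed

lemma padic_Rats: "x \<in> padic p k \<Longrightarrow> x \<in> \<rat>"
  by (auto elim!: padicE)

end

section \<open>Reduction modulo a prime\<close>

text \<open>If \<open>n0\<close> is the order of \<open>P\<close> and \<open>l\<close> a prime
  factor of it, then \<open>m = n0 / l\<close> works. This reduces the absence of torsion in the
  kernel of reduction to prime order.\<close>

lemma (in group) torsion_prime_order:
  assumes "P \<in> carrier G" "P \<noteq> \<one>" "(n::nat) > 0" "P [^] n = \<one>"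
  obtains m l :: nat where "P [^] m \<noteq> \<one>" "prime l" "(P [^] m) [^] l = \<one>"
proof -
  define n0 where "n0 = (LEAST n::nat. n > 0 \<and> P [^] n = \<one>)"
  have n0: "n0 > 0 \<and> P [^] n0 = \<one>"
    unfolding n0_def by (rule LeastI[of _ n]) (use assms in simp)
  have "n0 \<noteq> 1" using n0 assms by auto
  then obtain l where l: "prime l" "l dvd n0" using prime_factor_nat by blast
  then obtain m where m: "n0 = l * m" by blast
  have "m > 0" "m < n0" using n0 l m prime_gt_1_nat[of l] by auto
  then have "P [^] m \<noteq> \<one>" using not_less_Least unfolding n0_def by blast
  moreover have "(P [^] m) [^] l = \<one>"
    using n0 assms(1) m by (simp add: nat_pow_pow mult.commute)
  ultimately show ?thesis using l that by blast
qed

context elliptic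
begin

sublocale G: comm_group "ell_group a b" by (rule comm_group_ell)

definition torsion :: "point \<Rightarrow> bool" where
  "torsion P \<longleftrightarrow> P \<in> E \<and> (\<exists>n>0. P [^]\<^bsub>ell_group a b\<^esub> (n::nat) = None)"

lemma torsion_add:
  assumes "torsion P" "torsion Q"
  shows "torsion (P \<oplus>\<^sub>E Q)"
proof -
  obtain m n :: nat where m: "m > 0" "P [^]\<^bsub>ell_group a b\<^esub> m = None" and n: "n > 0" "Q [^]\<^bsub>ell_group a b\<^esub> n = None"
    using assms torsion_def by auto
  have c: "P \<in> carrier (ell_group a b)" "Q \<in> carrier (ell_group a b)" using assms torsion_def by auto
  have "P [^]\<^bsub>ell_group a b\<^esub> (m * n) = None"
    using G.nat_pow_pow[OF c(1), of m n] m G.nat_pow_one by simp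
  moreover have "Q [^]\<^bsub>ell_group a b\<^esub> (m * n) = None"
    using G.nat_pow_pow[OF c(2), of n m] n G.nat_pow_one by (simp add: mult.commute)
  ultimately have "(P \<oplus>\<^sub>E Q) [^]\<^bsub>ell_group a b\<^esub> (m * n) = None"
    using G.nat_pow_distrib[OF c, of "m * n"] by simp
  moreover have "m * n > 0" using m n by simp
  ultimately show ?thesis using cubic_add_closed assms unfolding torsion_def by blast
qed

lemma ell_neg_eq_inv: "P \<in> E \<Longrightarrow> ell_neg P = inv\<^bsub>ell_group a b\<^esub> P"
  using G.inv_equality[of "ell_neg P" P] ell_neg_closed cubic_add_neg by simp

lemma torsion_neg:
  assumes "torsion P" shows "torsion (ell_neg P)"
proof -
  have c: "P \<in> carrier (ell_group a b)" using assms torsion_def by auto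
  obtain n :: nat where n: "n > 0" "P [^]\<^bsub>ell_group a b\<^esub> n = None" using assms torsion_def by auto
  have "ell_neg P [^]\<^bsub>ell_group a b\<^esub> n = None"
    using G.nat_pow_inv[OF c, of n] n ell_neg_eq_inv c G.inv_one by simp
  then show ?thesis using n ell_neg_closed c unfolding torsion_def by auto
qed

end

section \<open>The formal group filtration and injectivity of reduction on torsion\<close>

locale elliptic_reduction = elliptic a b + prime_int p for a b p +
  assumes integral: "a \<in> padic p 0" "b \<in> padic p 0"
begin

text \<open>The filtration of the kernel of reduction by powers of \<open>p\<close>, in the
  coordinates \<open>z = x / y\<close> and \<open>w = 1 / y\<close> in which infinity is the origin.
  The weight 3 for \<open>w\<close> reflects that \<open>w\<close> vanishes to third order where
  \<open>z\<close> is a local parameter.\<close>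

definition kernel :: "nat \<Rightarrow> point set" where
  "kernel k = {None} \<union>
     {Some (x, y) | x y. Some (x, y) \<in> E \<and> y \<noteq> 0 \<and> x / y \<in> padic p k \<and> 1 / y \<in> padic p (3 * k)}"

fun zcoord :: "point \<Rightarrow> complex" where
  "zcoord None = 0"
| "zcoord (Some (x, y)) = x / y"

lemma kernel_Some [simp]:
  "Some (x, y) \<in> kernel k \<longleftrightarrow>
     y ^ 2 = x ^ 3 + a * x ^ 2 + b * x \<and> y \<noteq> 0 \<and> x / y \<in> padic p k \<and> 1 / y \<in> padic p (3 * k)"
  by (simp add: kernel_def)

lemma kernel_None [simp]: "None \<in> kernel k"
  by (simp add: kernel_def)

lemma kernel_carrier: "P \<in> kernel k \<Longrightarrow> P \<in> E"
  by (auto simp: kernel_def)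

text \<open>In the coordinates \<open>z = x/y\<close>, \<open>w = 1/y\<close> around infinity the line through two points of the
  kernel is \<open>w = \<mu> z + \<nu>\<close> with \<open>\<mu> = - l / m\<close>, \<open>\<nu> = 1 / m\<close> small, and the sum of the three
  \<open>z\<close>-coordinates on it is \<open>- (a \<nu> + 2 b \<mu> \<nu>) / (1 + a \<mu> + b \<mu>\<^sup>2)\<close>.\<close>

lemma kernel_add_affine:
  assumes k: "k > 0" and P: "Some (x1, y1) \<in> kernel k" and Q: "Some (x2, y2) \<in> kernel k"
    and ne: "\<not> (x1 = x2 \<and> y1 = - y2)"
  obtains x3 y3 where "Some (x1, y1) \<oplus>\<^sub>E Some (x2, y2) = Some (x3, y3)"
    "Some (x3, y3) \<in> kernel k" "x3 / y3 - x1 / y1 - x2 / y2 \<in> padic p (3 * k)"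
proof -
  have on: "y1 ^ 2 = x1 ^ 3 + a * x1 ^ 2 + b * x1" "y2 ^ 2 = x2 ^ 3 + a * x2 ^ 2 + b * x2"
    and nz: "y1 \<noteq> 0" "y2 \<noteq> 0" using P Q by simp_all
  obtain l where l: "is_slope a b x1 y1 x2 y2 l"
    using is_slope_exists on ne by metis
  define m where "m = y1 - l * x1"
  define z1 z2 w1 w2 where "z1 = x1 / y1" "z2 = x2 / y2" "w1 = 1 / y1" "w2 = 1 / y2"
  note zw = z1_z2_w1_w2_def
  have z: "z1 \<in> padic p k" "z2 \<in> padic p k" and w: "w1 \<in> padic p (3 * k)" "w2 \<in> padic p (3 * k)"
    using P Q by (simp_all add: zw)
  have w': "w1 \<in> padic p (2 * k)" "w2 \<in> padic p (2 * k)" "w1 \<in> padic p 0" "z1 \<in> padic p 0" "z2 \<in> padic p 0"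
    using w z by (auto elim: padic_mono)
  \<comment> \<open>In these coordinates the curve is \<open>w = z^3 + a z^2 w + b z w^2\<close>.
    Subtracting this equation at the two points gives
    \<open>(w1 - w2) * den = (z1 - z2) * num\<close>, so \<open>num / den\<close> is the slope of
    the line, with \<open>den\<close> a unit.\<close>
  define num where "num = z1 * z1 + z1 * z2 + z2 * z2 + (a * (z1 + z2)) * w1 + (b * w1) * w1"
  define den where "den = 1 + (- (a * z2) * z2 - (b * z2) * (w1 + w2))"
  have zz: "u * v \<in> padic p (2 * k)" if "u \<in> padic p k" "v \<in> padic p k" for u v
    using padic_mult[OF that] by (simp add: mult_2)
  have num: "num \<in> padic p (2 * k)"
    unfolding num_def using zz z w' integral
    by (intro padic_add) (auto intro!: padic_intros)
  have "- (a * z2) * z2 - (b * z2) * (w1 + w2) \<in> padic p k"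
    using z w w' integral
    by (intro padic_diff padic_mult_left) (auto intro!: padic_intros elim: padic_mono)
  then have "- (a * z2) * z2 - (b * z2) * (w1 + w2) \<in> padic p 1"
    by (rule padic_mono) (use k in simp)
  note den = one_plus_padic[OF this, folded den_def]
  then have den0: "den \<noteq> 0" by auto
  have ndx: "num * (y1 ^ 2 * y2 ^ 2) = x1 ^ 2 * y2 ^ 2 + x1 * x2 * y1 * y2 + x2 ^ 2 * y1 ^ 2
      + a * (x1 * y2 + x2 * y1) * y2 + b * y2 ^ 2"
    unfolding num_def zw using nz by (simp add: field_simps power2_eq_square)
  have ddx: "den * (y1 * y2 ^ 2) = y1 * y2 ^ 2 - a * x2 ^ 2 * y1 - b * x2 * (y1 + y2)"
    unfolding den_def zw using nz by (simp add: field_simps power2_eq_square)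
  \<comment> \<open>This is \<open>\<mu> = num / den\<close> with denominators cleared. In this form
    it also holds for a tangent line, where \<open>z1 = z2\<close> and the difference quotient is
    meaningless.\<close>
  have key: "m * num = - l * den"
  proof (cases "x1 = x2")
    case False
    have d: "l * (x2 - x1) = y2 - y1" using l by (simp add: is_slope_def)
    have "(x2 - x1) * (m * (num * (y1 ^ 2 * y2 ^ 2)) + l * y1 * (den * (y1 * y2 ^ 2))) = 0"
      unfolding ndx ddx using on d m_def by algebra
    with False have "m * (num * (y1 ^ 2 * y2 ^ 2)) + l * y1 * (den * (y1 * y2 ^ 2)) = 0" by simp
    then have "(m * num + l * den) * (y1 ^ 2 * y2 ^ 2) = 0"
      by (simp add: algebra_simps power2_eq_square)
    with nz have "m * num + l * den = 0" by simp
    then show ?thesis by (simp add: add_eq_0_iff)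
  next
    case True
    with l ne have y: "y2 = y1" by (auto simp: is_slope_def)
    have d: "l * (2 * y1) = 3 * x1 ^ 2 + 2 * a * x1 + b"
      using l True y by (simp add: is_slope_def power2_eq_square algebra_simps)
    have "m * (num * (y1 ^ 2 * y2 ^ 2)) + l * y1 * (den * (y1 * y2 ^ 2)) = 0"
      unfolding ndx ddx unfolding y True[symmetric] using on(1) d m_def by algebra
    then have "(m * num + l * den) * (y1 ^ 2 * y2 ^ 2) = 0"
      by (simp add: algebra_simps power2_eq_square)
    with nz have "m * num + l * den = 0" by simp
    then show ?thesis by (simp add: add_eq_0_iff)
  qed
  have m0: "m \<noteq> 0"
  proof
    assume "m = 0"
    with key den0 have "l = 0" by simp
    with \<open>m = 0\<close> nz show False by (simp add: m_def)
  qed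
  define \<mu> where "\<mu> = - l / m"
  define \<nu> where "\<nu> = 1 / m"
  have "\<mu> = num / den" unfolding \<mu>_def using key m0 den0 by (simp add: field_simps)
  then have lam: "\<mu> \<in> padic p (2 * k)" using padic_divide num den by simp
  have lm: "l = - \<mu> / \<nu>" "m = 1 / \<nu>" "\<nu> \<noteq> 0" using m0 by (simp_all add: \<mu>_def \<nu>_def)
  have "\<nu> = w1 - \<mu> * z1"
    unfolding \<mu>_def \<nu>_def zw using m0 nz by (simp add: field_simps) (simp add: m_def algebra_simps)
  moreover have "\<mu> * z1 \<in> padic p (3 * k)" using padic_mult[OF lam z(1)] by simp
  ultimately have nu: "\<nu> \<in> padic p (3 * k)" using w padic_diff by simp
  have "a * \<mu> + (b * \<mu>) * \<mu> \<in> padic p (2 * k)"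
    using lam integral padic_mono[OF lam, of 0] by (intro padic_add padic_mult_left) auto
  then have "a * \<mu> + (b * \<mu>) * \<mu> \<in> padic p 1" by (rule padic_mono) (use k in simp)
  note unit = one_plus_padic[OF this]
  define c where "c = 1 + (a * \<mu> + (b * \<mu>) * \<mu>)"
  have c0: "c \<noteq> 0" using unit c_def by auto
  define x3 where "x3 = l ^ 2 - a - x1 - x2"
  define y3 where "y3 = l * (x1 - x3) - y1"
  have sum: "Some (x1, y1) \<oplus>\<^sub>E Some (x2, y2) = Some (x3, y3)"
    using cubic_add_slope[OF l ne] unfolding x3_def y3_def .
  have ys: "y1 = l * x1 + m" "y2 = l * x2 + m" "- y3 = l * x3 + m"
    using l by (auto simp: m_def y3_def is_slope_def algebra_simps)
  have e1: "x1 + x2 + x3 = l ^ 2 - a" by (simp add: x3_def)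
  have e2: "x1 * x2 + x1 * x3 + x2 * x3 = b - 2 * l * m"
    using l unfolding is_slope_def x3_def m_def by algebra
  have e3: "x1 * x2 * x3 = m ^ 2"
    using e1 e2 on(1) ys(1) by algebra
  \<comment> \<open>The abscissas \<open>x1\<close>, \<open>x2\<close>, \<open>x3\<close> are the
    roots of the cubic minus \<open>(l x + m)^2\<close>, so the product of the three values
    \<open>l x + m\<close> is a polynomial in the symmetric functions \<open>e1\<close>,
    \<open>e2\<close>, \<open>e3\<close>. Up to \<open>m ^ 3\<close> it is the unit
    \<open>c\<close>, hence \<open>y3\<close> does not vanish.\<close>
  have prod: "y1 * y2 * (- y3) = m * (l ^ 2 * b - a * l * m + m ^ 2)"
    unfolding ys using e1 e2 e3 by algebra
  have cm: "l ^ 2 * b - a * l * m + m ^ 2 = m ^ 2 * c"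
    unfolding c_def \<mu>_def using m0 by (simp add: field_simps power2_eq_square)
  have y30: "y3 \<noteq> 0" using prod cm c0 m0 nz by auto
  have num3: "x1 * y2 * (- y3) + x2 * y1 * (- y3) + x3 * y1 * y2 = m * (2 * l * b - a * m)"
    unfolding ys using e1 e2 e3 by algebra
  have "x1 / y1 + x2 / y2 + x3 / (- y3) =
      (x1 * y2 * (- y3) + x2 * y1 * (- y3) + x3 * y1 * y2) / (y1 * y2 * (- y3))"
    using nz y30 by (simp add: field_simps)
  also have "\<dots> = - ((a * \<nu> + 2 * b * \<mu> * \<nu>) / c)"
    unfolding prod num3 cm unfolding \<mu>_def \<nu>_def using m0 c0 by (simp add: field_simps power2_eq_square)
  finally have zsum: "x3 / y3 - z1 - z2 = (a * \<nu> + 2 * b * \<mu> * \<nu>) / c"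
    by (simp add: zw algebra_simps)
  have "\<mu> \<in> padic p 0" using lam padic_mono by blast
  then have "a * \<nu> + 2 * b * \<mu> * \<nu> \<in> padic p (3 * k)"
    using nu integral by (intro padic_add padic_mult_left) auto
  then have zs: "x3 / y3 - z1 - z2 \<in> padic p (3 * k)"
    unfolding zsum c_def using unit padic_divide by blast
  have "(x3 / y3 - z1 - z2) + z1 + z2 \<in> padic p k"
    using z padic_mono[OF zs, of k] by (intro padic_add) simp_all
  then have z3: "x3 / y3 \<in> padic p k" by simp
  have "1 / y3 = \<mu> * (x3 / y3) - \<nu>"
  proof -
    have my: "m = - y3 - l * x3" using ys(3) by simp
    have "m * (1 / y3) = - l * (x3 / y3) - 1" unfolding my using y30 by (simp add: diff_divide_distrib)
    then show ?thesis unfolding \<mu>_def \<nu>_def using m0 by (simp add: field_simps)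
  qed
  moreover have "\<mu> * (x3 / y3) \<in> padic p (3 * k)" using padic_mult[OF lam z3] by simp
  ultimately have w3: "1 / y3 \<in> padic p (3 * k)" using nu padic_diff by simp
  have "y3 ^ 2 = x3 ^ 3 + a * x3 ^ 2 + b * x3"
    unfolding y3_def by (rule slope_third_point[OF on(1) l x3_def])
  then have "Some (x3, y3) \<in> kernel k" using z3 w3 y30 by simp
  with sum zs show ?thesis using that zw by blast
qed

text \<open>The error term of weight \<open>3 * k\<close> is the point: by induction, multiplication
  by \<open>n\<close> multiplies \<open>z\<close> by \<open>n\<close> up to a quantity much smaller
  than \<open>z\<close> itself.\<close>

lemma kernel_add:
  assumes "k > 0" "P \<in> kernel k" "Q \<in> kernel k"
  shows "P \<oplus>\<^sub>E Q \<in> kernel k \<and> zcoord (P \<oplus>\<^sub>E Q) - zcoord P - zcoord Q \<in> padic p (3 * k)"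
proof (cases P; cases Q)
  fix q r assume "P = Some q" "Q = Some r"
  then obtain x1 y1 x2 y2 where PQ: "P = Some (x1, y1)" "Q = Some (x2, y2)"
    by (cases q; cases r) auto
  show ?thesis
  proof (cases "x1 = x2 \<and> y1 = - y2")
    case True
    then show ?thesis by (simp add: PQ)
  next
    case False
    with assms PQ kernel_add_affine show ?thesis by (metis zcoord.simps(2))
  qed
qed (use assms in auto)

lemma kernel_pow:
  assumes "k > 0" "P \<in> kernel k"
  shows "P [^]\<^bsub>ell_group a b\<^esub> (n::nat) \<in> kernel k \<and>
    zcoord (P [^]\<^bsub>ell_group a b\<^esub> n) - of_nat n * zcoord P \<in> padic p (3 * k)"
proof (induction n)
  case (Suc n)
  let ?R = "P [^]\<^bsub>ell_group a b\<^esub> n"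
  have "?R \<oplus>\<^sub>E P \<in> kernel k" and "zcoord (?R \<oplus>\<^sub>E P) - zcoord ?R - zcoord P \<in> padic p (3 * k)"
    using kernel_add[OF assms(1)] Suc assms(2) by blast+
  moreover from this(2) Suc have
    "(zcoord (?R \<oplus>\<^sub>E P) - zcoord ?R - zcoord P) + (zcoord ?R - of_nat n * zcoord P) \<in> padic p (3 * k)"
    using padic_add by blast
  ultimately show ?case by (simp add: algebra_simps)
qed auto

text \<open>The depth of a point is governed by \<open>z\<close> alone: the curve equation gives
  \<open>z^3\<close> as \<open>w\<close> times a factor congruent to 1, so the valuation of
  \<open>w\<close> is three times that of \<open>z\<close>.\<close>

lemma kernel_refine:
  assumes "Some (x, y) \<in> kernel 1" "x / y \<in> padic p k" "k > 0"
  shows "Some (x, y) \<in> kernel k"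
proof -
  define z w where "z = x / y" "w = 1 / y"
  have y: "y \<noteq> 0" and on: "y ^ 2 = x ^ 3 + a * x ^ 2 + b * x" using assms by simp_all
  have z: "z \<in> padic p 1" "z \<in> padic p k" and w: "w \<in> padic p 0"
    using assms padic_mono[of "1 / y" "3 * 1" 0] by (simp_all add: z_w_def)
  have "- (a * z) * z - (b * w) * z \<in> padic p 1"
    using z w integral padic_mono[OF z(1), of 0] by (intro padic_diff padic_mult_left padic_minus) auto
  note u = one_plus_padic[OF this]
  have "w * (1 + (- (a * z) * z - (b * w) * z)) * y ^ 3 = y ^ 2 - a * x ^ 2 - b * x"
    unfolding z_w_def using y by (simp add: field_simps power2_eq_square power3_eq_cube)
  also have "\<dots> = z ^ 3 * y ^ 3" unfolding z_w_def on using y by (simp add: power_divide)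
  finally have "w * (1 + (- (a * z) * z - (b * w) * z)) = z ^ 3" using y by simp
  then have "w = z ^ 3 / (1 + (- (a * z) * z - (b * w) * z))"
    using u by (metis nonzero_mult_div_cancel_right padic_zero)
  moreover have "z ^ 3 \<in> padic p (3 * k)" using padic_power[OF z(2), of 3] by simp
  ultimately have "w \<in> padic p (3 * k)" using u padic_divide by metis
  then show ?thesis using assms z on y by (simp add: z_w_def)
qed

text \<open>Let \<open>k\<close> be the exact valuation of \<open>z = x / y\<close>. Vanishing of
  the \<open>l\<close>-fold point would give \<open>l * z\<close> valuation at least
  \<open>3 * k \<ge> k + 2\<close>, whereas a prime \<open>l\<close> raises the valuation of
  \<open>z\<close> by at most 1, and by 1 only for \<open>l = p\<close>.\<close>

lemma kernel_prime_torsion_free: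
  assumes P: "P \<in> kernel 1" "P \<noteq> None" and l: "prime (l::nat)"
  shows "P [^]\<^bsub>ell_group a b\<^esub> l \<noteq> None"
proof
  assume eq: "P [^]\<^bsub>ell_group a b\<^esub> l = None"
  obtain x y where xy: "P = Some (x, y)" using P by (cases P) auto
  have y: "y \<noteq> 0" "x / y \<in> padic p 1" using P xy by simp_all
  have "x \<noteq> 0" using P xy by auto
  then have "x / y \<noteq> 0" "x / y \<in> padic p 0" using y padic_mono by auto
  then obtain k where k: "x / y \<in> padic p k" "x / y \<notin> padic p (Suc k)" using padic_exact by blast
  have "k > 0" using k y by (cases k) auto
  then have "P \<in> kernel k" using kernel_refine P xy k by blast
  from kernel_pow[OF \<open>k > 0\<close> this, of l]
  have "of_nat l * (x / y) \<in> padic p (3 * k)" using eq xy padic_minus[of "- (of_nat l * (x / y))" "3 * k"] by simp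
  then have *: "of_nat l * (x / y) \<in> padic p (Suc (1 + k))"
    by (rule padic_mono) (use \<open>k > 0\<close> in simp)
  have l2: "\<not> p ^ 2 dvd int l"
  proof
    assume "p ^ 2 dvd int l"
    then have "p * p dvd int l" by (simp add: power2_eq_square)
    then have "p dvd int l" using dvd_mult_left by blast
    moreover have "prime (int l)" using l by simp
    ultimately have "p = int l" using prime_p primes_dvd_imp_eq by blast
    with \<open>p * p dvd int l\<close> have "p dvd 1" using prime_p
      by (metis dvd_mult_cancel_left dvd_times_left_cancel_iff mult.right_neutral not_prime_0)
    with prime_p show False using not_prime_unit by blast
  qed
  show False
  proof (cases "p dvd int l")
    case True
    have "of_int (int l) \<in> padic p 1" "of_int (int l) \<notin> padic p (Suc 1)"
      using True l2 of_int_padic_iff[of "int l" 1] of_int_padic_iff[of "int l" 2] by (auto simp: numeral_2_eq_2)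
    then show False using not_padic_mult[OF _ _ k] * by fastforce
  next
    case False
    have "of_int (int l) \<in> padic p 0" "of_int (int l) \<notin> padic p (Suc 0)"
      using False of_int_padic_iff[of "int l" 1] padic_of_int[of "int l"] by auto
    then have "of_int (int l) * (x / y) \<notin> padic p (Suc (0 + k))" using not_padic_mult[OF _ _ k] by blast
    then show False using padic_mono[OF *, of "Suc k"] by simp
  qed
qed

lemma kernel_torsion_free:
  assumes P: "P \<in> kernel 1" "torsion P"
  shows "P = None"
proof (rule ccontr)
  assume ne: "P \<noteq> None"
  obtain n :: nat where n: "n > 0" "P [^]\<^bsub>ell_group a b\<^esub> n = None" using P torsion_def by auto
  have "P \<in> carrier (ell_group a b)" using P kernel_carrier by simp
  then obtain m l :: nat where "P [^]\<^bsub>ell_group a b\<^esub> m \<noteq> None" "prime l"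
    "(P [^]\<^bsub>ell_group a b\<^esub> m) [^]\<^bsub>ell_group a b\<^esub> l = None"
    using G.torsion_prime_order[of P n] ne n unfolding monoid.simps by metis
  moreover have "P [^]\<^bsub>ell_group a b\<^esub> m \<in> kernel 1" using kernel_pow P by simp
  ultimately show False using kernel_prime_torsion_free by blast
qed

text \<open>For large \<open>x\<close> the equation reads \<open>y ^ 2 = x ^ 3 * v\<close> with a
  unit \<open>v\<close>. Hence \<open>z ^ 2 = t / v\<close> with \<open>t = 1 / x\<close> divisible
  by \<open>p\<close>, which forces \<open>z\<close> into \<open>padic p 1\<close>, and then
  \<open>1 / y = v * z ^ 3\<close>.\<close>

lemma nonintegral_kernel:
  assumes on: "Some (x, y) \<in> E" and rat: "x \<in> \<rat>" "y \<in> \<rat>" and x: "x \<notin> padic p 0"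
  shows "Some (x, y) \<in> kernel 1"
proof -
  define t where "t = inverse x"
  have x0: "x \<noteq> 0" and t: "t \<in> padic p 1" using rational_cases[OF rat(1)] x by (auto simp: t_def)
  have "a * t + (b * t) * t \<in> padic p 1"
    using t padic_mono[OF t, of 0] integral by (intro padic_add padic_mult_left) auto
  note u = one_plus_padic[OF this]
  define v where "v = 1 + (a * t + (b * t) * t)"
  have v: "v \<in> padic p 0" "v \<notin> padic p 1" using u by (simp_all add: v_def)
  have v0: "v \<noteq> 0" using v by auto
  have yv: "y ^ 2 = x ^ 3 * v"
    using on x0 unfolding v_def t_def by (simp add: field_simps power2_eq_square power3_eq_cube)
  have y0: "y \<noteq> 0" using yv x0 v0 by auto
  define z where "z = x / y"
  have "z ^ 2 = x ^ 2 / y ^ 2" by (simp add: z_def power_divide)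
  then have z2: "z ^ 2 = t / v"
    unfolding yv t_def using x0 v0 by (simp add: field_simps power2_eq_square power3_eq_cube)
  then have z2p: "z ^ 2 \<in> padic p 1" using padic_divide t v by simp
  have "z \<in> \<rat>" using rat by (simp add: z_def)
  have zp: "z \<in> padic p 0"
  proof (rule ccontr)
    assume "z \<notin> padic p 0"
    then have "z \<noteq> 0" "inverse z \<in> padic p 1" using rational_cases[OF \<open>z \<in> \<rat>\<close>] by auto
    then have "inverse z ^ 2 * z ^ 2 \<in> padic p 1"
      using padic_mult_left[OF _ z2p] padic_power_0 padic_mono by blast
    then show False using \<open>z \<noteq> 0\<close> one_not_padic[of 0] by (simp add: power_inverse)
  qed
  then have z1: "z \<in> padic p 1" using padic_prime[of z z] z2p by (auto simp: power2_eq_square)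
  have "1 / y = z * t" using x0 by (simp add: z_def t_def)
  also have "t = z ^ 2 * v" using z2 v0 by simp
  finally have "1 / y = v * z ^ 3" by (simp add: power2_eq_square power3_eq_cube)
  moreover have "v * z ^ 3 \<in> padic p (3 * 1)" using v padic_power[OF z1, of 3] padic_mult_left by blast
  ultimately show ?thesis using on y0 z1 by (simp add: z_def)
qed

lemma torsion_integral:
  assumes "torsion (Some (x, y))" "x \<in> \<rat>" "y \<in> \<rat>"
  shows "x \<in> padic p 0"
  using assms kernel_torsion_free nonintegral_kernel torsion_def by blast

lemma torsion_integral':
  assumes "torsion (Some (x, y))" "x \<in> \<rat>" "y \<in> \<rat>"
  shows "y \<in> padic p 0"
proof (rule ccontr)
  assume "y \<notin> padic p 0"
  then have y: "y \<noteq> 0" "inverse y \<in> padic p 1" using rational_cases assms by auto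
  have x: "x \<in> padic p 0" using assms torsion_integral by blast
  have "y ^ 2 = x ^ 3 + a * x ^ 2 + b * x" using assms torsion_def by simp
  then have "y ^ 2 \<in> padic p 0" using x integral by (auto intro!: padic_intros)
  then have "inverse y * inverse y * y ^ 2 \<in> padic p (1 + 1 + 0)" using padic_mult y by blast
  then show False using y one_not_padic[of 1] by (simp add: power2_eq_square field_simps)
qed

text \<open>Reduction is injective on rational torsion. The difference of two distinct congruent
  points comes from a line through the first and the negative of the second; its slope is
  nonintegral, hence so is the abscissa of the difference, contradicting
  \<open>torsion_integral\<close>.\<close>

lemma torsion_congruent_eq:
  assumes good: "p \<noteq> 2" "b \<notin> padic p 1" "a ^ 2 - 4 * b \<notin> padic p 1"
    and P: "torsion (Some (x, y))" and T: "torsion (Some (x', y'))"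
    and rat: "x \<in> \<rat>" "y \<in> \<rat>" "x' \<in> \<rat>" "y' \<in> \<rat>"
    and cong: "x - x' \<in> padic p 1" "y - y' \<in> padic p 1"
  shows "x = x' \<and> y = y'"
proof (rule ccontr)
  assume ne: "\<not> (x = x' \<and> y = y')"
  have int: "x \<in> padic p 0" "y \<in> padic p 0" "x' \<in> padic p 0" "y' \<in> padic p 0"
    using P T rat torsion_integral torsion_integral' by blast+
  have on: "y ^ 2 = x ^ 3 + a * x ^ 2 + b * x" "(- y') ^ 2 = x' ^ 3 + a * x' ^ 2 + b * x'"
    using P T torsion_def by auto
  have ne': "\<not> (x = x' \<and> y = - (- y'))" using ne by simp
  obtain l where l: "is_slope a b x y x' (- y') l" using is_slope_exists[OF on ne'] by blast
  \<comment> \<open>An integral slope would give \<open>y + y'\<close> divisible by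
    \<open>p\<close>, hence \<open>y\<close> too as \<open>p\<close> is odd; then the cubic
    \<open>f\<close> and its derivative \<open>g\<close> would both vanish at \<open>x\<close>
    modulo \<open>p\<close>, against good reduction.\<close>
  have "l \<notin> padic p 0"
  proof
    assume li: "l \<in> padic p 0"
    have "y + y' = l * (x - x')" using l unfolding is_slope_def by algebra
    then have "y + y' \<in> padic p 1" using padic_mult_left[OF li cong(1)] by simp
    then have "2 * y \<in> padic p 1" using padic_add[OF _ cong(2)] by fastforce
    moreover have "2 \<notin> padic p 1"
    proof
      assume "2 \<in> padic p 1"
      then have "p dvd 2" using of_int_padic_iff[of 2 1] by simp
      with prime_p have "p = 2" using primes_dvd_imp_eq[of p 2] by simp
      with good show False by blast
    qed
    ultimately have y1: "y \<in> padic p 1" using padic_prime[of 2 y] int by auto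
    define f where "f = x ^ 3 + a * x ^ 2 + b * x"
    define g where "g = 3 * x ^ 2 + 2 * a * x + b"
    have f: "f \<in> padic p 1" unfolding f_def on(1)[symmetric]
      using padic_mult_left[OF int(2) y1] by (simp add: power2_eq_square)
    have "l * (y - y') \<in> padic p 1" using padic_mult_left[OF li cong(2)] .
    moreover have "g = l * (y - y') + (2 * x + x' + a) * (x - x')"
      using l unfolding is_slope_def g_def by algebra
    moreover have "(2 * x + x' + a) * (x - x') \<in> padic p 1"
      using cong(1) int integral by (intro padic_mult_left) (auto intro!: padic_intros)
    ultimately have g: "g \<in> padic p 1" using padic_add by simp
    \<comment> \<open>A Bezout identity expressing the discriminant of the cubic through
      \<open>f\<close> and \<open>g\<close>, with integral coefficients.\<close>
    have "b ^ 2 * (a ^ 2 - 4 * b) = (a ^ 2 * b - 4 * b ^ 2 + (2 * a ^ 3 - 7 * a * b) * x + (2 * a ^ 2 - 6 * b) * x ^ 2) * g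
        + (- 6 * a ^ 2 + 18 * b) * x * f + (- 4 * a ^ 3 + 15 * a * b) * f"
      unfolding f_def g_def by algebra
    moreover have "\<dots> \<in> padic p 1"
      using f g int integral
      by (intro padic_add padic_mult_left) (auto intro!: padic_intros)
    ultimately have "b * (b * (a ^ 2 - 4 * b)) \<in> padic p 1" by (simp add: power2_eq_square mult.assoc)
    moreover have "a ^ 2 - 4 * b \<in> padic p 0" using integral by (auto intro!: padic_intros)
    ultimately show False
      using padic_prime[of b "b * (a ^ 2 - 4 * b)"] padic_prime[of b "a ^ 2 - 4 * b"] good integral
        padic_mult_left by blast
  qed
  moreover have lr: "l \<in> \<rat>"
  proof (cases "x = x'")
    case False
    then have "l = (- y' - y) / (x' - x)" using l unfolding is_slope_def by (simp add: field_simps)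
    then show ?thesis using rat by simp
  next
    case True
    then have "y \<noteq> y'" using ne by blast
    then have "l = (x ^ 2 + x * x' + x' ^ 2 + a * (x + x') + b) / (y - y')"
      using l unfolding is_slope_def by (simp add: field_simps)
    then show ?thesis using rat integral padic_Rats by simp
  qed
  ultimately have l0: "l \<noteq> 0" "inverse l \<in> padic p 1" using rational_cases by blast+
  define x3 where "x3 = l ^ 2 - a - x - x'"
  have sum: "Some (x, y) \<oplus>\<^sub>E Some (x', - y') = Some (x3, l * (x - x3) - y)"
    using cubic_add_slope[OF l ne'] unfolding x3_def .
  have "x3 \<notin> padic p 0"
  proof
    assume "x3 \<in> padic p 0"
    then have "x3 + a + x + x' \<in> padic p 0" using int integral padic_add by simp
    then have "l ^ 2 \<in> padic p 0" by (simp add: x3_def)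
    then have "inverse l * inverse l * l ^ 2 \<in> padic p (1 + 1 + 0)" using padic_mult l0 by blast
    then show False using l0 one_not_padic[of 1] by (simp add: power2_eq_square field_simps)
  qed
  moreover have "x3 \<in> \<rat>" using lr rat integral padic_Rats by (simp add: x3_def)
  moreover have "l * (x - x3) - y \<in> \<rat>" using \<open>x3 \<in> \<rat>\<close> lr rat by simp
  moreover have "torsion (Some (x3, l * (x - x3) - y))"
    using torsion_add[OF P torsion_neg[OF T]] sum by simp
  ultimately show False using torsion_integral by blast
qed

end

section \<open>Groups and coordinate changes\<close>

context comm_group
begin

lemma nat_pow_mod:
  assumes "x \<in> carrier G" "x [^] m = \<one>"
  shows "x [^] (n mod m :: nat) = x [^] n"
proof -
  have "x [^] n = x [^] (m * (n div m) + n mod m)" by simp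
  also have "\<dots> = (x [^] m) [^] (n div m) \<otimes> x [^] (n mod m)"
    using assms(1) by (simp add: nat_pow_mult nat_pow_pow)
  finally show ?thesis using assms by simp
qed

lemma nat_pow_eq_one_iff_prime:
  assumes "x \<in> carrier G" "x \<noteq> \<one>" "prime l" "x [^] (l::nat) = \<one>"
  shows "x [^] (n::nat) = \<one> \<longleftrightarrow> l dvd n"
proof
  assume n: "x [^] n = \<one>"
  show "l dvd n"
  proof (rule ccontr)
    assume "\<not> l dvd n"
    then have "coprime n l" using assms(3) prime_imp_coprime coprime_commute by blast
    have "n \<noteq> 0" using \<open>\<not> l dvd n\<close> by (metis dvd_0_right)
    then obtain u v where "n * u = l * v + gcd n l" using bezout_nat by blast
    then have uv: "n * u = l * v + 1" using \<open>coprime n l\<close> by simp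
    have "x = x [^] (l * v + 1)" using assms by (simp add: nat_pow_mult[symmetric] nat_pow_pow[symmetric])
    also have "\<dots> = (x [^] n) [^] u" unfolding uv[symmetric] using assms by (simp add: nat_pow_pow)
    finally show False using n assms by simp
  qed
qed (use assms nat_pow_pow[of x l] in \<open>auto simp: dvd_def\<close>)

text \<open>The product of \<open>r\<close>, of order 4, and \<open>s\<close>, of order 3, has order
  12 and generates both, so with \<open>t\<close> it generates \<open>H\<close>. The condition
  \<open>t \<noteq> r \<otimes> r\<close> keeps \<open>t\<close> out of the cyclic part, whose only
  element of order 2 is \<open>r \<otimes> r\<close>.\<close>

lemma Z2_Z12_parametrization:
  assumes c: "t \<in> carrier G" "r \<in> carrier G" "s \<in> carrier G"
    and t: "t \<noteq> \<one>" "t \<otimes> t = \<one>"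
    and r: "r \<otimes> r \<noteq> \<one>" "(r \<otimes> r) \<otimes> (r \<otimes> r) = \<one>" "t \<noteq> r \<otimes> r"
    and s: "s \<noteq> \<one>" "s \<otimes> s \<otimes> s = \<one>"
    and H: "H = {t [^] (i::nat) \<otimes> (r [^] (j::nat) \<otimes> s [^] (k::nat)) | i j k. True}"
  obtains f :: "nat \<times> nat \<Rightarrow> 'a" where "bij_betw f ({..<2} \<times> {..<12}) H"
    "\<And>i j i' j'. f ((i + i') mod 2, (j + j') mod 12) = f (i, j) \<otimes> f (i', j')"
proof -
  define q where "q = r \<otimes> s"
  define f where "f = (\<lambda>(i::nat, j::nat). t [^] i \<otimes> q [^] j)"
  have q: "q \<in> carrier G" using c by (simp add: q_def)
  have t2: "t [^] (2::nat) = \<one>" using t c by (simp add: numeral_2_eq_2)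
  have r2: "r [^] (2::nat) = r \<otimes> r" using c by (simp add: numeral_2_eq_2)
  have r4: "r [^] (4::nat) = \<one>"
    using nat_pow_mult[of r 2 2] c r by (simp add: r2)
  have rr2: "(r \<otimes> r) [^] (2::nat) = \<one>" using c r by (simp add: numeral_2_eq_2)
  have s3: "s [^] (3::nat) = \<one>" using s c by (simp add: numeral_3_eq_3)
  have pow0: "x [^] (m * n) = \<one>" if "x [^] m = \<one>" "x \<in> carrier G" for x and m n :: nat
    using that by (metis nat_pow_one nat_pow_pow)
  have qj: "q [^] j = r [^] j \<otimes> s [^] j" for j :: nat
    using c by (simp add: q_def nat_pow_distrib)
  have q12: "q [^] (12::nat) = \<one>"
    using pow0[of r 4 3] pow0[of s 3 4] r4 s3 c by (simp add: qj)
  \<comment> \<open>The fourth power removes \<open>t\<close> and \<open>r\<close> and yields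
    \<open>3 dvd j\<close>; the square then removes \<open>t\<close> and yields
    \<open>even j\<close>. What remains is a relation in the four-group of \<open>t\<close> and
    \<open>r \<otimes> r\<close>.\<close>
  have triv: "even i \<and> 12 dvd j" if eq: "t [^] i \<otimes> q [^] j = \<one>" for i j :: nat
  proof -
    have "(t [^] i \<otimes> q [^] j) [^] (4::nat) = t [^] (2 * (2 * i)) \<otimes> (r [^] (4 * j) \<otimes> s [^] (4 * j))"
      using c q by (simp add: nat_pow_distrib nat_pow_pow qj mult.commute)
    also have "\<dots> = \<one> \<otimes> (\<one> \<otimes> s [^] (4 * j))"
      unfolding pow0[OF t2 c(1)] pow0[OF r4 c(2)] ..
    finally have "s [^] (4 * j) = \<one>"
      unfolding eq using c by (metis l_one nat_pow_closed nat_pow_one)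
    then have "3 dvd 4 * j"
      using nat_pow_eq_one_iff_prime[of s 3 "4 * j"] c s s3 by simp
    then have j3: "3 dvd j" by presburger
    then have "s [^] j = \<one>" using pow0[OF s3] c by (auto simp: dvd_def)
    then have eq': "t [^] i \<otimes> r [^] j = \<one>" using eq c by (simp add: qj)
    then have "(t [^] i \<otimes> r [^] j) [^] (2::nat) = \<one>" by simp
    moreover have "(t [^] i \<otimes> r [^] j) [^] (2::nat) = t [^] (2 * i) \<otimes> (r \<otimes> r) [^] j"
      unfolding r2[symmetric] using c by (simp add: nat_pow_distrib nat_pow_pow mult.commute)
    ultimately have "(r \<otimes> r) [^] j = \<one>" using pow0[OF t2] c by simp
    then have "even j"
      using nat_pow_eq_one_iff_prime[of "r \<otimes> r" 2 j] c r rr2 two_is_prime_nat by simp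
    then obtain m where m: "j = 2 * m" by blast
    have eq2: "t [^] (i mod 2) \<otimes> (r \<otimes> r) [^] (m mod 2) = \<one>"
    proof -
      have "t [^] (i mod 2) = t [^] i" using nat_pow_mod c t2 by blast
      moreover have "(r \<otimes> r) [^] (m mod 2) = (r \<otimes> r) [^] m"
        using nat_pow_mod[of "r \<otimes> r" 2 m] c rr2 by simp
      moreover have "(r \<otimes> r) [^] m = r [^] j" unfolding m r2[symmetric] using c by (simp add: nat_pow_pow)
      ultimately show ?thesis using eq' by simp
    qed
    have "\<not> (i mod 2 = 1 \<and> m mod 2 = 1)"
    proof
      assume "i mod 2 = 1 \<and> m mod 2 = 1"
      then have "t \<otimes> (r \<otimes> r) = \<one>" using eq2 c by simp
      then have "t \<otimes> (r \<otimes> r) = t \<otimes> t" using t by simp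
      then show False using r c by simp
    qed
    moreover have "\<not> (i mod 2 = 1 \<and> m mod 2 = 0)"
    proof
      assume "i mod 2 = 1 \<and> m mod 2 = 0"
      then have "t = \<one>" using eq2 c by simp
      then show False using t by simp
    qed
    moreover have "\<not> (i mod 2 = 0 \<and> m mod 2 = 1)"
    proof
      assume "i mod 2 = 0 \<and> m mod 2 = 1"
      then have "r \<otimes> r = \<one>" using eq2 c by simp
      then show False using r by simp
    qed
    ultimately have "i mod 2 = 0 \<and> m mod 2 = 0" by presburger
    then show ?thesis using m j3 by presburger
  qed
  have mult: "f ((i + i') mod 2, (j + j') mod 12) = f (i, j) \<otimes> f (i', j')" for i i' j j'
  proof -
    have "f ((i + i') mod 2, (j + j') mod 12) = t [^] (i + i') \<otimes> q [^] (j + j')"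
      using nat_pow_mod[OF c(1) t2] nat_pow_mod[OF q q12] by (simp add: f_def)
    also have "\<dots> = f (i, j) \<otimes> f (i', j')"
      using c q by (simp add: f_def nat_pow_mult[symmetric] m_ac)
    finally show ?thesis .
  qed
  have inj: "inj_on f ({..<2} \<times> {..<12})"
  proof (rule inj_onI, clarsimp)
    fix i j i' j' :: nat
    assume b: "i < 2" "j < 12" "i' < 2" "j' < 12" and eq: "f (i, j) = f (i', j')"
    \<comment> \<open>Exponents are natural numbers, so \<open>2 - i'\<close> and
      \<open>12 - j'\<close> stand in for the negatives of \<open>i'\<close> and
      \<open>j'\<close>.\<close>
    have "t [^] (i + (2 - i')) \<otimes> q [^] (j + (12 - j')) = f (i, j) \<otimes> (t [^] (2 - i') \<otimes> q [^] (12 - j'))"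
      using c q by (simp add: f_def nat_pow_mult[symmetric] m_ac)
    also have "\<dots> = f (i', j') \<otimes> (t [^] (2 - i') \<otimes> q [^] (12 - j'))" by (simp add: eq)
    also have "\<dots> = t [^] (i' + (2 - i')) \<otimes> q [^] (j' + (12 - j'))"
      using c q by (simp add: f_def nat_pow_mult[symmetric] m_ac)
    also have "\<dots> = \<one>" using b t2 q12 by simp
    finally have "even (i + (2 - i')) \<and> 12 dvd (j + (12 - j'))" by (rule triv)
    then obtain u v where "i + (2 - i') = 2 * u" "j + (12 - j') = 12 * v" by (elim conjE dvdE)
    moreover from this b have "u = 1" "v = 1" by linarith+
    ultimately show "i = i' \<and> j = j'" using b by linarith
  qed
  have surj: "f ` ({..<2} \<times> {..<12}) = H"
  proof
    show "f ` ({..<2} \<times> {..<12}) \<subseteq> H" unfolding H f_def using qj by auto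
    show "H \<subseteq> f ` ({..<2} \<times> {..<12})"
    proof
      fix x assume "x \<in> H"
      then obtain i j k :: nat where x: "x = t [^] i \<otimes> (r [^] j \<otimes> s [^] k)" unfolding H by blast
      \<comment> \<open>Chinese remainders: \<open>9 * j + 4 * k\<close> is \<open>j\<close> modulo
        4 and \<open>k\<close> modulo 3.\<close>
      have "r [^] (9 * j + 4 * k) = r [^] ((9 * j + 4 * k) mod 4)" using nat_pow_mod[OF c(2) r4] by metis
      also have "(9 * j + 4 * k) mod 4 = j mod 4" by presburger
      finally have rj: "r [^] (9 * j + 4 * k) = r [^] j" using nat_pow_mod[OF c(2) r4] by metis
      have "s [^] (9 * j + 4 * k) = s [^] ((9 * j + 4 * k) mod 3)" using nat_pow_mod[OF c(3) s3] by metis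
      also have "(9 * j + 4 * k) mod 3 = k mod 3" by presburger
      finally have sk: "s [^] (9 * j + 4 * k) = s [^] k" using nat_pow_mod[OF c(3) s3] by metis
      have "x = f (i mod 2, (9 * j + 4 * k) mod 12)"
        unfolding x f_def using nat_pow_mod[OF c(1) t2] nat_pow_mod[OF q q12] qj rj sk by simp
      then show "x \<in> f ` ({..<2} \<times> {..<12})" by force
    qed
  qed
  show ?thesis using that mult inj surj by (auto simp: bij_betw_def)
qed

end

section \<open>Affine changes of coordinates between cubic models\<close>

fun affine_map :: "complex \<Rightarrow> complex \<Rightarrow> complex \<Rightarrow> point \<Rightarrow> point" where
  "affine_map \<kappa> c \<kappa>' None = None"
| "affine_map \<kappa> c \<kappa>' (Some (x, y)) = Some (\<kappa> * x + c, \<kappa>' * y)"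

text \<open>The last three hypotheses compare the coefficients of \<open>x^3\<close>,
  \<open>x^2\<close> and \<open>x\<close> after substituting \<open>X = \<kappa> x + c\<close>,
  \<open>Y = \<kappa>' y\<close> into the monic equation. The constant coefficient does not enter
  the addition formulas.\<close>

lemma affine_map_cubic_add:
  assumes nz: "A \<noteq> 0" "\<kappa> \<noteq> 0" "\<kappa>' \<noteq> 0" and 1: "\<kappa>' ^ 2 * A = \<kappa> ^ 3"
    and 2: "(a + 3 * c) * A = \<kappa> * B" and 3: "(3 * c ^ 2 + 2 * a * c + b) * A = \<kappa> ^ 2 * C"
  shows "affine_map \<kappa> c \<kappa>' (cubic_add A B C P Q) = cubic_add 1 a b (affine_map \<kappa> c \<kappa>' P) (affine_map \<kappa> c \<kappa>' Q)"
proof (cases P; cases Q)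
  fix u v assume "P = Some u" "Q = Some v"
  then obtain x1 y1 x2 y2 where PQ: "P = Some (x1, y1)" "Q = Some (x2, y2)"
    by (cases u; cases v) auto
  show ?thesis
  proof (cases "x1 = x2 \<and> y1 = - y2")
    case True
    then show ?thesis by (simp add: PQ)
  next
    case False
    define l where "l = (if x1 \<noteq> x2 then (y2 - y1) / (x2 - x1) else (3 * A * x1 ^ 2 + 2 * B * x1 + C) / (2 * y1))"
    define L where "L = (if \<kappa> * x1 + c \<noteq> \<kappa> * x2 + c then (\<kappa>' * y2 - \<kappa>' * y1) / ((\<kappa> * x2 + c) - (\<kappa> * x1 + c))
      else (3 * 1 * (\<kappa> * x1 + c) ^ 2 + 2 * a * (\<kappa> * x1 + c) + b) / (2 * (\<kappa>' * y1)))"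
    have Ll: "L = \<kappa>' / \<kappa> * l"
    proof (cases "x1 = x2")
      case False
      have "(\<kappa>' * y2 - \<kappa>' * y1) / ((\<kappa> * x2 + c) - (\<kappa> * x1 + c)) = (\<kappa>' * (y2 - y1)) / (\<kappa> * (x2 - x1))"
        by (simp add: algebra_simps)
      then show ?thesis using False nz by (simp add: L_def l_def)
    next
      case True
      have "A * (3 * (\<kappa> * x1 + c) ^ 2 + 2 * a * (\<kappa> * x1 + c) + b) = \<kappa> ^ 2 * (3 * A * x1 ^ 2 + 2 * B * x1 + C)"
        using 2 3 by algebra
      then have e: "3 * (\<kappa> * x1 + c) ^ 2 + 2 * a * (\<kappa> * x1 + c) + b = \<kappa> ^ 2 * (3 * A * x1 ^ 2 + 2 * B * x1 + C) / A"
        using nz(1) by (metis nonzero_mult_div_cancel_left)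
      have k: "\<kappa> ^ 2 / A / \<kappa>' = \<kappa>' / \<kappa>"
        using 1 nz by (simp add: field_simps power2_eq_square power3_eq_cube)
      have "\<kappa> ^ 2 * N / A / (2 * (\<kappa>' * y1)) = \<kappa> ^ 2 / A / \<kappa>' * (N / (2 * y1))" for N
        by (simp add: ac_simps)
      then have "\<kappa> ^ 2 * N / A / (2 * (\<kappa>' * y1)) = \<kappa>' / \<kappa> * (N / (2 * y1))" for N
        unfolding k .
      with e show ?thesis using True by (simp only: L_def l_def if_False simp_thms mult_1_right)
    qed
    have L2: "L ^ 2 = \<kappa> * (l ^ 2 / A)"
    proof -
      have "\<kappa>' ^ 2 / \<kappa> ^ 2 = \<kappa> / A"
        using 1 nz by (simp add: field_simps power2_eq_square power3_eq_cube)
      then have "(\<kappa>' / \<kappa>) ^ 2 * l ^ 2 = \<kappa> / A * l ^ 2" by (simp only: power_divide)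
      then show ?thesis unfolding Ll power_mult_distrib by simp
    qed
    have a: "a = \<kappa> * (B / A) - 3 * c" using 2 nz by (simp add: field_simps)
    define x3 where "x3 = (l ^ 2 - B) / A - x1 - x2"
    have X3: "(L ^ 2 - a) / 1 - (\<kappa> * x1 + c) - (\<kappa> * x2 + c) = \<kappa> * x3 + c"
      unfolding L2 a x3_def by (simp add: algebra_simps diff_divide_distrib)
    have Y3: "L * ((\<kappa> * x1 + c) - (\<kappa> * x3 + c)) - \<kappa>' * y1 = \<kappa>' * (l * (x1 - x3) - y1)"
      unfolding Ll using nz by (simp add: field_simps)
    have F: "\<not> (\<kappa> * x1 + c = \<kappa> * x2 + c \<and> \<kappa>' * y1 = - (\<kappa>' * y2))"
      using False nz by (metis add_right_cancel mult_left_cancel mult_minus_right)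
    have "cubic_add A B C P Q = Some (x3, l * (x1 - x3) - y1)"
      unfolding PQ cubic_add.simps using False by (simp only: if_False l_def[symmetric] Let_def x3_def[symmetric])
    moreover have "cubic_add 1 a b (affine_map \<kappa> c \<kappa>' P) (affine_map \<kappa> c \<kappa>' Q) =
       Some (\<kappa> * x3 + c, L * ((\<kappa> * x1 + c) - (\<kappa> * x3 + c)) - \<kappa>' * y1)"
      unfolding PQ affine_map.simps cubic_add.simps using F by (simp only: if_False L_def[symmetric] Let_def X3)
    ultimately show ?thesis by (simp only: Y3 affine_map.simps)
  qed
qed auto

lemma affine_map_inj: "\<kappa> \<noteq> 0 \<Longrightarrow> \<kappa>' \<noteq> 0 \<Longrightarrow> affine_map \<kappa> c \<kappa>' P = affine_map \<kappa> c \<kappa>' Q \<Longrightarrow> P = Q"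
  by (cases P rule: ell_neg.cases; cases Q rule: ell_neg.cases) auto

lemma cubic_mult_affine_map:
  assumes "A \<noteq> 0" "\<kappa> \<noteq> 0" "\<kappa>' \<noteq> 0" "\<kappa>' ^ 2 * A = \<kappa> ^ 3"
    "(a + 3 * c) * A = \<kappa> * B" "(3 * c ^ 2 + 2 * a * c + b) * A = \<kappa> ^ 2 * C"
  shows "affine_map \<kappa> c \<kappa>' (cubic_mult A B C n P) = cubic_mult 1 a b n (affine_map \<kappa> c \<kappa>' P)"
  by (induction n) (simp_all add: affine_map_cubic_add[OF assms])

lemma (in elliptic) cubic_mult_eq_pow:
  assumes "P \<in> E"
  shows "cubic_mult 1 a b n P = P [^]\<^bsub>ell_group a b\<^esub> n"
proof -
  interpret G: comm_group "ell_group a b" by (rule comm_group_ell)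
  show ?thesis
  proof (induction n)
    case (Suc n)
    have "P [^]\<^bsub>ell_group a b\<^esub> n \<in> E" using G.nat_pow_closed[of P n] assms by simp
    then show ?case using Suc assms cubic_add_commute by simp
  qed simp
qed

section \<open>Congruences between p-integral rationals\<close>

context prime_int
begin

definition pcong :: "complex \<Rightarrow> complex \<Rightarrow> bool" where
  "pcong x y \<longleftrightarrow> x \<in> padic p 0 \<and> y \<in> padic p 0 \<and> x - y \<in> padic p 1"

lemma pcong_refl: "x \<in> padic p 0 \<Longrightarrow> pcong x x"
  by (simp add: pcong_def)

lemma pcong_sym: "pcong x y \<Longrightarrow> pcong y x"
  using padic_minus[of "x - y" 1] by (simp add: pcong_def)

lemma pcong_trans: "pcong x y \<Longrightarrow> pcong y z \<Longrightarrow> pcong x z"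
  using padic_add[of "x - y" 1 "y - z"] by (simp add: pcong_def)

lemma pcong_add: "pcong x y \<Longrightarrow> pcong x' y' \<Longrightarrow> pcong (x + x') (y + y')"
  using padic_add[of "x - y" 1 "x' - y'"] by (simp add: pcong_def padic_add algebra_simps)

lemma pcong_minus: "pcong x y \<Longrightarrow> pcong (- x) (- y)"
  using padic_minus[of "x - y" 1] by (simp add: pcong_def padic_minus)

lemma pcong_diff: "pcong x y \<Longrightarrow> pcong x' y' \<Longrightarrow> pcong (x - x') (y - y')"
  using pcong_add[of x y "- x'" "- y'"] pcong_minus by simp

lemma pcong_mult:
  assumes "pcong x y" "pcong x' y'" shows "pcong (x * x') (y * y')"
proof -
  have "x * (x' - y') + y' * (x - y) \<in> padic p 1"
    using assms unfolding pcong_def by (intro padic_add padic_mult_left) auto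
  then have "x * x' - y * y' \<in> padic p 1" by (simp add: algebra_simps)
  then show ?thesis using assms by (simp add: pcong_def padic_mult_left)
qed

lemma pcong_power: "pcong x y \<Longrightarrow> pcong (x ^ n) (y ^ n)"
  by (induction n) (auto intro: pcong_mult pcong_refl)

lemmas pcong_intros = pcong_add pcong_minus pcong_diff pcong_mult pcong_power

lemma pcong_of_int: "pcong (of_int m) (of_int n) \<longleftrightarrow> p dvd m - n"
  using of_int_padic_iff[of "m - n" 1] by (simp add: pcong_def)

lemma pcong_0: "pcong x 0 \<longleftrightarrow> x \<in> padic p 1"
  by (auto simp: pcong_def intro: padic_mono)

lemma residue_exists:
  assumes "x \<in> padic p 0"
  obtains r where "0 \<le> r" "r < p" "pcong x (of_int r)"
proof -
  obtain m n where *: "x = of_int (p ^ 0 * m) / of_int n" "\<not> p dvd n" "n \<noteq> 0"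
    using assms by (rule padicE)
  have "coprime n p" using *(2) prime_p prime_imp_coprime coprime_commute by blast
  then obtain u v where uv: "u * n + v * p = 1" using bezout_int[of n p] by auto
  define r where "r = (m * u) mod p"
  have "m - r * n = (m * u - r) * n + m * (1 - u * n)" by (simp add: algebra_simps)
  also have "1 - u * n = v * p" using uv by simp
  finally have "m - r * n = (m * u - r) * n + m * v * p" by simp
  moreover have "p dvd m * u - r" by (simp add: r_def)
  ultimately have "p dvd m - r * n" by simp
  then obtain d where d: "m - r * n = p * d" by blast
  have "x - of_int r = of_int (m - r * n) / of_int n" using * by (simp add: field_simps)
  then have "x - of_int r \<in> padic p 1" unfolding d using * by (intro padicI) auto
  then have "pcong x (of_int r)" using assms by (simp add: pcong_def)
  moreover have "0 \<le> r" "r < p" using prime_p prime_gt_0_int[of p] by (simp_all add: r_def)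
  ultimately show ?thesis using that by blast
qed

end

section \<open>Points over a quadratic field\<close>

locale quadratic_extension =
  fixes \<alpha> :: complex
  assumes alpha_sq: "\<alpha> ^ 2 \<in> \<rat>" and alpha_irrational: "\<alpha> \<notin> \<rat>"
begin

definition K :: "complex set" where
  "K = {u + v * \<alpha> | u v. u \<in> \<rat> \<and> v \<in> \<rat>}"

lemma K_I: "u \<in> \<rat> \<Longrightarrow> v \<in> \<rat> \<Longrightarrow> u + v * \<alpha> \<in> K"
  unfolding K_def by blast

lemma K_E:
  assumes "x \<in> K" obtains u v where "u \<in> \<rat>" "v \<in> \<rat>" "x = u + v * \<alpha>"
  using assms unfolding K_def by blast

lemma K_unique:
  assumes "u \<in> \<rat>" "v \<in> \<rat>" "u' \<in> \<rat>" "v' \<in> \<rat>" "u + v * \<alpha> = u' + v' * \<alpha>"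
  shows "u = u' \<and> v = v'"
proof (cases "v = v'")
  case False
  then have "\<alpha> = (u' - u) / (v - v')" using assms(5) by (simp add: field_simps)
  then have "\<alpha> \<in> \<rat>" using assms by simp
  then show ?thesis using alpha_irrational by blast
qed (use assms in simp)

lemma K_Rats: "x \<in> \<rat> \<Longrightarrow> x \<in> K"
  using K_I[of x 0] by simp

lemma K_alpha: "\<alpha> \<in> K"
  using K_I[of 0 1] by simp

text \<open>Conjugation is fixed by description because \<open>K\<close> is a set of complex numbers
  without coordinate functions; the value is meaningful only on \<open>K\<close>, where
  \<open>K_unique\<close> determines the coordinates.\<close>

definition galois :: "complex \<Rightarrow> complex" where
  "galois x = (THE y. \<exists>u\<in>\<rat>. \<exists>v\<in>\<rat>. x = u + v * \<alpha> \<and> y = u - v * \<alpha>)"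

lemma galois_eq: "u \<in> \<rat> \<Longrightarrow> v \<in> \<rat> \<Longrightarrow> galois (u + v * \<alpha>) = u - v * \<alpha>"
  unfolding galois_def by (rule the_equality) (use K_unique in blast)+

lemma galois_rat: "u \<in> \<rat> \<Longrightarrow> galois u = u"
  using galois_eq[of u 0] by simp

lemma galois_K: "x \<in> K \<Longrightarrow> galois x \<in> K"
  by (elim K_E) (use K_I[of _ "- _"] in \<open>auto simp: galois_eq\<close>)

lemma galois_minus: "x \<in> K \<Longrightarrow> - x \<in> K \<and> galois (- x) = - galois x"
proof (elim K_E)
  fix u v assume *: "u \<in> \<rat>" "v \<in> \<rat>" "x = u + v * \<alpha>"
  have "- x = - u + (- v) * \<alpha>" using * by simp
  then show ?thesis using K_I[of "- u" "- v"] galois_eq[of "- u" "- v"] galois_eq[of u v] * by simp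
qed

lemma galois_add: "x \<in> K \<Longrightarrow> y \<in> K \<Longrightarrow> x + y \<in> K \<and> galois (x + y) = galois x + galois y"
proof (elim K_E)
  fix u v u' v' assume *: "u \<in> \<rat>" "v \<in> \<rat>" "x = u + v * \<alpha>" "u' \<in> \<rat>" "v' \<in> \<rat>" "y = u' + v' * \<alpha>"
  have "x + y = (u + u') + (v + v') * \<alpha>" using * by (simp add: algebra_simps)
  moreover have "galois x = u - v * \<alpha>" "galois y = u' - v' * \<alpha>" using * by (simp_all add: galois_eq)
  moreover have "(u + u') - (v + v') * \<alpha> = (u - v * \<alpha>) + (u' - v' * \<alpha>)" by (simp add: algebra_simps)
  ultimately show ?thesis using K_I[of "u + u'" "v + v'"] galois_eq[of "u + u'" "v + v'"] *(1,2,4,5) by simp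
qed

lemma galois_diff: "x \<in> K \<Longrightarrow> y \<in> K \<Longrightarrow> x - y \<in> K \<and> galois (x - y) = galois x - galois y"
  using galois_add[of x "- y"] galois_minus[of y] by simp

lemma galois_mult: "x \<in> K \<Longrightarrow> y \<in> K \<Longrightarrow> x * y \<in> K \<and> galois (x * y) = galois x * galois y"
proof (elim K_E)
  fix u v u' v' assume *: "u \<in> \<rat>" "v \<in> \<rat>" "x = u + v * \<alpha>" "u' \<in> \<rat>" "v' \<in> \<rat>" "y = u' + v' * \<alpha>"
  define s t where "s = u * u' + v * v' * \<alpha> ^ 2" "t = u * v' + v * u'"
  have st: "s \<in> \<rat>" "t \<in> \<rat>" using * alpha_sq by (simp_all add: s_t_def)
  have "x * y = s + t * \<alpha>" using * by (simp add: s_t_def algebra_simps power2_eq_square)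
  moreover have cxy: "galois x = u - v * \<alpha>" "galois y = u' - v' * \<alpha>" using * by (simp_all add: galois_eq)
  moreover have "galois x * galois y = s - t * \<alpha>"
    unfolding cxy by (simp add: s_t_def algebra_simps power2_eq_square)
  ultimately show ?thesis using K_I[OF st] galois_eq[OF st] by simp
qed

lemma galois_inverse: "x \<in> K \<Longrightarrow> inverse x \<in> K \<and> galois (inverse x) = inverse (galois x)"
proof (cases "x = 0")
  case True
  then show ?thesis using K_Rats[of 0] galois_rat[of 0] by simp
next
  case False
  assume "x \<in> K"
  then obtain u v where *: "u \<in> \<rat>" "v \<in> \<rat>" "x = u + v * \<alpha>" by (rule K_E)
  define n where "n = u ^ 2 - v ^ 2 * \<alpha> ^ 2"
  have n: "n \<in> \<rat>" using * alpha_sq by (simp add: n_def)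
  have nx: "n = x * (u - v * \<alpha>)" using * by (simp add: n_def algebra_simps power2_eq_square)
  have "u - v * \<alpha> \<noteq> 0"
  proof
    assume "u - v * \<alpha> = 0"
    then have "u + (- v) * \<alpha> = 0 + 0 * \<alpha>" by simp
    then have "u = 0 \<and> - v = 0" using * by (intro K_unique) auto
    then show False using False * by simp
  qed
  then have "inverse x = (u - v * \<alpha>) / n" unfolding nx using False by (simp add: inverse_eq_divide)
  then have inv: "inverse x = u / n + (- v / n) * \<alpha>" by (simp add: diff_divide_distrib)
  then have iK: "inverse x \<in> K" using K_I[of "u / n" "- v / n"] * n by simp
  have "galois (x * inverse x) = galois x * galois (inverse x)" using galois_mult[OF \<open>x \<in> K\<close> iK] by simp
  then have "galois x * galois (inverse x) = 1" using False galois_rat[of 1] by simp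
  then have "galois (inverse x) = inverse (galois x)" using inverse_unique by metis
  with iK show ?thesis by simp
qed

lemma galois_divide: "x \<in> K \<Longrightarrow> y \<in> K \<Longrightarrow> x / y \<in> K \<and> galois (x / y) = galois x / galois y"
  using galois_inverse[of y] galois_mult[of x "inverse y"] by (simp add: divide_inverse)

lemma galois_power: "x \<in> K \<Longrightarrow> x ^ n \<in> K \<and> galois (x ^ n) = galois x ^ n"
  by (induction n) (use K_Rats[of 1] galois_rat[of 1] galois_mult in auto)

lemma galois_conj: "x \<in> K \<Longrightarrow> galois (galois x) = x"
proof (elim K_E)
  fix u v assume *: "u \<in> \<rat>" "v \<in> \<rat>" "x = u + v * \<alpha>"
  then show ?thesis using galois_eq[of u "- v"] by (simp add: galois_eq)
qed

lemma galois_inj: "x \<in> K \<Longrightarrow> y \<in> K \<Longrightarrow> galois x = galois y \<longleftrightarrow> x = y"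
  using galois_conj by metis

lemma galois_fixed: "x \<in> K \<Longrightarrow> galois x = x \<Longrightarrow> x \<in> \<rat>"
proof (elim K_E)
  fix u v assume *: "u \<in> \<rat>" "v \<in> \<rat>" "x = u + v * \<alpha>" "galois x = x"
  then have "u + v * \<alpha> = u + (- v) * \<alpha>" by (simp add: galois_eq)
  then have "v = - v" using K_unique[of u v u "- v"] * by auto
  then show "x \<in> \<rat>" using * by simp
qed

text \<open>An element negated by conjugation is a rational multiple of \<alpha>. Rationality of
  \<open>x * \<alpha>\<close> is the form needed to pass to the quadratic twist.\<close>

lemma galois_negated: "x \<in> K \<Longrightarrow> galois x = - x \<Longrightarrow> x * \<alpha> \<in> \<rat>"
proof (elim K_E)
  fix u v assume *: "u \<in> \<rat>" "v \<in> \<rat>" "x = u + v * \<alpha>" "galois x = - x"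
  then have "u + (- v) * \<alpha> = (- u) + (- v) * \<alpha>" by (simp add: galois_eq)
  then have "u = - u" using K_unique[of u "- v" "- u" "- v"] * by auto
  then have "x * \<alpha> = v * \<alpha> ^ 2" using * by (simp add: power2_eq_square)
  then show "x * \<alpha> \<in> \<rat>" using * alpha_sq by simp
qed

lemmas K_closed = galois_add[THEN conjunct1] galois_diff[THEN conjunct1] galois_mult[THEN conjunct1]
  galois_divide[THEN conjunct1] galois_power[THEN conjunct1] galois_minus[THEN conjunct1]

lemma quadratic_field_K: "quadratic_field K"
proof -
  have "subfield_of_complex K"
    unfolding subfield_of_complex_def
    using K_Rats[of 0] K_Rats[of 1] galois_inverse by (auto intro: K_closed)
  moreover have "\<forall>q1 q2 :: rat. of_rat q1 * 1 + of_rat q2 * \<alpha> = 0 \<longrightarrow> q1 = 0 \<and> q2 = 0"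
    using K_unique[of "of_rat _" "of_rat _" 0 0] by auto
  moreover have "K = {of_rat q1 * 1 + of_rat q2 * \<alpha> | q1 q2 :: rat. True}"
    unfolding K_def Rats_def by auto
  ultimately show ?thesis
    unfolding quadratic_field_def
    by (intro conjI bexI[of _ 1] bexI[of _ \<alpha>]) (assumption | rule K_Rats K_alpha Rats_1)+
qed

section \<open>Points over the quadratic field and their conjugates\<close>

definition K_points :: "complex \<Rightarrow> complex \<Rightarrow> point set" where
  "K_points a b = {None} \<union> {Some (x, y) | x y. x \<in> K \<and> y \<in> K \<and> Some (x, y) \<in> ell_points a b}"

fun conj_point :: "point \<Rightarrow> point" where
  "conj_point None = None"
| "conj_point (Some (x, y)) = Some (galois x, galois y)"

lemma K_points_Some [simp]:
  "Some (x, y) \<in> K_points a b \<longleftrightarrow> x \<in> K \<and> y \<in> K \<and> y ^ 2 = x ^ 3 + a * x ^ 2 + b * x"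
  by (simp add: K_points_def)

lemma K_points_None [simp]: "None \<in> K_points a b"
  by (simp add: K_points_def)

lemma K_points_carrier: "P \<in> K_points a b \<Longrightarrow> P \<in> ell_points a b"
  by (auto simp: K_points_def)

lemma K_points_neg: "P \<in> K_points a b \<Longrightarrow> ell_neg P \<in> K_points a b"
  by (cases P rule: ell_neg.cases) (auto simp: galois_minus)

lemma conj_point_K_points:
  assumes "a \<in> \<rat>" "b \<in> \<rat>" "P \<in> K_points a b"
  shows "conj_point P \<in> K_points a b"
proof (cases P rule: ell_neg.cases)
  case (2 x y)
  have x: "x \<in> K" "y \<in> K" and eq: "y ^ 2 = x ^ 3 + a * x ^ 2 + b * x" using assms 2 by simp_all
  have ab: "a \<in> K" "b \<in> K" "galois a = a" "galois b = b" using assms K_Rats galois_rat by simp_all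
  have "galois (y ^ 2) = galois (x ^ 3 + a * x ^ 2 + b * x)" using eq by simp
  then have "galois y ^ 2 = galois x ^ 3 + a * galois x ^ 2 + b * galois x"
    using x ab by (simp add: galois_add galois_mult galois_power K_closed)
  then show ?thesis using 2 x by (simp add: galois_K)
qed simp

text \<open>One of the two slope equations always presents the slope as a quotient of elements of
  \<open>K\<close>; applying conjugation to both equations shows that its conjugate is the slope for
  the conjugate points.\<close>

lemma conj_point_add:
  assumes ab: "a \<in> \<rat>" "b \<in> \<rat>" and P: "P \<in> K_points a b" and Q: "Q \<in> K_points a b"
  shows "cubic_add 1 a b P Q \<in> K_points a b \<and>
    conj_point (cubic_add 1 a b P Q) = cubic_add 1 a b (conj_point P) (conj_point Q)"
proof (cases P; cases Q)
  fix u v assume "P = Some u" "Q = Some v"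
  then obtain x1 y1 x2 y2 where PQ: "P = Some (x1, y1)" "Q = Some (x2, y2)"
    by (cases u; cases v) auto
  have K: "x1 \<in> K" "y1 \<in> K" "x2 \<in> K" "y2 \<in> K" using P Q PQ by simp_all
  have on: "y1 ^ 2 = x1 ^ 3 + a * x1 ^ 2 + b * x1" "y2 ^ 2 = x2 ^ 3 + a * x2 ^ 2 + b * x2"
    using P Q PQ by simp_all
  have abK: "a \<in> K" "b \<in> K" "galois a = a" "galois b = b" using ab K_Rats galois_rat by simp_all
  show ?thesis
  proof (cases "x1 = x2 \<and> y1 = - y2")
    case True
    then show ?thesis using K by (simp add: PQ galois_minus)
  next
    case False
    obtain l where l: "is_slope a b x1 y1 x2 y2 l" using is_slope_exists[OF on False] by blast
    have lK: "l \<in> K"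
    proof (cases "x1 = x2")
      case True
      then have "y1 + y2 \<noteq> 0" using False by (simp add: add_eq_0_iff2)
      then have "l = (x1 ^ 2 + x1 * x2 + x2 ^ 2 + a * (x1 + x2) + b) / (y1 + y2)"
        using l unfolding is_slope_def by (simp add: field_simps)
      then show ?thesis using K abK by (simp add: K_closed)
    next
      case False
      then have "l = (y2 - y1) / (x2 - x1)"
        using l unfolding is_slope_def by (simp add: field_simps)
      then show ?thesis using K abK by (simp add: K_closed)
    qed
    have "galois (l * (x2 - x1)) = galois (y2 - y1)"
      "galois (l * (y1 + y2)) = galois (x1 ^ 2 + x1 * x2 + x2 ^ 2 + a * (x1 + x2) + b)"
      using l unfolding is_slope_def by simp_all
    then have l': "is_slope a b (galois x1) (galois y1) (galois x2) (galois y2) (galois l)"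
      unfolding is_slope_def using K abK lK
      by (simp add: galois_add galois_mult galois_power galois_diff K_closed)
    have False': "\<not> (galois x1 = galois x2 \<and> galois y1 = - galois y2)"
      using False K galois_inj galois_minus by metis
    define x3 where "x3 = l ^ 2 - a - x1 - x2"
    define y3 where "y3 = l * (x1 - x3) - y1"
    have x3: "x3 \<in> K" "galois x3 = galois l ^ 2 - a - galois x1 - galois x2"
      unfolding x3_def using lK K abK by (simp_all add: galois_power galois_diff K_closed)
    have y3: "y3 \<in> K" "galois y3 = galois l * (galois x1 - galois x3) - galois y1"
      unfolding y3_def using lK K abK x3(1) by (simp_all add: galois_mult galois_diff K_closed)
    have sum: "cubic_add 1 a b P Q = Some (x3, y3)"
      using cubic_add_slope[OF l False] unfolding PQ x3_def y3_def .
    have "cubic_add 1 a b (conj_point P) (conj_point Q) = Some (galois x3, galois y3)"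
      unfolding PQ conj_point.simps y3(2) unfolding x3(2) by (rule cubic_add_slope[OF l' False'])
    moreover have "cubic_add 1 a b P Q \<in> ell_points a b"
      using cubic_add_closed P Q K_points_carrier by blast
    ultimately show ?thesis using sum x3 y3 by simp
  qed
qed (use P Q in auto)

lemma conj_point_neg: "P \<in> K_points a b \<Longrightarrow> conj_point (ell_neg P) = ell_neg (conj_point P)"
  by (cases P rule: ell_neg.cases) (auto simp: galois_minus)

lemma conj_point_conj: "P \<in> K_points a b \<Longrightarrow> conj_point (conj_point P) = P"
  by (cases P rule: ell_neg.cases) (auto simp: galois_conj)

end

section \<open>Reduction modulo 7\<close>

interpretation P7: prime_int 7
  by unfold_locales simp

lemma residue_cases7:
  assumes "x \<in> padic 7 0"
  obtains r where "r \<in> {0, 1, 2, 3, 4, 5, 6}" "P7.pcong x (of_int r)"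
proof -
  obtain r where "0 \<le> r" "r < 7" and r: "P7.pcong x (of_int r)" using P7.residue_exists[OF assms] .
  then have "r \<in> {0, 1, 2, 3, 4, 5, 6}" by auto
  with r show ?thesis using that by blast
qed

text \<open>For \<open>y^2 = x (x + e1) (x + e2)\<close> the quantity \<open>a^2 - 4 b\<close> is
  \<open>(e1 - e2)^2\<close>, so good reduction means that 0, \<open>e1\<close>, \<open>e2\<close>
  are distinct modulo 7.\<close>

lemma good_reduction7:
  assumes "P7.pcong e1 (of_int r1)" "P7.pcong e2 (of_int r2)"
    and "\<not> 7 dvd r1" "\<not> 7 dvd r2" "\<not> 7 dvd r1 - r2"
  shows "elliptic_reduction (e1 + e2) (e1 * e2) 7" "e1 * e2 \<notin> padic 7 1"
    "(e1 + e2) ^ 2 - 4 * (e1 * e2) \<notin> padic 7 1"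
proof -
  have nz: "u \<notin> padic 7 1" if "P7.pcong u (of_int r)" "\<not> 7 dvd r" for u r
  proof
    assume "u \<in> padic 7 1"
    then have "P7.pcong u (of_int 0)" using P7.pcong_0 by simp
    then have "P7.pcong (of_int r) (of_int 0)" using that(1) P7.pcong_trans P7.pcong_sym by blast
    then have "7 dvd r" using P7.pcong_of_int[of r 0] by simp
    with that show False by blast
  qed
  have p: "prime (7::int)" by simp
  have "P7.pcong (e1 * e2) (of_int (r1 * r2))" using P7.pcong_mult[OF assms(1,2)] by simp
  moreover have "\<not> 7 dvd r1 * r2" using assms p prime_dvd_mult_iff by blast
  ultimately show b: "e1 * e2 \<notin> padic 7 1" using nz by blast
  have "P7.pcong ((e1 - e2) * (e1 - e2)) (of_int ((r1 - r2) * (r1 - r2)))"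
    using P7.pcong_mult[OF P7.pcong_diff P7.pcong_diff, OF assms(1,2) assms(1,2)] by simp
  moreover have "\<not> 7 dvd (r1 - r2) * (r1 - r2)" using assms p prime_dvd_mult_iff by blast
  ultimately have "(e1 - e2) * (e1 - e2) \<notin> padic 7 1" using nz by blast
  then show d: "(e1 + e2) ^ 2 - 4 * (e1 * e2) \<notin> padic 7 1" by (simp add: algebra_simps power2_eq_square)
  have "e1 \<in> padic 7 0" "e2 \<in> padic 7 0" using assms by (simp_all add: P7.pcong_def)
  then show "elliptic_reduction (e1 + e2) (e1 * e2) 7"
    using b d by unfold_locales (auto intro: P7.padic_add P7.padic_mult_left)
qed

text \<open>Congruent abscissas leave \<open>y\<close> determined up to sign modulo
  \<open>p\<close>. Thus a torsion point is recognised, up to sign, from the residue of its abscissa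
  alone.\<close>

lemma (in elliptic_reduction) torsion_congruent_x:
  assumes good: "p \<noteq> 2" "b \<notin> padic p 1" "a ^ 2 - 4 * b \<notin> padic p 1"
    and P: "torsion (Some (x, y))" and T: "torsion (Some (x', y'))"
    and rat: "x \<in> \<rat>" "y \<in> \<rat>" "x' \<in> \<rat>" "y' \<in> \<rat>" and cong: "pcong x x'"
  shows "Some (x, y) = Some (x', y') \<or> Some (x, y) = ell_neg (Some (x', y'))"
proof -
  have y: "y \<in> padic p 0" "y' \<in> padic p 0" using torsion_integral' P T rat by blast+
  have on: "y ^ 2 = x ^ 3 + a * x ^ 2 + b * x" "y' ^ 2 = x' ^ 3 + a * x' ^ 2 + b * x'"
    using P T torsion_def by simp_all
  have "pcong (y ^ 2) (y' ^ 2)"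
    unfolding on by (intro pcong_intros pcong_refl cong integral)
  then have "(y - y') * (y + y') \<in> padic p 1" by (simp add: pcong_def algebra_simps power2_eq_square)
  then have "y - y' \<in> padic p 1 \<or> y + y' \<in> padic p 1"
    using padic_prime[of "y - y'" "y + y'"] y padic_add padic_diff by blast
  then show ?thesis
  proof
    assume "y - y' \<in> padic p 1"
    then show ?thesis using torsion_congruent_eq[OF good P T rat] cong by (simp add: pcong_def)
  next
    assume *: "y + y' \<in> padic p 1"
    have "torsion (Some (x', - y'))" using torsion_neg[OF T] by simp
    then show ?thesis using torsion_congruent_eq[OF good P, of x' "- y'"] rat cong * by (simp add: pcong_def)
  qed
qed

lemma (in elliptic) torsion_order_two:
  assumes "x ^ 3 + a * x ^ 2 + b * x = 0" shows "torsion (Some (x, 0))"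
proof -
  have "Some (x, 0) [^]\<^bsub>ell_group a b\<^esub> (2::nat) = None" by (simp add: numeral_2_eq_2)
  then show ?thesis using assms unfolding torsion_def by (intro conjI exI[of _ 2]) auto
qed

text \<open>Modulo 7 the curve \<open>y\<^sup>2 = x (x + 4) (x + 6)\<close> has no points besides its 2-torsion.\<close>

lemma torsion_of_twist:
  assumes e: "P7.pcong e1 4" "P7.pcong e2 6"
    and P: "elliptic.torsion (e1 + e2) (e1 * e2) (Some (x, y))" and rat: "x \<in> \<rat>" "y \<in> \<rat>"
  shows "y = 0"
proof -
  have e': "P7.pcong e1 (of_int 4)" "P7.pcong e2 (of_int 6)" using e by simp_all
  interpret E: elliptic_reduction "e1 + e2" "e1 * e2" 7
    by (rule good_reduction7[OF e']) simp_all
  have good: "(7::int) \<noteq> 2" "e1 * e2 \<notin> padic 7 1" "(e1 + e2) ^ 2 - 4 * (e1 * e2) \<notin> padic 7 1"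
    by (simp, (rule good_reduction7[OF e']; simp)+)
  have ei: "e1 \<in> padic 7 0" "e2 \<in> padic 7 0" using e by (simp_all add: P7.pcong_def)
  obtain r where r: "r \<in> {0, 1, 2, 3, 4, 5, 6}" and xr: "P7.pcong x (of_int r)"
    using residue_cases7 E.torsion_integral[OF P rat] by blast
  obtain t where t: "t \<in> {0, 1, 2, 3, 4, 5, 6}" and yt: "P7.pcong y (of_int t)"
    using residue_cases7 E.torsion_integral'[OF P rat] by blast
  have on: "y ^ 2 = x * (x + e1) * (x + e2)"
    using P E.torsion_def by (simp add: algebra_simps power2_eq_square power3_eq_cube)
  have "P7.pcong (y ^ 2) (of_int r * (of_int r + of_int 4) * (of_int r + of_int 6))"
    unfolding on by (intro P7.pcong_intros xr e')
  moreover have "P7.pcong (of_int t ^ 2) (y ^ 2)" by (intro P7.pcong_intros P7.pcong_sym[OF yt])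
  ultimately have "P7.pcong (of_int (t ^ 2)) (of_int (r * (r + 4) * (r + 6)))"
    using P7.pcong_trans by fastforce
  then have "7 dvd t ^ 2 - r * (r + 4) * (r + 6)" using P7.pcong_of_int by blast
  \<comment> \<open>All 49 pairs of residues are tested; the surviving \<open>r\<close> are the
    roots 0, \<open>- 6\<close>, \<open>- 4\<close> of the cubic modulo 7, at all others its value
    is a nonresidue.\<close>
  then have "r = 0 \<or> r = 1 \<or> r = 3" using r t by auto
  moreover have root: "y = 0" if "z \<in> padic 7 0" "z * (z + e1) * (z + e2) = 0" "P7.pcong x z" for z
  proof -
    have "z ^ 3 + (e1 + e2) * z ^ 2 + e1 * e2 * z = 0"
      using that(2) by (simp add: algebra_simps power2_eq_square power3_eq_cube)
    then have "E.torsion (Some (z, 0))" by (rule E.torsion_order_two)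
    then show ?thesis
      using E.torsion_congruent_x[OF good P _ rat, of z 0] that P7.padic_Rats by auto
  qed
  moreover have "P7.pcong x 0" if "r = 0" using xr that by simp
  moreover have "P7.pcong x (- e1)" if "r = 3"
  proof -
    have "P7.pcong (of_int 3) (of_int (- 4))" using P7.pcong_of_int[of 3 "- 4"] by simp
    moreover have "P7.pcong (of_int (- 4)) (- e1)" using P7.pcong_sym[OF P7.pcong_minus[OF e(1)]] by simp
    ultimately show ?thesis using xr that P7.pcong_trans by blast
  qed
  moreover have "P7.pcong x (- e2)" if "r = 1"
  proof -
    have "P7.pcong (of_int 1) (of_int (- 6))" using P7.pcong_of_int[of 1 "- 6"] by simp
    moreover have "P7.pcong (of_int (- 6)) (- e2)" using P7.pcong_sym[OF P7.pcong_minus[OF e(2)]] by simp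
    ultimately show ?thesis using xr that P7.pcong_trans by blast
  qed
  ultimately show ?thesis using root[of 0] root[of "- e1"] root[of "- e2"] ei P7.padic_minus by auto
qed

lemma not_square_mod7:
  assumes "x \<in> \<rat>" "P7.pcong (x ^ 2) 3" shows False
proof -
  have "x \<in> padic 7 0"
  proof (rule ccontr)
    assume "x \<notin> padic 7 0"
    then have x: "x \<noteq> 0" "inverse x \<in> padic 7 1" using P7.rational_cases assms by auto
    then have "inverse x * inverse x * x ^ 2 \<in> padic 7 (1 + 1 + 0)"
      using P7.padic_mult assms(2) unfolding P7.pcong_def by blast
    then show False using x P7.one_not_padic[of 1] by (simp add: power2_eq_square field_simps)
  qed
  then obtain r where r: "r \<in> {0, 1, 2, 3, 4, 5, 6}" and xr: "P7.pcong x (of_int r)"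
    using residue_cases7 by blast
  have "P7.pcong (of_int r ^ 2) (of_int 3)"
    using P7.pcong_trans[OF P7.pcong_power[OF P7.pcong_sym[OF xr]] assms(2)] by simp
  then have "P7.pcong (of_int (r ^ 2)) (of_int 3)" by simp
  then have "7 dvd r ^ 2 - 3" using P7.pcong_of_int by blast
  then show False using r by auto
qed

lemma congruences7:
  assumes "w - 3 \<in> padic 7 1"
  shows "P7.pcong w 3" "P7.pcong (w ^ 2 - 2 * w) 3" "P7.pcong (1 - 2 * w) 2"
proof -
  show w: "P7.pcong w 3"
    using assms P7.padic_add[of "w - 3" 0 3] P7.padic_mono[OF assms, of 0] by (simp add: P7.pcong_def)
  have "P7.pcong (w ^ 2 - 2 * w) (3 ^ 2 - 2 * 3)" by (intro P7.pcong_intros w P7.pcong_refl) simp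
  then show "P7.pcong (w ^ 2 - 2 * w) 3" by simp
  have "P7.pcong (1 - 2 * w) (1 - 2 * 3)" by (intro P7.pcong_intros w P7.pcong_refl) simp_all
  moreover have "P7.pcong (of_int (- 5)) (of_int 2)" using P7.pcong_of_int[of "- 5" 2] by simp
  ultimately show "P7.pcong (1 - 2 * w) 2" using P7.pcong_trans by fastforce
qed

section \<open>The torsion group of the induced curve\<close>

lemma (in comm_group) mult_interchange:
  assumes "x \<in> carrier G" "y \<in> carrier G" "z \<in> carrier G" "x' \<in> carrier G" "y' \<in> carrier G" "z' \<in> carrier G"
  shows "(x \<otimes> (y \<otimes> z)) \<otimes> (x' \<otimes> (y' \<otimes> z')) = (x \<otimes> x') \<otimes> ((y \<otimes> y') \<otimes> (z \<otimes> z'))"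
  using assms by (simp add: m_ac)

text \<open>Here \<open>w_mod7\<close> fixes the residues that matter: modulo 7,
  \<open>\<alpha> ^ 2\<close> is the nonresidue 3, and the roots of the curve are 0, -6 and -2. The
  hypothesis \<open>alpha_real\<close> excludes a half of the 2-torsion point
  \<open>T1\<close>.\<close>

locale diophantine_curve = quadratic_extension \<alpha> for \<alpha> +
  fixes w q :: complex
  assumes alpha_eq: "\<alpha> ^ 2 = w ^ 2 - 2 * w" and q_eq: "q ^ 2 = 1 - 2 * w"
    and q_rat: "q \<in> \<rat>" and w_mod7: "w - 3 \<in> padic 7 1" and alpha_real: "\<alpha> \<in> \<real>"
begin

abbreviation e1 :: complex where "e1 \<equiv> w ^ 2 * \<alpha> ^ 2"
abbreviation e2 :: complex where "e2 \<equiv> q ^ 2"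
abbreviation G :: "point monoid" where "G \<equiv> ell_group (e1 + e2) (e1 * e2)"

lemma pow_one: "P [^]\<^bsub>G\<^esub> (1::nat) = P"
  by simp

lemma w_rat: "w \<in> \<rat>"
  using q_eq q_rat by (metis (no_types) Rats_diff Rats_divide Rats_number_of Rats_power Rats_1
      add_diff_cancel_left' diff_add_cancel minus_diff_eq nonzero_mult_div_cancel_left zero_neq_numeral)

lemma e_cong: "P7.pcong e1 (of_int 6)" "P7.pcong e2 (of_int 2)" "P7.pcong (\<alpha> ^ 2) 3" "P7.pcong w 3"
proof -
  show D: "P7.pcong (\<alpha> ^ 2) 3" and w: "P7.pcong w 3" and "P7.pcong e2 (of_int 2)"
    using congruences7[OF w_mod7] alpha_eq q_eq by simp_all
  have "P7.pcong e1 (3 ^ 2 * 3)" by (intro P7.pcong_intros D w)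
  moreover have "P7.pcong (of_int 27) (of_int 6)" using P7.pcong_of_int[of 27 6] by simp
  ultimately show "P7.pcong e1 (of_int 6)" using P7.pcong_trans by fastforce
qed

sublocale E: elliptic_reduction "e1 + e2" "e1 * e2" 7
  by (rule good_reduction7[OF e_cong(1,2)]) simp_all

lemma good: "(7::int) \<noteq> 2" "e1 * e2 \<notin> padic 7 1" "(e1 + e2) ^ 2 - 4 * (e1 * e2) \<notin> padic 7 1"
  by (simp, (rule good_reduction7[OF e_cong(1,2)]; simp)+)

lemma on_curve_iff:
  "Some (x, y) \<in> E.E \<longleftrightarrow> y ^ 2 = x * (x + e1) * (x + e2)"
  by (simp add: algebra_simps power2_eq_square power3_eq_cube)

lemma pcong7_ne: "P7.pcong x (of_int m) \<Longrightarrow> \<not> 7 dvd m - n \<Longrightarrow> x \<noteq> of_int n"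
  using P7.pcong_of_int[of n m] P7.pcong_sym by (metis dvd_minus_iff minus_diff_eq)

lemma nonzero: "\<alpha> \<noteq> 0" "w \<noteq> 0" "q \<noteq> 0" "w ^ 2 \<noteq> 1" "w \<noteq> 1" "e1 \<noteq> e2" "e1 \<noteq> 0" "e2 \<noteq> 0"
proof -
  have w: "P7.pcong w (of_int 3)" using e_cong by simp
  have e: "e1 * e2 \<noteq> 0" "(e1 + e2) ^ 2 - 4 * (e1 * e2) \<noteq> 0" using good by auto
  show "\<alpha> \<noteq> 0" "w \<noteq> 0" "q \<noteq> 0" using e(1) by auto
  then show "e1 \<noteq> 0" "e2 \<noteq> 0" by simp_all
  have "(e1 + e2) ^ 2 - 4 * (e1 * e2) = (e1 - e2) ^ 2" by algebra
  then show "e1 \<noteq> e2" using e(2) by auto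
  show "w \<noteq> 1" using pcong7_ne[OF w, of 1] by simp
  have "P7.pcong (w ^ 2) (of_int 9)" using P7.pcong_power[OF w, of 2] by simp
  then show "w ^ 2 \<noteq> 1" using pcong7_ne[of "w ^ 2" 9 1] by simp
qed

section \<open>Explicit torsion points and their sums\<close>

definition T0 where "T0 = Some (0 :: complex, 0 :: complex)"
definition T1 where "T1 = Some (- e1, 0 :: complex)"
definition T2 where "T2 = Some (- e2, 0 :: complex)"
text \<open>A half of \<open>T0\<close> has as abscissa a square root of \<open>e1 * e2\<close>,
  available since \<open>e1 = (w * \<alpha>)^2\<close> and \<open>e2 = q^2\<close>.\<close>

definition R where "R = Some (w * q * \<alpha>, w * q * \<alpha> * (w * \<alpha> + q))"
definition S where "S = Some (w ^ 2, w ^ 2 * (w - 1) ^ 2)"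

lemma sum_eqI:
  assumes "is_slope (e1 + e2) (e1 * e2) x1 y1 x2 y2 l" "\<not> (x1 = x2 \<and> y1 = - y2)"
    and "x3 = l ^ 2 - (e1 + e2) - x1 - x2" "y3 = l * (x1 - x3) - y1"
  shows "Some (x1, y1) \<otimes>\<^bsub>G\<^esub> Some (x2, y2) = Some (x3, y3)"
  using cubic_add_slope[OF assms(1,2)] assms(3,4) by (simp only: monoid.simps)

lemma T_carrier: "T0 \<in> carrier G" "T1 \<in> carrier G" "T2 \<in> carrier G"
  by (simp_all add: T0_def T1_def T2_def algebra_simps power2_eq_square power3_eq_cube)

lemma R_carrier: "R \<in> carrier G"
proof -
  have "(w * q * \<alpha> * (w * \<alpha> + q)) ^ 2 = (w * q * \<alpha>) * (w * q * \<alpha> + e1) * (w * q * \<alpha> + e2)" by algebra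
  then show ?thesis unfolding R_def monoid.simps partial_object.simps on_curve_iff .
qed

lemma S_carrier: "S \<in> carrier G"
proof -
  have "(w ^ 2 * (w - 1) ^ 2) ^ 2 = w ^ 2 * (w ^ 2 + e1) * (w ^ 2 + e2)"
    using alpha_eq q_eq by algebra
  then show ?thesis unfolding S_def monoid.simps partial_object.simps on_curve_iff .
qed

lemma T1_T1: "T1 \<otimes>\<^bsub>G\<^esub> T1 = None" and T0_T0: "T0 \<otimes>\<^bsub>G\<^esub> T0 = None"
  by (simp_all add: T1_def T0_def)

lemma T1_T0: "T1 \<otimes>\<^bsub>G\<^esub> T0 = T2"
  unfolding T1_def T0_def T2_def
  by (rule sum_eqI[where l = 0]) (use nonzero in \<open>simp_all add: is_slope_def algebra_simps power2_eq_square\<close>)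

lemma R_R: "R \<otimes>\<^bsub>G\<^esub> R = T0"
proof -
  have ne: "w * \<alpha> + q \<noteq> 0"
  proof
    assume "w * \<alpha> + q = 0"
    then have "w * \<alpha> = - q" by (simp add: add_eq_0_iff)
    then have "(w * \<alpha>) ^ 2 = q ^ 2" by simp
    then show False using nonzero by (simp add: power_mult_distrib)
  qed
  have y0: "w * q * \<alpha> * (w * \<alpha> + q) \<noteq> 0" using ne nonzero by simp
  show ?thesis
    unfolding R_def T0_def
  proof (rule sum_eqI[where l = "w * \<alpha> + q"])
    show "\<not> (w * q * \<alpha> = w * q * \<alpha> \<and> w * q * \<alpha> * (w * \<alpha> + q) = - (w * q * \<alpha> * (w * \<alpha> + q)))"
      using y0 by simp
    show "is_slope (e1 + e2) (e1 * e2) (w * q * \<alpha>) (w * q * \<alpha> * (w * \<alpha> + q)) (w * q * \<alpha>) (w * q * \<alpha> * (w * \<alpha> + q)) (w * \<alpha> + q)"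
      unfolding is_slope_def by (intro conjI; algebra)
  qed (algebra, algebra)
qed

lemma S_y: "w ^ 2 * (w - 1) ^ 2 \<noteq> 0"
  using nonzero by simp

text \<open>\<open>S\<close> is an inflection point: its tangent, of slope
  \<open>w ^ 2 - w + 1\<close>, meets the curve in \<open>S\<close> three times.\<close>

lemma S_S: "S \<otimes>\<^bsub>G\<^esub> S = ell_neg S"
  unfolding S_def ell_neg.simps
proof (rule sum_eqI[where l = "w ^ 2 - w + 1"])
  show "\<not> (w ^ 2 = w ^ 2 \<and> w ^ 2 * (w - 1) ^ 2 = - (w ^ 2 * (w - 1) ^ 2))" using S_y by simp
  show "is_slope (e1 + e2) (e1 * e2) (w ^ 2) (w ^ 2 * (w - 1) ^ 2) (w ^ 2) (w ^ 2 * (w - 1) ^ 2) (w ^ 2 - w + 1)"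
    unfolding is_slope_def alpha_eq q_eq by (intro conjI; algebra)
  show "w ^ 2 = (w ^ 2 - w + 1) ^ 2 - (e1 + e2) - w ^ 2 - w ^ 2"
    unfolding alpha_eq q_eq by algebra
qed simp

text \<open>The translates of \<open>S\<close> by the 2-torsion are needed in coordinates: their
  abscissas supply the residue classes modulo 7 not met by \<open>S\<close> and the 2-torsion
  points.\<close>

lemma T0_S: "T0 \<otimes>\<^bsub>G\<^esub> S = Some (\<alpha> ^ 2 * q ^ 2, - ((w - 1) ^ 2 * \<alpha> ^ 2 * q ^ 2))"
  unfolding T0_def S_def
proof (rule sum_eqI[where l = "(w - 1) ^ 2"])
  show "is_slope (e1 + e2) (e1 * e2) 0 0 (w ^ 2) (w ^ 2 * (w - 1) ^ 2) ((w - 1) ^ 2)"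
    unfolding is_slope_def alpha_eq q_eq by (simp add: algebra_simps power2_eq_square)
  show "\<alpha> ^ 2 * q ^ 2 = ((w - 1) ^ 2) ^ 2 - (e1 + e2) - 0 - w ^ 2"
    unfolding alpha_eq q_eq by (simp add: algebra_simps power2_eq_square)
qed (use nonzero in \<open>auto simp: algebra_simps\<close>)

lemma T1_S: "T1 \<otimes>\<^bsub>G\<^esub> S = Some (- (\<alpha> ^ 2), \<alpha> ^ 2 - e1)"
  unfolding T1_def S_def
proof (rule sum_eqI[where l = 1])
  show "is_slope (e1 + e2) (e1 * e2) (- e1) 0 (w ^ 2) (w ^ 2 * (w - 1) ^ 2) 1"
    unfolding is_slope_def alpha_eq q_eq by (simp add: algebra_simps power2_eq_square)
  show "- (\<alpha> ^ 2) = 1 ^ 2 - (e1 + e2) - - e1 - w ^ 2"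
    unfolding alpha_eq q_eq by (simp add: algebra_simps power2_eq_square)
  show "\<not> (- e1 = w ^ 2 \<and> 0 = - (w ^ 2 * (w - 1) ^ 2))" using S_y by auto
qed simp

lemma T2_S: "T2 \<otimes>\<^bsub>G\<^esub> S = Some (- (q ^ 2 * w ^ 2), w ^ 2 * (q ^ 2 * w ^ 2 - q ^ 2))"
  unfolding T2_def S_def
proof (rule sum_eqI[where l = "w ^ 2"])
  show "is_slope (e1 + e2) (e1 * e2) (- e2) 0 (w ^ 2) (w ^ 2 * (w - 1) ^ 2) (w ^ 2)"
    unfolding is_slope_def alpha_eq q_eq by (simp add: algebra_simps power2_eq_square)
  show "- (q ^ 2 * w ^ 2) = (w ^ 2) ^ 2 - (e1 + e2) - - e2 - w ^ 2"
    unfolding alpha_eq q_eq by (simp add: algebra_simps power2_eq_square)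
  show "\<not> (- e2 = w ^ 2 \<and> 0 = - (w ^ 2 * (w - 1) ^ 2))" using S_y by auto
qed simp

text \<open>The subgroup generated by \<open>T1\<close>, \<open>R\<close>, \<open>S\<close>; natural
  exponents suffice because these points have orders 2, 4, 3. It turns out to be the whole torsion
  over \<open>K\<close>.\<close>

definition H where
  "H = {T1 [^]\<^bsub>G\<^esub> (i::nat) \<otimes>\<^bsub>G\<^esub> (R [^]\<^bsub>G\<^esub> (j::nat) \<otimes>\<^bsub>G\<^esub> S [^]\<^bsub>G\<^esub> (k::nat)) | i j k. True}"

lemma S_S_S: "S \<otimes>\<^bsub>G\<^esub> S \<otimes>\<^bsub>G\<^esub> S = \<one>\<^bsub>G\<^esub>"
  unfolding S_S using cubic_add_neg by simp

lemma pow_eq: "T1 [^]\<^bsub>G\<^esub> (2::nat) = \<one>\<^bsub>G\<^esub>" "R [^]\<^bsub>G\<^esub> (4::nat) = \<one>\<^bsub>G\<^esub>" "S [^]\<^bsub>G\<^esub> (3::nat) = \<one>\<^bsub>G\<^esub>"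
proof -
  note c = T_carrier R_carrier S_carrier
  show "T1 [^]\<^bsub>G\<^esub> (2::nat) = \<one>\<^bsub>G\<^esub>"
    using E.G.nat_pow_mult[of T1 1 1] pow_one[of T1] c T1_T1 by (simp add: numeral_2_eq_2)
  have "R [^]\<^bsub>G\<^esub> (2::nat) = T0"
    using E.G.nat_pow_mult[of R 1 1] pow_one[of R] c R_R by (simp add: numeral_2_eq_2)
  then show "R [^]\<^bsub>G\<^esub> (4::nat) = \<one>\<^bsub>G\<^esub>"
    using E.G.nat_pow_mult[of R 2 2] c T0_T0 by simp
  have "S [^]\<^bsub>G\<^esub> (2::nat) = S \<otimes>\<^bsub>G\<^esub> S"
    using E.G.nat_pow_mult[of S 1 1] pow_one[of S] c by (simp add: numeral_2_eq_2)
  then show "S [^]\<^bsub>G\<^esub> (3::nat) = \<one>\<^bsub>G\<^esub>"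
    using E.G.nat_pow_mult[of S 2 1] pow_one[of S] c S_S_S by simp
qed

lemma H_I: "T1 [^]\<^bsub>G\<^esub> (i::nat) \<otimes>\<^bsub>G\<^esub> (R [^]\<^bsub>G\<^esub> (j::nat) \<otimes>\<^bsub>G\<^esub> S [^]\<^bsub>G\<^esub> (k::nat)) \<in> H"
  unfolding H_def by blast

lemma H_carrier: "h \<in> H \<Longrightarrow> h \<in> carrier G"
  unfolding H_def using T_carrier R_carrier S_carrier E.G.m_closed E.G.nat_pow_closed by blast

lemma gens_mult:
  "(T1 [^]\<^bsub>G\<^esub> (i::nat) \<otimes>\<^bsub>G\<^esub> (R [^]\<^bsub>G\<^esub> (j::nat) \<otimes>\<^bsub>G\<^esub> S [^]\<^bsub>G\<^esub> (k::nat))) \<otimes>\<^bsub>G\<^esub>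
   (T1 [^]\<^bsub>G\<^esub> (i'::nat) \<otimes>\<^bsub>G\<^esub> (R [^]\<^bsub>G\<^esub> (j'::nat) \<otimes>\<^bsub>G\<^esub> S [^]\<^bsub>G\<^esub> (k'::nat))) =
   T1 [^]\<^bsub>G\<^esub> (i + i') \<otimes>\<^bsub>G\<^esub> (R [^]\<^bsub>G\<^esub> (j + j') \<otimes>\<^bsub>G\<^esub> S [^]\<^bsub>G\<^esub> (k + k'))"
proof -
  have c: "T1 [^]\<^bsub>G\<^esub> n \<in> carrier G" "R [^]\<^bsub>G\<^esub> n \<in> carrier G" "S [^]\<^bsub>G\<^esub> n \<in> carrier G" for n :: nat
    using T_carrier R_carrier S_carrier E.G.nat_pow_closed by blast+
  show ?thesis
    unfolding E.G.nat_pow_mult[OF T_carrier(2), symmetric] E.G.nat_pow_mult[OF R_carrier, symmetric]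
      E.G.nat_pow_mult[OF S_carrier, symmetric]
    by (rule E.G.mult_interchange[OF c c])
qed

lemma H_mult: "g \<in> H \<Longrightarrow> h \<in> H \<Longrightarrow> g \<otimes>\<^bsub>G\<^esub> h \<in> H"
  unfolding H_def using gens_mult by blast

lemma H_gens: "\<one>\<^bsub>G\<^esub> \<in> H" "T1 \<in> H" "R \<in> H" "S \<in> H"
  using H_I[of 0 0 0] H_I[of 1 0 0] H_I[of 0 1 0] H_I[of 0 0 1] pow_one T_carrier R_carrier S_carrier
  by simp_all

text \<open>The multiples of \<open>T1\<close> plus the doubles of \<open>H\<close>. If the double
  of a point lies here, subtracting a suitable element of \<open>H\<close> leaves a single question,
  whether \<open>T1\<close> can be halved over \<open>K\<close>.\<close>

definition M where "M = {T1 [^]\<^bsub>G\<^esub> (i::nat) \<otimes>\<^bsub>G\<^esub> (h \<otimes>\<^bsub>G\<^esub> h) | i h. h \<in> H}"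

lemma M_I: "h \<in> H \<Longrightarrow> T1 [^]\<^bsub>G\<^esub> (i::nat) \<otimes>\<^bsub>G\<^esub> (h \<otimes>\<^bsub>G\<^esub> h) \<in> M"
  unfolding M_def by blast

lemma M_mult:
  assumes "x \<in> M" "y \<in> M" shows "x \<otimes>\<^bsub>G\<^esub> y \<in> M"
proof -
  obtain i j :: nat and g h where *: "x = T1 [^]\<^bsub>G\<^esub> i \<otimes>\<^bsub>G\<^esub> (g \<otimes>\<^bsub>G\<^esub> g)" "g \<in> H"
    "y = T1 [^]\<^bsub>G\<^esub> j \<otimes>\<^bsub>G\<^esub> (h \<otimes>\<^bsub>G\<^esub> h)" "h \<in> H"
    using assms unfolding M_def by blast
  have c: "T1 [^]\<^bsub>G\<^esub> n \<in> carrier G" for n :: nat using T_carrier E.G.nat_pow_closed by blast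
  have "x \<otimes>\<^bsub>G\<^esub> y = T1 [^]\<^bsub>G\<^esub> (i + j) \<otimes>\<^bsub>G\<^esub> ((g \<otimes>\<^bsub>G\<^esub> h) \<otimes>\<^bsub>G\<^esub> (g \<otimes>\<^bsub>G\<^esub> h))"
    unfolding * E.G.nat_pow_mult[OF T_carrier(2), symmetric]
    by (rule E.G.mult_interchange) (use c H_carrier * in blast)+
  then show ?thesis using M_I H_mult * by simp
qed

lemma M_gens: "\<one>\<^bsub>G\<^esub> \<in> M" "T0 \<in> M" "T1 \<in> M" "T2 \<in> M" "S \<in> M" "ell_neg S \<in> M"
proof -
  note c = T_carrier R_carrier S_carrier
  have 0: "T1 [^]\<^bsub>G\<^esub> (0::nat) = \<one>\<^bsub>G\<^esub>" by simp
  have l1: "\<one>\<^bsub>G\<^esub> \<otimes>\<^bsub>G\<^esub> x = x" for x by simp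
  show 1: "\<one>\<^bsub>G\<^esub> \<in> M" using M_I[OF H_gens(1), of 0] unfolding 0 l1 .
  show T0: "T0 \<in> M" using M_I[OF H_gens(3), of 0] unfolding 0 l1 R_R .
  show T1: "T1 \<in> M" using M_I[OF H_gens(1), of 1] pow_one[of T1] by simp
  show "T2 \<in> M" using M_mult[OF T1 T0] unfolding T1_T0 .
  show nS: "ell_neg S \<in> M" using M_I[OF H_gens(4), of 0] unfolding 0 l1 S_S .
  have "ell_neg S \<otimes>\<^bsub>G\<^esub> ell_neg S = S"
    unfolding S_S[symmetric] using E.G.m_assoc[of "S \<otimes>\<^bsub>G\<^esub> S" S S] S_S_S c E.G.m_closed by (metis E.G.l_one)
  then show "S \<in> M" using M_mult[OF nS nS] by simp
qed

text \<open>The 12 points modulo 7 are infinity, three 2-torsion points and four pairs of opposite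
  points. Every residue of \<open>x\<close> is therefore the abscissa of a known torsion point in
  \<open>M\<close>, and \<open>torsion_congruent_x\<close> identifies the given point with it up to
  sign.\<close>

lemma rational_torsion_M:
  assumes P: "E.torsion (Some (x, y))" and rat: "x \<in> \<rat>" "y \<in> \<rat>"
  shows "Some (x, y) \<in> M"
proof -
  note c = T_carrier S_carrier
  have r2: "\<alpha> ^ 2 \<in> \<rat>" using alpha_sq .
  obtain r where r: "r \<in> {0, 1, 2, 3, 4, 5, 6}" and xr: "P7.pcong x (of_int r)"
    using residue_cases7 E.torsion_integral[OF P rat] by blast
  have tT: "E.torsion T0" "E.torsion T1" "E.torsion T2"
    unfolding T0_def T1_def T2_def
    by (rule E.torsion_order_two, simp add: algebra_simps power2_eq_square power3_eq_cube)+
  have tS: "E.torsion S"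
    unfolding E.torsion_def using S_carrier pow_eq(3) by (intro conjI exI[of _ 3]) simp_all
  have hit: "Some (x, y) \<in> M"
    if "E.torsion (Some (x', y'))" "Some (x', y') \<in> M" "ell_neg (Some (x', y')) \<in> M"
      "x' \<in> \<rat>" "y' \<in> \<rat>" "P7.pcong x' (of_int m)" "7 dvd r - m" for x' y' m
  proof -
    have "P7.pcong (of_int r) (of_int m)" using that P7.pcong_of_int by blast
    then have "P7.pcong x x'" using xr that P7.pcong_trans P7.pcong_sym by blast
    then show ?thesis using E.torsion_congruent_x[OF good P that(1) rat that(4,5)] that by metis
  qed
  have nM: "ell_neg (T \<otimes>\<^bsub>G\<^esub> S) \<in> M" if "T \<in> M" "T \<in> carrier G" "ell_neg T = T" for T
  proof -
    have "ell_neg (T \<otimes>\<^bsub>G\<^esub> S) = inv\<^bsub>G\<^esub> (T \<otimes>\<^bsub>G\<^esub> S)"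
      using E.ell_neg_eq_inv E.G.m_closed[OF that(2) S_carrier] by simp
    also have "\<dots> = inv\<^bsub>G\<^esub> T \<otimes>\<^bsub>G\<^esub> inv\<^bsub>G\<^esub> S" using E.G.inv_mult[OF that(2) S_carrier] .
    also have "\<dots> = T \<otimes>\<^bsub>G\<^esub> ell_neg S"
      using E.ell_neg_eq_inv that S_carrier by (metis partial_object.select_convs(1))
    finally show ?thesis using M_mult that M_gens by simp
  qed
  have tTS: "E.torsion (T \<otimes>\<^bsub>G\<^esub> S)" if "E.torsion T" for T
    using E.torsion_add[OF that tS] by simp
  note C = e_cong
  have D: "P7.pcong (\<alpha> ^ 2) (of_int 3)" and w: "P7.pcong w (of_int 3)" using C by simp_all
  have rats: "w \<in> \<rat>" "e1 \<in> \<rat>" "e2 \<in> \<rat>" using w_rat q_rat r2 by simp_all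
  have Tn: "ell_neg T0 = T0" "ell_neg T1 = T1" "ell_neg T2 = T2" by (simp_all add: T0_def T1_def T2_def)
  \<comment> \<open>The residues 0 to 6 are met in order by \<open>T0\<close>, \<open>T1\<close>,
    \<open>S\<close>, \<open>T2 + S\<close>, \<open>T1 + S\<close>, \<open>T2\<close> and
    \<open>T0 + S\<close>.\<close>
  consider "r = 0" | "r = 1" | "r = 2" | "r = 3" | "r = 4" | "r = 5" | "r = 6" using r by auto
  then show ?thesis
  proof cases
    case 1
    show ?thesis
      by (rule hit[of 0 0 0]) (use 1 tT Tn M_gens P7.pcong_refl in \<open>auto simp: T0_def\<close>)
  next
    case 2
    have "P7.pcong (- e1) (of_int (- 6))" using P7.pcong_minus[OF C(1)] by simp
    then show ?thesis
      using 2 tT Tn M_gens rats by (intro hit[of "- e1" 0 "- 6"]) (auto simp: T1_def)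
  next
    case 3
    have "P7.pcong (w ^ 2) (of_int 9)" using P7.pcong_power[OF w, of 2] by simp
    then show ?thesis
      using 3 tS M_gens rats by (intro hit[of "w ^ 2" "w ^ 2 * (w - 1) ^ 2" 9]) (auto simp: S_def)
  next
    case 4
    have "P7.pcong (- (q ^ 2 * w ^ 2)) (of_int (- 18))"
      using P7.pcong_minus[OF P7.pcong_mult[OF C(2) P7.pcong_power[OF w, of 2]]] by simp
    then show ?thesis
      using 4 tTS[OF tT(3)] M_mult[OF M_gens(4,5)] nM[OF M_gens(4) c(3) Tn(3)] rats
      unfolding T2_S by (intro hit[of "- (q ^ 2 * w ^ 2)" "w ^ 2 * (q ^ 2 * w ^ 2 - q ^ 2)" "- 18"]) auto
  next
    case 5
    have "P7.pcong (- (\<alpha> ^ 2)) (of_int (- 3))" using P7.pcong_minus[OF D] by simp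
    then show ?thesis
      using 5 tTS[OF tT(2)] M_mult[OF M_gens(3,5)] nM[OF M_gens(3) c(2) Tn(2)] rats r2
      unfolding T1_S by (intro hit[of "- (\<alpha> ^ 2)" "\<alpha> ^ 2 - e1" "- 3"]) auto
  next
    case 6
    have "P7.pcong (- e2) (of_int (- 2))" using P7.pcong_minus[OF C(2)] by simp
    then show ?thesis
      using 6 tT Tn M_gens rats by (intro hit[of "- e2" 0 "- 2"]) (auto simp: T2_def)
  next
    case 7
    have "P7.pcong (\<alpha> ^ 2 * q ^ 2) (of_int 6)" using P7.pcong_mult[OF D C(2)] by simp
    then show ?thesis
      using 7 tTS[OF tT(1)] M_mult[OF M_gens(2,5)] nM[OF M_gens(2) c(1) Tn(1)] rats r2
      unfolding T0_S by (intro hit[of "\<alpha> ^ 2 * q ^ 2" "- ((w - 1) ^ 2 * \<alpha> ^ 2 * q ^ 2)" 6]) auto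
  qed
qed

lemma order_two_cases:
  assumes "Some (x, 0) \<in> E.E" shows "Some (x, 0) \<in> {T0, T1, T2}"
proof -
  have "x * (x + e1) * (x + e2) = 0" using assms unfolding on_curve_iff by simp
  then have "x = 0 \<or> x = - e1 \<or> x = - e2" by (auto simp: add_eq_0_iff2)
  then show ?thesis by (auto simp: T0_def T1_def T2_def)
qed

text \<open>With \<open>D = \<alpha> ^ 2\<close>, the map sending \<open>(x, y)\<close> to
  \<open>(D x, \<alpha>^3 y)\<close> carries such a point to a rational torsion point of the twist
  by \<open>D\<close>. The twist reduces to the curve of \<open>torsion_of_twist\<close>, so only
  the 2-torsion is left.\<close>

lemma twisted_torsion_M:
  assumes P: "E.torsion (Some (x, y))" and x: "x \<in> \<rat>" and y: "y * \<alpha> \<in> \<rat>"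
  shows "Some (x, y) \<in> M"
proof -
  define D where "D = \<alpha> ^ 2"
  have D0: "D \<noteq> 0" using nonzero by (simp add: D_def)
  have D: "P7.pcong D 3" using e_cong by (simp add: D_def)
  have "P7.pcong (D * e1) (of_int 18)" "P7.pcong (D * e2) (of_int 6)"
    using P7.pcong_mult[OF D e_cong(1)] P7.pcong_mult[OF D e_cong(2)] by simp_all
  moreover have "P7.pcong (of_int 18) (of_int 4)" using P7.pcong_of_int[of 18 4] by simp
  ultimately have e: "P7.pcong (D * e1) 4" "P7.pcong (D * e2) 6"
    using P7.pcong_trans by fastforce+
  have e': "P7.pcong (D * e1) (of_int 4)" "P7.pcong (D * e2) (of_int 6)" using e by simp_all
  let ?a = "D * e1 + D * e2" and ?b = "(D * e1) * (D * e2)"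
  interpret F: elliptic_reduction ?a ?b 7
    by (rule good_reduction7[OF e']) simp_all
  have m: "affine_map D 0 (\<alpha> ^ 3) (cubic_mult 1 (e1 + e2) (e1 * e2) n Q) = cubic_mult 1 ?a ?b n (affine_map D 0 (\<alpha> ^ 3) Q)" for n Q
    by (rule cubic_mult_affine_map)
      (use nonzero in \<open>simp_all add: D_def algebra_simps power2_eq_square power3_eq_cube\<close>)
  obtain n :: nat where n: "n > 0" "cubic_mult 1 (e1 + e2) (e1 * e2) n (Some (x, y)) = None"
    using P E.torsion_def E.cubic_mult_eq_pow by auto
  have on: "y ^ 2 = x * (x + e1) * (x + e2)" using P E.torsion_def on_curve_iff by blast
  have "(\<alpha> ^ 3 * y) ^ 2 = D ^ 3 * y ^ 2" by (simp add: D_def algebra_simps power2_eq_square power3_eq_cube)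
  also have "\<dots> = (D * x) ^ 3 + ?a * (D * x) ^ 2 + ?b * (D * x)"
    unfolding on by (simp add: algebra_simps power2_eq_square power3_eq_cube)
  finally have onF: "Some (D * x, \<alpha> ^ 3 * y) \<in> F.E" by simp
  have "cubic_mult 1 ?a ?b n (Some (D * x, \<alpha> ^ 3 * y)) = None"
    using m[of n "Some (x, y)"] n by simp
  then have "F.torsion (Some (D * x, \<alpha> ^ 3 * y))"
    unfolding F.torsion_def using n onF F.cubic_mult_eq_pow by metis
  moreover have "D * x \<in> \<rat>" using x alpha_sq by (simp add: D_def)
  moreover have "\<alpha> ^ 3 * y \<in> \<rat>"
  proof -
    have eq: "\<alpha> ^ 3 * y = \<alpha> ^ 2 * (y * \<alpha>)" by algebra
    show ?thesis unfolding eq by (rule Rats_mult[OF alpha_sq y])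
  qed
  ultimately have "\<alpha> ^ 3 * y = 0" using torsion_of_twist[OF e] by blast
  then have "y = 0" using nonzero by simp
  then have "Some (x, 0) \<in> E.E" using P E.torsion_def by simp
  then have "Some (x, 0) \<in> {T0, T1, T2}" by (rule order_two_cases)
  then show ?thesis using \<open>y = 0\<close> M_gens by auto
qed

section \<open>The torsion over the quadratic field\<close>

abbreviation EK :: "point set" where "EK \<equiv> K_points (e1 + e2) (e1 * e2)"

lemma coeffs_rat: "e1 + e2 \<in> \<rat>" "e1 * e2 \<in> \<rat>"
  using w_rat q_rat alpha_sq by simp_all

lemma EK_mult: "P \<in> EK \<Longrightarrow> Q \<in> EK \<Longrightarrow> P \<otimes>\<^bsub>G\<^esub> Q \<in> EK"
  using conj_point_add[OF coeffs_rat] by simp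

lemma EK_carrier: "P \<in> EK \<Longrightarrow> P \<in> carrier G"
  using K_points_carrier by simp

lemma EK_pow: "P \<in> EK \<Longrightarrow> P [^]\<^bsub>G\<^esub> (n::nat) \<in> EK"
  by (induction n) (use EK_mult in simp_all)

lemma EK_inv: "P \<in> EK \<Longrightarrow> inv\<^bsub>G\<^esub> P \<in> EK"
  using K_points_neg E.ell_neg_eq_inv K_points_carrier by metis

lemma conj_pow:
  "P \<in> EK \<Longrightarrow> conj_point (P [^]\<^bsub>G\<^esub> (n::nat)) = conj_point P [^]\<^bsub>G\<^esub> n"
proof (induction n)
  case (Suc n)
  have "conj_point (P [^]\<^bsub>G\<^esub> n \<otimes>\<^bsub>G\<^esub> P) = conj_point (P [^]\<^bsub>G\<^esub> n) \<otimes>\<^bsub>G\<^esub> conj_point P"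
    using conj_point_add[OF coeffs_rat EK_pow[OF Suc(2)] Suc(2)] by simp
  with Suc show ?case by simp
qed simp

text \<open>The abscissa of a double is a square in \<open>K\<close>, but that of \<open>T1\<close>
  is \<open>- (w * \<alpha>)^2\<close>. In the real field \<open>K\<close> a nonzero square is never
  the negative of a square.\<close>

lemma T1_not_double:
  assumes "N \<in> EK" "N \<otimes>\<^bsub>G\<^esub> N = T1" shows False
proof -
  obtain x y where N: "N = Some (x, y)" using assms(2) by (cases N) (auto simp: T1_def)
  have K: "x \<in> K" "y \<in> K" and on: "y ^ 2 = x ^ 3 + (e1 + e2) * x ^ 2 + e1 * e2 * x"
    using assms(1) N by simp_all
  have y0: "y \<noteq> 0" using assms(2) by (auto simp: N T1_def)
  then have ne: "\<not> (x = x \<and> y = - y)" by simp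
  obtain l where l: "is_slope (e1 + e2) (e1 * e2) x y x y l" using is_slope_exists[OF on on ne] by blast
  have "Some (l ^ 2 - (e1 + e2) - x - x, l * (x - (l ^ 2 - (e1 + e2) - x - x)) - y) = T1"
    using cubic_add_slope[OF l ne] assms(2) unfolding N by (simp only: monoid.simps)
  then have x2: "l ^ 2 - (e1 + e2) - x - x = - e1" by (simp add: T1_def)
  have l2: "l * (2 * y) = 3 * x ^ 2 + 2 * (e1 + e2) * x + e1 * e2"
    using l unfolding is_slope_def by algebra
  \<comment> \<open>The duplication formula: \<open>4 y^2\<close> times the abscissa of the double
    is \<open>(x^2 - b)^2\<close>.\<close>
  have "(2 * y) ^ 2 * (l ^ 2 - (e1 + e2) - x - x) = (x ^ 2 - e1 * e2) ^ 2"
    using l2 on by algebra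
  then have sq: "- ((2 * y * (w * \<alpha>)) ^ 2) = (x ^ 2 - e1 * e2) ^ 2"
    unfolding x2 by (simp add: algebra_simps power2_eq_square)
  have QR: "z \<in> \<real>" if z: "z \<in> \<rat>" for z :: complex
  proof -
    obtain m n where "z = of_int m / of_int n" using Rats_cases'[OF z] by metis
    then show ?thesis by simp
  qed
  have KR: "z \<in> \<real>" if "z \<in> K" for z
    using that alpha_real QR unfolding K_def by auto
  have R': "x ^ 2 - e1 * e2 \<in> \<real>" "2 * y * (w * \<alpha>) \<in> \<real>"
    using KR[OF K(1)] KR[OF K(2)] alpha_real KR[OF K_Rats[OF w_rat]] KR[OF K_Rats[OF coeffs_rat(2)]] by simp_all
  obtain s t where st: "x ^ 2 - e1 * e2 = complex_of_real s" "2 * y * (w * \<alpha>) = complex_of_real t"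
    using R' by (auto elim!: Reals_cases)
  have "- (t ^ 2) = s ^ 2"
    using sq unfolding st by (metis of_real_eq_iff of_real_minus of_real_power)
  then have "t = 0" by (smt (verit) zero_le_power2 zero_eq_power2)
  then show False using st(2) y0 nonzero by simp
qed

lemma gens_EK: "T0 \<in> EK" "T1 \<in> EK" "T2 \<in> EK" "R \<in> EK" "S \<in> EK"
proof -
  have r: "w \<in> K" "q \<in> K" "\<alpha> \<in> K" "0 \<in> K" "1 \<in> K" using w_rat q_rat K_Rats K_alpha by simp_all
  have iff: "Some (x, y) \<in> EK \<longleftrightarrow> x \<in> K \<and> y \<in> K \<and> Some (x, y) \<in> carrier G" for x y by simp
  show "T0 \<in> EK" unfolding T0_def iff using T_carrier(1)[unfolded T0_def] r by blast
  show "T1 \<in> EK" unfolding T1_def iff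
    by (intro conjI K_closed r) (rule T_carrier(2)[unfolded T1_def])
  show "T2 \<in> EK" unfolding T2_def iff
    by (intro conjI K_closed r) (rule T_carrier(3)[unfolded T2_def])
  show "R \<in> EK" unfolding R_def iff
    by (intro conjI K_closed r) (rule R_carrier[unfolded R_def])
  show "S \<in> EK" unfolding S_def iff
    by (intro conjI K_closed r) (rule S_carrier[unfolded S_def])
qed

lemma H_EK:
  assumes "h \<in> H" shows "h \<in> EK"
proof -
  obtain i j k :: nat where h: "h = T1 [^]\<^bsub>G\<^esub> i \<otimes>\<^bsub>G\<^esub> (R [^]\<^bsub>G\<^esub> j \<otimes>\<^bsub>G\<^esub> S [^]\<^bsub>G\<^esub> k)"
    using assms unfolding H_def by blast
  show ?thesis unfolding h by (intro EK_mult EK_pow gens_EK)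
qed

lemma M_H: "x \<in> M \<Longrightarrow> x \<in> H"
proof -
  assume "x \<in> M"
  then obtain i h where "x = T1 [^]\<^bsub>G\<^esub> (i::nat) \<otimes>\<^bsub>G\<^esub> (h \<otimes>\<^bsub>G\<^esub> h)" "h \<in> H" unfolding M_def by blast
  moreover have "T1 [^]\<^bsub>G\<^esub> i \<in> H" using H_I[of i 0 0] by simp
  ultimately show ?thesis using H_mult by blast
qed

lemma torsion_in_H:
  assumes P: "P \<in> EK" and tor: "E.torsion P"
  shows "P \<in> H"
proof -
  define C where "C = conj_point P"
  have C: "C \<in> EK" unfolding C_def by (rule conj_point_K_points[OF coeffs_rat P])
  have Pc: "P \<in> carrier G" and Cc: "C \<in> carrier G" using P C EK_carrier by blast+
  have torC: "E.torsion C"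
  proof -
    obtain n :: nat where "n > 0" "P [^]\<^bsub>G\<^esub> n = None" using tor E.torsion_def by auto
    moreover from this have "C [^]\<^bsub>G\<^esub> n = None" using conj_pow[OF P, of n] by (simp add: C_def)
    ultimately show ?thesis unfolding E.torsion_def using Cc by auto
  qed
  define U where "U = P \<otimes>\<^bsub>G\<^esub> C"
  define V where "V = P \<otimes>\<^bsub>G\<^esub> ell_neg C"
  have nC: "ell_neg C \<in> EK" using K_points_neg C by blast
  have UK: "U \<in> EK" and VK: "V \<in> EK" using EK_mult P C nC by (simp_all only: U_def V_def)
  have torU: "E.torsion U" using E.torsion_add[OF tor torC] by (simp add: U_def)
  have torV: "E.torsion V" using E.torsion_add[OF tor E.torsion_neg[OF torC]] by (simp add: V_def)
  have cC: "conj_point C = P" unfolding C_def by (rule conj_point_conj[OF P])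
  have "conj_point U = C \<otimes>\<^bsub>G\<^esub> P"
    using conj_point_add[OF coeffs_rat P C] by (simp add: U_def cC C_def[symmetric])
  then have cU: "conj_point U = U" using E.G.m_comm[OF Pc Cc] by (simp only: U_def)
  have "conj_point V = C \<otimes>\<^bsub>G\<^esub> ell_neg P"
    using conj_point_add[OF coeffs_rat P nC] conj_point_neg[OF C] by (simp add: V_def cC C_def[symmetric])
  also have "\<dots> = inv\<^bsub>G\<^esub> V"
  proof -
    have n: "ell_neg P = inv\<^bsub>G\<^esub> P" "ell_neg C = inv\<^bsub>G\<^esub> C" using E.ell_neg_eq_inv Pc Cc by simp_all
    have "inv\<^bsub>G\<^esub> V = inv\<^bsub>G\<^esub> P \<otimes>\<^bsub>G\<^esub> inv\<^bsub>G\<^esub> (inv\<^bsub>G\<^esub> C)"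
      unfolding V_def n by (rule E.G.inv_mult[OF Pc E.G.inv_closed[OF Cc]])
    also have "\<dots> = C \<otimes>\<^bsub>G\<^esub> inv\<^bsub>G\<^esub> P"
      unfolding E.G.inv_inv[OF Cc] by (rule E.G.m_comm[OF E.G.inv_closed[OF Pc] Cc])
    finally show ?thesis unfolding n by simp
  qed
  also have "\<dots> = ell_neg V" using E.ell_neg_eq_inv[of V] EK_carrier[OF VK] by simp
  finally have cV: "conj_point V = ell_neg V" .
  have UM: "U \<in> M"
  proof (cases U rule: ell_neg.cases)
    case 1
    then show ?thesis using M_gens(1) by simp
  next
    case (2 x y)
    then have "x \<in> \<rat>" "y \<in> \<rat>" using UK cU galois_fixed by auto
    then show ?thesis using rational_torsion_M torU 2 by blast
  qed
  have VM: "V \<in> M"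
  proof (cases V rule: ell_neg.cases)
    case 1
    then show ?thesis using M_gens(1) by simp
  next
    case (2 x y)
    then have "x \<in> \<rat>" "y * \<alpha> \<in> \<rat>" using VK cV galois_fixed galois_negated by auto
    then show ?thesis using twisted_torsion_M torV 2 by blast
  qed
  \<comment> \<open>Sum and difference of \<open>P\<close> and its conjugate add up to twice
    \<open>P\<close>, so twice \<open>P\<close> lies in \<open>M\<close>.\<close>
  have "U \<otimes>\<^bsub>G\<^esub> V = (P \<otimes>\<^bsub>G\<^esub> P) \<otimes>\<^bsub>G\<^esub> (C \<otimes>\<^bsub>G\<^esub> inv\<^bsub>G\<^esub> C)"
  proof -
    have n: "ell_neg C = inv\<^bsub>G\<^esub> C" using E.ell_neg_eq_inv Cc by simp
    show ?thesis unfolding U_def V_def n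
      using E.G.mult_interchange[OF Pc Cc E.G.one_closed Pc E.G.inv_closed[OF Cc] E.G.one_closed]
        E.G.r_one Cc E.G.inv_closed[OF Cc] E.G.m_closed E.G.one_closed by metis
  qed
  then have PP: "P \<otimes>\<^bsub>G\<^esub> P \<in> M"
    using M_mult[OF UM VM] E.G.r_inv[OF Cc] E.G.r_one[OF E.G.m_closed[OF Pc Pc]] by simp
  then obtain i h where h: "P \<otimes>\<^bsub>G\<^esub> P = T1 [^]\<^bsub>G\<^esub> (i::nat) \<otimes>\<^bsub>G\<^esub> (h \<otimes>\<^bsub>G\<^esub> h)" "h \<in> H"
    unfolding M_def by blast
  have hc: "h \<in> carrier G" using h H_carrier by blast
  \<comment> \<open>Subtracting \<open>h\<close> leaves a point whose double is a multiple of
    \<open>T1\<close>. The odd multiple is impossible by \<open>T1_not_double\<close>, so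
    \<open>N\<close> is 2-torsion and already belongs to \<open>M\<close>.\<close>
  define N where "N = P \<otimes>\<^bsub>G\<^esub> inv\<^bsub>G\<^esub> h"
  have NK: "N \<in> EK" unfolding N_def by (rule EK_mult[OF P EK_inv[OF H_EK[OF h(2)]]])
  have Ti: "T1 [^]\<^bsub>G\<^esub> i \<in> carrier G" using T_carrier E.G.nat_pow_closed by blast
  have "N \<otimes>\<^bsub>G\<^esub> N = (P \<otimes>\<^bsub>G\<^esub> P) \<otimes>\<^bsub>G\<^esub> (inv\<^bsub>G\<^esub> h \<otimes>\<^bsub>G\<^esub> inv\<^bsub>G\<^esub> h)"
    unfolding N_def
    using E.G.mult_interchange[OF Pc E.G.inv_closed[OF hc] E.G.one_closed Pc E.G.inv_closed[OF hc] E.G.one_closed]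
      E.G.r_one E.G.inv_closed[OF hc] E.G.m_closed E.G.one_closed by metis
  also have "\<dots> = T1 [^]\<^bsub>G\<^esub> i \<otimes>\<^bsub>G\<^esub> ((h \<otimes>\<^bsub>G\<^esub> h) \<otimes>\<^bsub>G\<^esub> inv\<^bsub>G\<^esub> (h \<otimes>\<^bsub>G\<^esub> h))"
    unfolding h E.G.inv_mult[OF hc hc]
    using E.G.m_assoc Ti hc E.G.m_closed E.G.inv_closed by metis
  also have "\<dots> = T1 [^]\<^bsub>G\<^esub> i" using E.G.r_inv[OF E.G.m_closed[OF hc hc]] E.G.r_one[OF Ti] by metis
  also have "\<dots> = T1 [^]\<^bsub>G\<^esub> (i mod 2)" using E.G.nat_pow_mod[OF T_carrier(2) pow_eq(1)] by metis
  finally have NN: "N \<otimes>\<^bsub>G\<^esub> N = T1 [^]\<^bsub>G\<^esub> (i mod 2)" .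
  have "i mod 2 \<noteq> 1"
  proof
    assume "i mod 2 = 1"
    then have "N \<otimes>\<^bsub>G\<^esub> N = T1" using NN pow_one by metis
    then show False using T1_not_double NK by blast
  qed
  then have "i mod 2 = 0" by simp
  then have N2: "N \<otimes>\<^bsub>G\<^esub> N = None" using NN by simp
  have "N \<in> M"
  proof (cases N rule: ell_neg.cases)
    case 1
    then show ?thesis using M_gens(1) by simp
  next
    case (2 x y)
    have "y = 0"
    proof (rule ccontr)
      assume "y \<noteq> 0"
      then have "\<not> (x = x \<and> y = - y)" by simp
      then show False using N2 2 by (simp add: Let_def split: if_splits)
    qed
    then have "Some (x, 0) \<in> E.E" using K_points_carrier[OF NK] 2 by simp
    then have "Some (x, 0) \<in> {T0, T1, T2}" by (rule order_two_cases)
    then show ?thesis using 2 \<open>y = 0\<close> M_gens by auto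
  qed
  then have "N \<otimes>\<^bsub>G\<^esub> h \<in> H" using M_H H_mult h by blast
  moreover have "N \<otimes>\<^bsub>G\<^esub> h = P"
    unfolding N_def using E.G.m_assoc[OF Pc E.G.inv_closed[OF hc] hc] E.G.l_inv[OF hc] E.G.r_one[OF Pc] by metis
  ultimately show ?thesis by simp
qed

lemma torsion_H: "{P \<in> EK. E.torsion P} = H"
proof
  show "{P \<in> EK. E.torsion P} \<subseteq> H" using torsion_in_H by blast
  show "H \<subseteq> {P \<in> EK. E.torsion P}"
  proof
    fix h assume hH: "h \<in> H"
    then obtain i j k :: nat where h: "h = T1 [^]\<^bsub>G\<^esub> i \<otimes>\<^bsub>G\<^esub> (R [^]\<^bsub>G\<^esub> j \<otimes>\<^bsub>G\<^esub> S [^]\<^bsub>G\<^esub> k)"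
      unfolding H_def by blast
    have t: "E.torsion (X [^]\<^bsub>G\<^esub> m)" if "X \<in> carrier G" "X [^]\<^bsub>G\<^esub> n = \<one>\<^bsub>G\<^esub>" "n > 0" for X and m n :: nat
    proof -
      have "(X [^]\<^bsub>G\<^esub> m) [^]\<^bsub>G\<^esub> n = (X [^]\<^bsub>G\<^esub> n) [^]\<^bsub>G\<^esub> m"
        using E.G.nat_pow_pow[OF that(1)] by (metis mult.commute)
      then have "(X [^]\<^bsub>G\<^esub> m) [^]\<^bsub>G\<^esub> n = None" using that E.G.nat_pow_one by (metis monoid.select_convs(2))
      moreover have "X [^]\<^bsub>G\<^esub> m \<in> E.E" using E.G.nat_pow_closed[OF that(1)] by simp
      ultimately show ?thesis unfolding E.torsion_def using that by blast
    qed
    have "E.torsion h"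
      unfolding h
      using E.torsion_add[OF t[OF T_carrier(2) pow_eq(1)] E.torsion_add[OF t[OF R_carrier pow_eq(2)] t[OF S_carrier pow_eq(3)]]]
      by simp
    then show "h \<in> {P \<in> EK. E.torsion P}" using H_EK hH by blast
  qed
qed

lemma torsion_parametrization:
  obtains f :: "nat \<times> nat \<Rightarrow> point" where "bij_betw f ({..<2} \<times> {..<12}) {P \<in> EK. E.torsion P}"
    "\<And>i j i' j'. f ((i + i') mod 2, (j + j') mod 12) = f (i, j) \<otimes>\<^bsub>G\<^esub> f (i', j')"
proof -
  have 1: "T1 \<noteq> \<one>\<^bsub>G\<^esub>" "R \<otimes>\<^bsub>G\<^esub> R \<noteq> \<one>\<^bsub>G\<^esub>" "T1 \<noteq> R \<otimes>\<^bsub>G\<^esub> R" "S \<noteq> \<one>\<^bsub>G\<^esub>"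
    unfolding R_R using nonzero by (simp_all add: T1_def T0_def S_def)
  have 2: "T1 \<otimes>\<^bsub>G\<^esub> T1 = \<one>\<^bsub>G\<^esub>" "(R \<otimes>\<^bsub>G\<^esub> R) \<otimes>\<^bsub>G\<^esub> (R \<otimes>\<^bsub>G\<^esub> R) = \<one>\<^bsub>G\<^esub>"
    unfolding R_R using T1_T1 T0_T0 by simp_all
  obtain f :: "nat \<times> nat \<Rightarrow> point" where f: "bij_betw f ({..<2} \<times> {..<12}) H"
    "\<And>i j i' j'. f ((i + i') mod 2, (j + j') mod 12) = f (i, j) \<otimes>\<^bsub>G\<^esub> f (i', j')"
    by (rule E.G.Z2_Z12_parametrization[OF T_carrier(2) R_carrier S_carrier 1(1) 2(1) 1(2) 2(2) 1(3,4) S_S_S H_def]) blast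
  show ?thesis by (rule that[of f]) (simp only: torsion_H f(1), rule f(2))
qed

section \<open>The triple and the transfer to its induced curve\<close>

abbreviation c3 :: complex where "c3 \<equiv> (w ^ 2 - 1) / \<alpha>"

lemma triple: "diophantine_triple K \<alpha> (- 1 / \<alpha>) c3"
proof -
  have r: "w \<in> K" "q \<in> K" "\<alpha> \<in> K" "0 \<in> K" "1 \<in> K" using w_rat q_rat K_Rats K_alpha by simp_all
  obtain t where t: "\<alpha> = complex_of_real t" using alpha_real by (auto elim: Reals_cases)
  have "\<alpha> * \<alpha> \<noteq> - 1"
  proof
    assume "\<alpha> * \<alpha> = - 1"
    then have "complex_of_real (t * t) = complex_of_real (- 1)" using t by simp
    then have "t * t = - 1" using of_real_eq_iff by blast
    then show False using zero_le_square[of t] by linarith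
  qed
  then have 1: "\<alpha> \<noteq> - 1 / \<alpha>" using nonzero(1) by (simp add: field_simps)
  have 2: "\<alpha> \<noteq> c3"
  proof
    assume "\<alpha> = c3"
    then have "\<alpha> ^ 2 = w ^ 2 - 1" using nonzero(1) by (simp add: field_simps power2_eq_square)
    then have "q ^ 2 = 0" using alpha_eq q_eq by algebra
    then show False using nonzero by simp
  qed
  have 3: "- 1 / \<alpha> \<noteq> c3"
  proof
    assume "- 1 / \<alpha> = c3"
    then have "w ^ 2 = 0" using nonzero(1) by (simp add: divide_eq_eq eq_divide_eq)
    then show False using nonzero by simp
  qed
  \<comment> \<open>The three square roots are 0, \<open>w\<close> and \<open>q / \<alpha>\<close>;
    zero counts as a square.\<close>
  have "\<alpha> * (- 1 / \<alpha>) + 1 = 0 ^ 2" "\<alpha> * c3 + 1 = w ^ 2" using nonzero by simp_all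
  moreover have "- 1 / \<alpha> * c3 + 1 = (q / \<alpha>) ^ 2"
  proof -
    have "- 1 / \<alpha> * c3 + 1 = (\<alpha> ^ 2 - (w ^ 2 - 1)) / \<alpha> ^ 2"
      using nonzero(1) by (simp add: field_simps power2_eq_square)
    also have "\<alpha> ^ 2 - (w ^ 2 - 1) = q ^ 2" unfolding alpha_eq q_eq by simp
    finally show ?thesis by (simp add: power_divide)
  qed
  ultimately show ?thesis
    unfolding diophantine_triple_def is_square_in_def
    using 1 2 3 nonzero r K_closed by (auto intro: bexI[of _ 0] bexI[of _ w] bexI[of _ "q / \<alpha>"])
qed

text \<open>This is \<open>a b c \<alpha>^2\<close> for the triple. Multiplying \<open>x\<close> by
  \<open>a b c\<close> makes the induced curve monic with roots \<open>- a b\<close>,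
  \<open>- a c\<close>, \<open>- b c\<close>; the factor \<open>\<alpha>^2\<close> clears
  denominators, and the shift by \<open>- \<alpha>^2\<close> moves the root coming from
  \<open>a b = - 1\<close> to 0.\<close>

abbreviation \<kappa> :: complex where "\<kappa> \<equiv> - \<alpha> * (w ^ 2 - 1)"
abbreviation \<Phi> :: "point \<Rightarrow> point" where "\<Phi> \<equiv> affine_map \<kappa> (- (\<alpha> ^ 2)) (\<kappa> * \<alpha>)"

lemma triple_curve_coeffs:
  defines "b3 \<equiv> - 1 / \<alpha>"
  shows "\<alpha> * b3 * c3 \<noteq> 0" "\<kappa> \<noteq> 0" "\<kappa> * \<alpha> \<noteq> 0" "(\<kappa> * \<alpha>) ^ 2 * (\<alpha> * b3 * c3) = \<kappa> ^ 3"
    "(e1 + e2 + 3 * (- (\<alpha> ^ 2))) * (\<alpha> * b3 * c3) = \<kappa> * (\<alpha> * b3 + \<alpha> * c3 + b3 * c3)"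
    "(3 * (- (\<alpha> ^ 2)) ^ 2 + 2 * (e1 + e2) * (- (\<alpha> ^ 2)) + e1 * e2) * (\<alpha> * b3 * c3) = \<kappa> ^ 2 * (\<alpha> + b3 + c3)"
proof -
  show "\<alpha> * b3 * c3 \<noteq> 0" "\<kappa> \<noteq> 0" "\<kappa> * \<alpha> \<noteq> 0" using nonzero by (simp_all add: b3_def)
  define u where "u = 1 / \<alpha>"
  have u: "\<alpha> * u = 1" using nonzero by (simp add: u_def)
  have b: "b3 = - u" "c3 = (w ^ 2 - 1) * u" by (simp_all add: b3_def u_def)
  have q': "q ^ 2 = \<alpha> ^ 2 - w ^ 2 + 1" using alpha_eq q_eq by simp
  show "(\<kappa> * \<alpha>) ^ 2 * (\<alpha> * b3 * c3) = \<kappa> ^ 3" unfolding b using u by algebra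
  show "(e1 + e2 + 3 * (- (\<alpha> ^ 2))) * (\<alpha> * b3 * c3) = \<kappa> * (\<alpha> * b3 + \<alpha> * c3 + b3 * c3)"
    unfolding b q' using u by algebra
  show "(3 * (- (\<alpha> ^ 2)) ^ 2 + 2 * (e1 + e2) * (- (\<alpha> ^ 2)) + e1 * e2) * (\<alpha> * b3 * c3) = \<kappa> ^ 2 * (\<alpha> + b3 + c3)"
    unfolding b q' using u by algebra
qed

lemma \<Phi>_points: "\<Phi> P \<in> EK \<longleftrightarrow> P \<in> dt_points K \<alpha> (- 1 / \<alpha>) c3"
proof (cases P rule: ell_neg.cases)
  case 1
  then show ?thesis by (simp add: dt_points_def)
next
  case (2 x y)
  have r: "w \<in> K" "q \<in> K" "\<alpha> \<in> K" "0 \<in> K" "1 \<in> K" using w_rat q_rat K_Rats K_alpha by simp_all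
  note nz = triple_curve_coeffs(2,3)
  have kK: "\<kappa> \<in> K" "\<kappa> * \<alpha> \<in> K" "\<alpha> ^ 2 \<in> K" by (intro K_closed r)+
  have x: "\<kappa> * x + - (\<alpha> ^ 2) \<in> K \<longleftrightarrow> x \<in> K"
  proof
    assume *: "\<kappa> * x + - (\<alpha> ^ 2) \<in> K"
    have "(\<kappa> * x + - (\<alpha> ^ 2) + \<alpha> ^ 2) / \<kappa> \<in> K" by (rule K_closed(4)[OF K_closed(1)[OF * kK(3)] kK(1)])
    moreover have "(\<kappa> * x + - (\<alpha> ^ 2) + \<alpha> ^ 2) / \<kappa> = x" using nz(1) by simp
    ultimately show "x \<in> K" by (simp only:)
  next
    assume "x \<in> K"
    then show "\<kappa> * x + - (\<alpha> ^ 2) \<in> K" by (intro K_closed r)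
  qed
  have y: "\<kappa> * \<alpha> * y \<in> K \<longleftrightarrow> y \<in> K"
  proof
    assume *: "\<kappa> * \<alpha> * y \<in> K"
    have "\<kappa> * \<alpha> * y / (\<kappa> * \<alpha>) \<in> K" by (rule K_closed(4)[OF * kK(2)])
    then show "y \<in> K" unfolding nonzero_mult_div_cancel_left[OF nz(2)] .
  next
    assume "y \<in> K"
    then show "\<kappa> * \<alpha> * y \<in> K" by (intro K_closed r)
  qed
  define f where "f = (\<alpha> * x + 1) * (- 1 / \<alpha> * x + 1) * (c3 * x + 1)"
  define X where "X = \<kappa> * x + - (\<alpha> ^ 2)"
  have q': "q ^ 2 = \<alpha> ^ 2 - w ^ 2 + 1" using alpha_eq q_eq by simp
  define u where "u = 1 / \<alpha>"
  have u: "\<alpha> * u = 1" using nonzero by (simp add: u_def)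
  have cu: "c3 = (w ^ 2 - 1) * u" "- 1 / \<alpha> = - u" by (simp_all add: u_def)
  have "X * (X + e1) * (X + e2) = (\<kappa> * \<alpha>) ^ 2 * f"
    unfolding X_def f_def cu q' using u by algebra
  then have "(\<kappa> * \<alpha> * y) ^ 2 = X * (X + e1) * (X + e2) \<longleftrightarrow> (\<kappa> * \<alpha>) ^ 2 * y ^ 2 = (\<kappa> * \<alpha>) ^ 2 * f"
    by (simp only: power_mult_distrib)
  also have "\<dots> \<longleftrightarrow> y ^ 2 = f" using nz by simp
  finally have on: "Some (X, \<kappa> * \<alpha> * y) \<in> E.E \<longleftrightarrow> y ^ 2 = f" unfolding on_curve_iff .
  show ?thesis
    unfolding 2 affine_map.simps K_points_Some x y using on
    by (simp add: dt_points_def f_def X_def)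
qed

lemma torsion_Z2_Z12_triple: "torsion_Z2_Z12 K \<alpha> (- 1 / \<alpha>) c3"
proof -
  obtain f :: "nat \<times> nat \<Rightarrow> point" where f: "bij_betw f ({..<2} \<times> {..<12}) {P \<in> EK. E.torsion P}"
    and hom: "\<And>i j i' j'. f ((i + i') mod 2, (j + j') mod 12) = f (i, j) \<otimes>\<^bsub>G\<^esub> f (i', j')"
    using torsion_parametrization by blast
  let ?b = "- 1 / \<alpha>"
  note co = triple_curve_coeffs
  have inj: "inj \<Phi>" using affine_map_inj[OF co(2,3)] by (meson injI)
  have add: "\<Phi> (dt_add \<alpha> ?b c3 P Q) = \<Phi> P \<otimes>\<^bsub>G\<^esub> \<Phi> Q" for P Q
    using affine_map_cubic_add[OF co] unfolding dt_add_def by (simp only: monoid.simps)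
  have mult: "\<Phi> (dt_mult \<alpha> ?b c3 n P) = cubic_mult 1 (e1 + e2) (e1 * e2) n (\<Phi> P)" for n P
    using cubic_mult_affine_map[OF co] unfolding dt_mult_def .
  have None_iff: "\<Phi> P = None \<longleftrightarrow> P = None" for P by (cases P rule: ell_neg.cases) auto
  have tor: "P \<in> dt_torsion K \<alpha> ?b c3 \<longleftrightarrow> \<Phi> P \<in> EK \<and> E.torsion (\<Phi> P)" for P
  proof -
    have "dt_mult \<alpha> ?b c3 n P = None \<longleftrightarrow> \<Phi> P [^]\<^bsub>G\<^esub> n = None" if "\<Phi> P \<in> EK" for n
      using mult[of n P] None_iff E.cubic_mult_eq_pow[OF K_points_carrier[OF that]] by metis
    then show ?thesis
      unfolding dt_torsion_def E.torsion_def using \<Phi>_points K_points_carrier by auto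
  qed
  have surj: "\<exists>Q. \<Phi> Q = P" for P
  proof (cases P rule: ell_neg.cases)
    case (2 x y)
    have "\<Phi> (Some ((x + \<alpha> ^ 2) / \<kappa>, y / (\<kappa> * \<alpha>))) = P"
      unfolding 2 affine_map.simps using co(2,3) by simp
    then show ?thesis by blast
  qed (auto intro: exI[of _ None])
  have \<Phi>i: "\<Phi> (the_inv \<Phi> P) = P" for P using surj the_inv_f_f[OF inj] by metis
  have "the_inv \<Phi> ` {P \<in> EK. E.torsion P} = dt_torsion K \<alpha> ?b c3"
  proof (intro equalityI subsetI)
    fix Q assume "Q \<in> the_inv \<Phi> ` {P \<in> EK. E.torsion P}"
    then obtain P where P: "P \<in> EK" "E.torsion P" "Q = the_inv \<Phi> P" by blast
    have "\<Phi> Q = P" unfolding P(3) by (rule \<Phi>i)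
    then show "Q \<in> dt_torsion K \<alpha> ?b c3" using P(1,2) by (simp only: tor)
  next
    fix Q assume "Q \<in> dt_torsion K \<alpha> ?b c3"
    then have "\<Phi> Q \<in> {P \<in> EK. E.torsion P}" using tor by blast
    then show "Q \<in> the_inv \<Phi> ` {P \<in> EK. E.torsion P}"
      by (rule image_eqI[rotated]) (rule the_inv_f_f[OF inj, symmetric])
  qed
  moreover have "inj_on (the_inv \<Phi>) {P \<in> EK. E.torsion P}"
    by (rule inj_on_inverseI[of _ \<Phi>]) (rule \<Phi>i)
  ultimately have "bij_betw (the_inv \<Phi>) {P \<in> EK. E.torsion P} (dt_torsion K \<alpha> ?b c3)"
    by (simp only: bij_betw_def)
  then have "bij_betw (the_inv \<Phi> \<circ> f) ({..<2} \<times> {..<12}) (dt_torsion K \<alpha> ?b c3)"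
    by (rule bij_betw_trans[OF f])
  moreover have "(the_inv \<Phi> \<circ> f) ((i + i') mod 2, (j + j') mod 12) =
      dt_add \<alpha> ?b c3 ((the_inv \<Phi> \<circ> f) (i, j)) ((the_inv \<Phi> \<circ> f) (i', j'))" for i j i' j'
  proof -
    have "\<Phi> (dt_add \<alpha> ?b c3 ((the_inv \<Phi> \<circ> f) (i, j)) ((the_inv \<Phi> \<circ> f) (i', j'))) = f (i, j) \<otimes>\<^bsub>G\<^esub> f (i', j')"
      unfolding add comp_def \<Phi>i ..
    then show ?thesis unfolding comp_def hom by (metis the_inv_f_f[OF inj])
  qed
  ultimately show ?thesis unfolding torsion_Z2_Z12_def by (intro exI[of _ "the_inv \<Phi> \<circ> f"] conjI ballI)
qed

end

section \<open>Infinitely many triples and fields\<close>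

definition triple_quartic :: "complex \<Rightarrow> complex" where
  "triple_quartic t = t * (1 + t) * (1 + t + t ^ 2)"

text \<open>
  Under \<open>Z = 1 / t\<close> the curve \<open>s\<^sup>2 = t (1 + t) (1 + t + t\<^sup>2)\<close> becomes \<open>Y\<^sup>2 = Z\<^sup>3 + 2 Z\<^sup>2 + 2 Z + 1\<close>. The map
  \<open>tripling\<close> is multiplication by 3 on it, and \<open>tri_num t = t\<^sup>4 \<psi>\<^sub>3(1 / t)\<close> for its third division polynomial.
\<close>

definition tri_num :: "complex \<Rightarrow> complex" where
  "tri_num t = 3 + 8 * t + 12 * t ^ 2 + 12 * t ^ 3 + 4 * t ^ 4"

definition tri_den :: "complex \<Rightarrow> complex" where
  "tri_den t = 1 - 24 * t ^ 2 - 128 * t ^ 3 - 312 * t ^ 4 - 432 * t ^ 5 - 368 * t ^ 6 - 192 * t ^ 7 - 48 * t ^ 8"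

definition tripling :: "complex \<Rightarrow> complex" where
  "tripling t = t * tri_num t ^ 2 / tri_den t"

lemma triple_quartic_tripling:
  assumes "tri_den t \<noteq> 0" "t \<in> \<rat>"
  obtains c where "c \<in> \<rat>" "triple_quartic (tripling t) = c ^ 2 * triple_quartic t"
proof -
  define A B where "A = tri_num t" "B = tri_den t"
  note AB = A_B_def
  \<comment> \<open>Multiplication by 3 fixes the 2-torsion points \<open>Z = - 1\<close> and the
    roots of \<open>Z^2 + Z + 1\<close>, so it multiplies the distance of \<open>Z\<close> from each
    of them by a square. Up to denominators \<open>g\<close> is the square root for
    \<open>- 1\<close>, and \<open>h\<close> the product of the two conjugate ones.\<close>
  define g where "g = 1 + 4 * t - 4 * t ^ 3 - 4 * t ^ 4"
  define h where "h = 1 + 4 * t + 28 * t ^ 2 + 112 * t ^ 3 + 232 * t ^ 4 + 256 * t ^ 5 + 160 * t ^ 6 + 64 * t ^ 7 + 16 * t ^ 8"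
  have B: "B \<noteq> 0" using assms by (simp add: AB)
  have 1: "B + t * A ^ 2 = (1 + t) * g ^ 2"
    unfolding AB g_def tri_num_def tri_den_def by algebra
  have 2: "B ^ 2 + B * (t * A ^ 2) + (t * A ^ 2) ^ 2 = (1 + t + t ^ 2) * h ^ 2"
    unfolding AB h_def tri_num_def tri_den_def by algebra
  have T: "tripling t = t * A ^ 2 / B" by (simp add: tripling_def AB)
  have "1 + tripling t = (B + t * A ^ 2) / B" unfolding T using B by (simp add: field_simps)
  then have 3: "1 + tripling t = (1 + t) * g ^ 2 / B" unfolding 1 .
  have "1 + tripling t + tripling t ^ 2 = (B ^ 2 + B * (t * A ^ 2) + (t * A ^ 2) ^ 2) / B ^ 2"
    unfolding T using B by (simp add: field_simps power2_eq_square)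
  then have 4: "1 + tripling t + tripling t ^ 2 = (1 + t + t ^ 2) * h ^ 2 / B ^ 2" unfolding 2 .
  have "triple_quartic (tripling t) = (t * A ^ 2 / B) * ((1 + t) * g ^ 2 / B) * ((1 + t + t ^ 2) * h ^ 2 / B ^ 2)"
    unfolding triple_quartic_def[of "tripling t"] 4 unfolding 3 unfolding T ..
  also have "\<dots> = (A * g * h / B ^ 2) ^ 2 * triple_quartic t"
    unfolding triple_quartic_def by (simp add: power2_eq_square)
  finally have "triple_quartic (tripling t) = (A * g * h / B ^ 2) ^ 2 * triple_quartic t" .
  moreover have "A * g * h / B ^ 2 \<in> \<rat>"
    using assms(2) by (simp add: AB g_def h_def tri_num_def tri_den_def)
  ultimately show ?thesis using that by blast
qed

text \<open>Doubling a point with \<open>Z = 1\<close> gives \<open>Z = 2\<close> modulo 7, a root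
  of the cubic. Points over \<open>t = 1\<close> thus have order 4 on the reduction of the relevant
  twist, and tripling is negation there.\<close>

lemma tripling_mod7:
  assumes "P7.pcong t 1"
  shows "tri_den t \<noteq> 0" "P7.pcong (tripling t) 1"
proof -
  have "P7.pcong (tri_den t) (tri_den 1)" "P7.pcong (t * tri_num t ^ 2) (1 * tri_num 1 ^ 2)"
    unfolding tri_den_def tri_num_def by (intro P7.pcong_intros assms P7.pcong_refl; simp)+
  moreover have v: "tri_den 1 = of_int (- 1503)" "1 * tri_num 1 ^ 2 = of_int 1521"
    by (simp_all add: tri_den_def tri_num_def)
  moreover have "P7.pcong (of_int (- 1503)) (of_int 2)" "P7.pcong (of_int 1521) (of_int 2)"
    using P7.pcong_of_int[of "- 1503" 2] P7.pcong_of_int[of 1521 2] by simp_all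
  ultimately have d: "P7.pcong (tri_den t) (of_int 2)" and n: "P7.pcong (t * tri_num t ^ 2) (of_int 2)"
    using P7.pcong_trans by metis+
  have d1: "tri_den t \<notin> padic 7 1"
  proof
    assume "tri_den t \<in> padic 7 1"
    then have "P7.pcong (tri_den t) (of_int 0)" using P7.pcong_0 by simp
    from P7.pcong_trans[OF P7.pcong_sym[OF d] this]
    show False using P7.pcong_of_int[of 2 0] by simp
  qed
  then show d0: "tri_den t \<noteq> 0" by auto
  have d2: "tri_den t \<in> padic 7 0" using d by (simp add: P7.pcong_def)
  have "t * tri_num t ^ 2 - tri_den t \<in> padic 7 1"
    using P7.pcong_trans[OF n P7.pcong_sym[OF d]] by (simp add: P7.pcong_def)
  then have "(t * tri_num t ^ 2 - tri_den t) / tri_den t \<in> padic 7 1" using P7.padic_divide d1 d2 by blast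
  moreover have "(t * tri_num t ^ 2 - tri_den t) / tri_den t = tripling t - 1"
    using d0 by (simp add: tripling_def diff_divide_distrib)
  moreover have "tripling t \<in> padic 7 0"
    unfolding tripling_def using n d1 d2 P7.padic_divide by (simp add: P7.pcong_def)
  ultimately show "P7.pcong (tripling t) 1" by (simp add: P7.pcong_def)
qed

interpretation P3: prime_int 3
  by unfold_locales simp

text \<open>The point \<open>t = 0\<close> is the identity of the curve, and \<open>t\<close> behaves like the square of a parameter
  of the formal group, so tripling multiplies it by 9 to first order.\<close>

lemma tripling_valuation:
  assumes t: "t \<in> padic 3 k" "t \<notin> padic 3 (Suc k)" and k: "2 \<le> k"
  shows "tripling t \<in> padic 3 (k + 2)" "tripling t \<notin> padic 3 (Suc (k + 2))"
proof -
  have t2: "t \<in> padic 3 2" using P3.padic_mono t(1) k by blast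
  have t0: "t \<in> padic 3 0" "t \<in> padic 3 1" using P3.padic_mono[OF t2] by simp_all
  \<comment> \<open>Since 9 divides \<open>t\<close>, it divides \<open>u\<close>, and
    \<open>3 + u\<close> has valuation exactly 1. Divisibility by 3 alone would not ensure this,
    hence the bound \<open>2 \<le> k\<close>.\<close>
  define u where "u = (8 + 12 * t + 12 * t ^ 2 + 4 * t ^ 3) * t"
  have u: "u \<in> padic 3 2"
    unfolding u_def by (intro P3.padic_mult_left t2 P3.padic_add P3.padic_power_0 t0) simp_all
  have A: "tri_num t = 3 + u" unfolding tri_num_def u_def by algebra
  have three: "of_int 3 \<in> padic 3 1" "of_int 3 \<notin> padic 3 2"
    using P3.of_int_padic_iff[of 3 1] P3.of_int_padic_iff[of 3 2] by simp_all
  have A1: "tri_num t \<in> padic 3 1" unfolding A using three P3.padic_add[of 3 1 u] P3.padic_mono[OF u, of 1] by simp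
  have A2: "tri_num t \<notin> padic 3 (Suc 1)"
  proof
    assume "tri_num t \<in> padic 3 (Suc 1)"
    then have "tri_num t - u \<in> padic 3 2" using P3.padic_diff[OF _ u] by (simp add: numeral_2_eq_2)
    then show False using three A by simp
  qed
  define v where "v = (- 24 * t - 128 * t ^ 2 - 312 * t ^ 3 - 432 * t ^ 4 - 368 * t ^ 5 - 192 * t ^ 6 - 48 * t ^ 7) * t"
  have v: "v \<in> padic 3 1"
    unfolding v_def by (intro P3.padic_mult_left t0 P3.padic_diff P3.padic_power_0 P3.padic_minus) (simp_all add: P3.padic_minus)
  have B: "tri_den t = 1 + v" unfolding tri_den_def v_def by algebra
  note unit = P3.one_plus_padic[OF v, folded B]
  have A22: "tri_num t * tri_num t \<in> padic 3 2" "tri_num t * tri_num t \<notin> padic 3 (Suc 2)"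
    using P3.padic_mult[OF A1 A1] P3.not_padic_mult[OF A1 A2 A1 A2] by (simp_all add: numeral_2_eq_2)
  define y where "y = t * (tri_num t * tri_num t)"
  have y: "y \<in> padic 3 (k + 2)" "y \<notin> padic 3 (Suc (k + 2))"
    unfolding y_def using P3.padic_mult[OF t(1) A22(1)] P3.not_padic_mult[OF t A22] by blast+
  have T: "tripling t = y / tri_den t" by (simp add: tripling_def y_def power2_eq_square)
  show "tripling t \<in> padic 3 (k + 2)" unfolding T using P3.padic_divide y(1) unit by blast
  show "tripling t \<notin> padic 3 (Suc (k + 2))"
  proof
    assume *: "tripling t \<in> padic 3 (Suc (k + 2))"
    have "tripling t * tri_den t \<in> padic 3 (Suc (k + 2))" using P3.padic_mult_right[OF *] unit by blast
    moreover have "tri_den t \<noteq> 0" using unit by auto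
    ultimately show False using y(2) T by simp
  qed
qed

text \<open>The other two factors are congruent to 1 modulo 3. Parameters of different valuation
  therefore give different values of \<alpha>.\<close>

lemma triple_quartic_valuation:
  assumes t: "t \<in> padic 3 k" "t \<notin> padic 3 (Suc k)" and k: "1 \<le> k"
  shows "triple_quartic t \<in> padic 3 k" "triple_quartic t \<notin> padic 3 (Suc k)"
proof -
  have t1: "t \<in> padic 3 1" using P3.padic_mono t(1) k by blast
  have t0: "t \<in> padic 3 0" using P3.padic_mono[OF t1] by simp
  have u1: "1 + t \<in> padic 3 0" "1 + t \<notin> padic 3 1" using P3.one_plus_padic[OF t1] by simp_all
  have "t + t * t \<in> padic 3 1" by (intro P3.padic_add P3.padic_mult_left t1 t0)
  then have u2: "1 + (t + t * t) \<in> padic 3 0" "1 + (t + t * t) \<notin> padic 3 1" using P3.one_plus_padic by simp_all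
  have e: "triple_quartic t = t * ((1 + t) * (1 + (t + t * t)))"
    by (simp add: triple_quartic_def power2_eq_square algebra_simps)
  have v: "(1 + t) * (1 + (t + t * t)) \<in> padic 3 0" "(1 + t) * (1 + (t + t * t)) \<notin> padic 3 (Suc 0)"
    using P3.padic_mult_left[OF u1(1) u2(1)] P3.not_padic_mult[of "1 + t" 0 "1 + (t + t * t)" 0] u1 u2 by simp_all
  show "triple_quartic t \<in> padic 3 k" "triple_quartic t \<notin> padic 3 (Suc k)"
    unfolding e using P3.padic_mult[OF t(1) v(1)] P3.not_padic_mult[OF t v] by simp_all
qed

lemma alpha_irrational_mod7:
  assumes "P7.pcong t 1" "\<alpha> ^ 2 = 4 * triple_quartic t" shows "\<alpha> \<notin> \<rat>"
proof
  assume "\<alpha> \<in> \<rat>"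
  have "P7.pcong (4 * triple_quartic t) (4 * triple_quartic 1)"
    unfolding triple_quartic_def by (intro P7.pcong_intros assms(1) P7.pcong_refl) simp_all
  moreover have "4 * triple_quartic 1 = of_int 24" by (simp add: triple_quartic_def)
  moreover have "P7.pcong (of_int 24) (of_int 3)" using P7.pcong_of_int[of 24 3] by simp
  ultimately have "P7.pcong (\<alpha> ^ 2) 3" using assms(2) P7.pcong_trans by fastforce
  then show False using not_square_mod7 \<open>\<alpha> \<in> \<rat>\<close> by blast
qed

lemma diophantine_curveI:
  assumes t: "t \<in> \<rat>" "P7.pcong t 1" and al: "\<alpha> ^ 2 = 4 * triple_quartic t" "\<alpha> \<in> \<real>"
  shows "diophantine_curve \<alpha> (- 2 * t * (1 + t)) (1 + 2 * t)"
proof unfold_locales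
  show "\<alpha> ^ 2 \<in> \<rat>" using t by (simp add: al triple_quartic_def)
  show "\<alpha> \<notin> \<rat>" by (rule alpha_irrational_mod7[OF t(2) al(1)])
  show "\<alpha> ^ 2 = (- 2 * t * (1 + t)) ^ 2 - 2 * (- 2 * t * (1 + t))"
    unfolding al triple_quartic_def by algebra
  show "(1 + 2 * t) ^ 2 = 1 - 2 * (- 2 * t * (1 + t))" by algebra
  show "1 + 2 * t \<in> \<rat>" using t by simp
  have "P7.pcong (- 2 * t * (1 + t)) (- 2 * 1 * (1 + 1))"
    by (intro P7.pcong_intros t(2) P7.pcong_refl) (simp_all add: P7.padic_minus)
  moreover have "P7.pcong (of_int (- 4)) (of_int 3)" using P7.pcong_of_int[of "- 4" 3] by simp
  ultimately show "- 2 * t * (1 + t) - 3 \<in> padic 7 1"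
    using P7.pcong_trans unfolding P7.pcong_def by fastforce
  show "\<alpha> \<in> \<real>" by fact
qed

lemma K_scale:
  assumes r: "r \<in> \<rat>" "r \<noteq> 0" and s: "quadratic_extension s" "quadratic_extension (r * s)"
  shows "quadratic_extension.K (r * s) = quadratic_extension.K s"
proof -
  interpret A: quadratic_extension s by fact
  interpret B: quadratic_extension "r * s" by fact
  have rs: "r * s \<in> A.K" using A.K_I[of 0 r] r by simp
  have "s = r * s / r" using r by simp
  then have sr: "s \<in> B.K" using B.K_closed(4)[OF B.K_alpha B.K_Rats[OF r(1)]] by simp
  show ?thesis
  proof
    show "B.K \<subseteq> A.K" using rs A.K_Rats A.K_closed by (auto elim!: B.K_E)
    show "A.K \<subseteq> B.K" using sr B.K_Rats B.K_closed by (auto elim!: A.K_E)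
  qed
qed

lemma infinite_triples:
  fixes t0 s :: complex
  assumes t0: "t0 \<in> \<rat>" "P7.pcong t0 1" "t0 \<in> padic 3 2" "t0 \<noteq> 0"
    and s: "s ^ 2 = triple_quartic t0" "s \<in> \<real>"
  defines "KK \<equiv> quadratic_extension.K s"
  shows "quadratic_extension s"
    "infinite {T. \<exists>a b c. T = {a, b, c} \<and> diophantine_triple KK a b c \<and> torsion_Z2_Z12 KK a b c}"
proof -
  have s2: "(2 * s) ^ 2 = 4 * triple_quartic t0" using s by (simp add: power2_eq_square)
  have "2 * s \<notin> \<rat>" by (rule alpha_irrational_mod7[OF t0(2) s2])
  then have "s \<notin> \<rat>" using Rats_mult[OF Rats_number_of] by blast
  moreover have "s ^ 2 \<in> \<rat>" using t0 by (simp add: s triple_quartic_def)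
  ultimately show qs: "quadratic_extension s" by unfold_locales
  obtain k where k: "t0 \<in> padic 3 k" "t0 \<notin> padic 3 (Suc k)"
    using P3.padic_exact P3.padic_mono[OF t0(3)] t0(4) by blast
  have k2: "2 \<le> k" using k(2) t0(3) P3.padic_mono[of t0 2 "Suc k"] by (meson not_less_eq_eq)
  define t where "t n = (tripling ^^ n) t0" for n
  have tS: "t (Suc n) = tripling (t n)" for n by (simp add: t_def)
  have t7: "P7.pcong (t n) 1" for n
    by (induction n) (use t0 tripling_mod7 in \<open>simp_all add: tS, simp add: t_def\<close>)
  have tR: "t n \<in> \<rat>" for n
    by (induction n) (use t0 in \<open>simp_all add: tS tripling_def tri_num_def tri_den_def, simp add: t_def\<close>)
  have t3: "t n \<in> padic 3 (k + 2 * n) \<and> t n \<notin> padic 3 (Suc (k + 2 * n))" for n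
  proof (induction n)
    case 0
    then show ?case using k by (simp add: t_def)
  next
    case (Suc n)
    then show ?case using tripling_valuation[of "t n" "k + 2 * n"] k2 by (simp add: tS)
  qed
  have "\<exists>c\<in>\<rat>. triple_quartic (t n) = c ^ 2 * triple_quartic t0" for n
  proof (induction n)
    case 0
    then show ?case by (intro bexI[of _ 1]) (simp_all add: t_def)
  next
    case (Suc n)
    then obtain c where c: "c \<in> \<rat>" "triple_quartic (t n) = c ^ 2 * triple_quartic t0" by blast
    obtain d where d: "d \<in> \<rat>" "triple_quartic (tripling (t n)) = d ^ 2 * triple_quartic (t n)"
      using triple_quartic_tripling[OF tripling_mod7(1)[OF t7] tR] .
    have "triple_quartic (t (Suc n)) = (d * c) ^ 2 * triple_quartic t0"
      unfolding tS d c by (simp add: power_mult_distrib)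
    then show ?case using c d Rats_mult by blast
  qed
  then obtain c where c: "\<And>n. c n \<in> \<rat>" "\<And>n. triple_quartic (t n) = c n ^ 2 * triple_quartic t0" by metis
  \<comment> \<open>Each quartic value differs from the first by a rational square, so its root is a
    rational multiple of \<open>s\<close>, and the field stays the same.\<close>
  define al where "al n = 2 * c n * s" for n
  have al2: "al n ^ 2 = 4 * triple_quartic (t n)" for n
    by (simp add: al_def c(2) s(1)[symmetric] power_mult_distrib)
  have alR: "al n \<in> \<real>" for n
  proof -
    obtain i j where "c n = of_int i / of_int j" using Rats_cases'[OF c(1)] by metis
    then show ?thesis using s(2) by (simp add: al_def)
  qed
  have dc: "diophantine_curve (al n) (- 2 * t n * (1 + t n)) (1 + 2 * t n)" for n
    by (rule diophantine_curveI[OF tR t7 al2 alR])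
  have K: "quadratic_extension.K (al n) = KK" for n
  proof -
    interpret diophantine_curve "al n" "- 2 * t n * (1 + t n)" "1 + 2 * t n" by (rule dc)
    have "quadratic_extension (2 * c n * s)" using quadratic_extension_axioms by (simp add: al_def)
    moreover have "2 * c n \<noteq> 0" using nonzero(1) by (auto simp: al_def)
    ultimately show ?thesis unfolding KK_def al_def using c(1) qs by (intro K_scale) simp_all
  qed
  define T where "T n = {al n, - 1 / al n, ((- 2 * t n * (1 + t n)) ^ 2 - 1) / al n}" for n
  have "T n \<in> {T. \<exists>a b c. T = {a, b, c} \<and> diophantine_triple KK a b c \<and> torsion_Z2_Z12 KK a b c}" for n
    using diophantine_curve.triple[OF dc, of n] diophantine_curve.torsion_Z2_Z12_triple[OF dc, of n]
    unfolding K T_def by blast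
  then have sub: "range T \<subseteq> {T. \<exists>a b c. T = {a, b, c} \<and> diophantine_triple KK a b c \<and> torsion_Z2_Z12 KK a b c}" by blast
  have inj: "inj al"
  proof (rule injI)
    fix m n assume "al m = al n"
    then have eq: "triple_quartic (t m) = triple_quartic (t n)" using al2[of m] al2[of n] by simp
    have v: "triple_quartic (t i) \<in> padic 3 (k + 2 * i)" "triple_quartic (t i) \<notin> padic 3 (Suc (k + 2 * i))" for i
      using triple_quartic_valuation[of "t i" "k + 2 * i"] t3[of i] k2 by simp_all
    have "\<not> m < n" using v(1)[of n] v(2)[of m] P3.padic_mono[of _ "k + 2 * n" "Suc (k + 2 * m)"] eq by auto
    moreover have "\<not> n < m" using v(1)[of m] v(2)[of n] P3.padic_mono[of _ "k + 2 * m" "Suc (k + 2 * n)"] eq by auto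
    ultimately show "m = n" by simp
  qed
  \<comment> \<open>Injectivity of \<open>T\<close> is avoided: finitely many finite sets have a
    finite union, yet this union contains all the distinct numbers \<open>al n\<close>.\<close>
  have "infinite (range T)"
  proof
    assume "finite (range T)"
    moreover have "finite X" if "X \<in> range T" for X using that by (auto simp: T_def)
    ultimately have "finite (\<Union> (range T))" by blast
    moreover have "range al \<subseteq> \<Union> (range T)" by (auto simp: T_def)
    ultimately have "finite (range al)" by (rule finite_subset[rotated])
    then show False using finite_imageD[OF _ inj] infinite_UNIV_nat by blast
  qed
  then show "infinite {T. \<exists>a b c. T = {a, b, c} \<and> diophantine_triple KK a b c \<and> torsion_Z2_Z12 KK a b c}"
    using sub finite_subset by blast
qed

text \<open>If \<open>s'\<close> lies in the field of \<open>s\<close> and both squares are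
  rational, then \<open>s'\<close> is a rational multiple \<open>v * s\<close>, so
  \<open>F' = v^2 F\<close>. When \<open>l\<close> does not divide \<open>F\<close>, the valuation
  of \<open>F'\<close> at \<open>l\<close> is even and cannot be 1.\<close>

lemma same_field_divides:
  fixes F F' :: int
  assumes K: "quadratic_extension.K s = quadratic_extension.K s'"
    and q: "quadratic_extension s" "quadratic_extension s'"
    and s: "s ^ 2 = of_int F" "s' ^ 2 = of_int F'"
    and l: "prime l" "l dvd F'" "\<not> l ^ 2 dvd F'"
  shows "l dvd F"
proof (rule ccontr)
  assume nF: "\<not> l dvd F"
  interpret A: quadratic_extension s by fact
  interpret B: quadratic_extension s' by fact
  interpret L: prime_int l by unfold_locales fact
  obtain u v where uv: "u \<in> \<rat>" "v \<in> \<rat>" "s' = u + v * s" using B.K_alpha K A.K_E by metis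
  have "of_int F' = u ^ 2 + 2 * u * v * s + v ^ 2 * s ^ 2" unfolding s(2)[symmetric] uv(3) by algebra
  then have "(2 * u * v) * s = (of_int F' - u ^ 2 - v ^ 2 * of_int F)" using s(1) by simp
  then have eq: "0 + (2 * u * v) * s = (of_int F' - u ^ 2 - v ^ 2 * of_int F) + 0 * s" by simp
  have "2 * u * v = 0"
    by (rule A.K_unique[THEN conjunct2, OF _ _ _ _ eq]) (use uv in simp_all)
  moreover have "v \<noteq> 0" using B.alpha_irrational uv by auto
  ultimately have "u = 0" by simp
  then have F': "of_int F' = v ^ 2 * of_int F" using s uv(3) by (simp add: power_mult_distrib)
  have F0: "of_int F \<in> padic l 0" "of_int F \<notin> padic l 1" using L.of_int_padic_iff[of F 1] nF by simp_all
  have F1: "of_int F' \<in> padic l 1" "of_int F' \<notin> padic l 2"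
    using L.of_int_padic_iff[of F' 1] L.of_int_padic_iff[of F' 2] l by simp_all
  have "of_int F \<noteq> (0::complex)" using nF by auto
  then have "v ^ 2 = of_int F' / of_int F" unfolding F' by simp
  then have v2: "v ^ 2 \<in> padic l 1" using L.padic_divide[OF F1(1) F0] by simp
  have v0: "v \<in> padic l 0"
  proof (rule ccontr)
    assume "v \<notin> padic l 0"
    then have iv: "inverse v \<in> padic l 1" using L.rational_cases uv by blast
    have "inverse v * inverse v * v ^ 2 \<in> padic l (1 + 1 + 1)" using L.padic_mult iv v2 by blast
    then show False using \<open>v \<noteq> 0\<close> L.one_not_padic[of 2] by (simp add: power2_eq_square field_simps)
  qed
  then have "v \<in> padic l 1" using L.padic_prime[of v v] v2 by (auto simp: power2_eq_square)
  then have "v ^ 2 \<in> padic l 2" using L.padic_power[of v 1 2] by simp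
  then have "v ^ 2 * of_int F \<in> padic l 2" using L.padic_mult_right F0 by blast
  then show False using F1 F' by simp
qed

theorem theorem2:
  shows "infinite {K. quadratic_field K \<and>
           infinite {T. \<exists>a b c. T = {a, b, c} \<and> diophantine_triple K a b c \<and>
                                torsion_Z2_Z12 K a b c}}"
    (is "infinite ?S")
proof -
  define L where "L = {l::int. prime l \<and> l > 7}"
  have "infinite L"
  proof
    assume fin: "finite L"
    have "int ` {p::nat. prime p} \<subseteq> L \<union> {0..7}" by (auto simp: L_def)
    then have "finite (int ` {p::nat. prime p})" by (rule finite_subset) (simp add: fin)
    then have "finite {p::nat. prime p}" by (rule finite_imageD) simp
    then show False using primes_infinite by blast
  qed
  have ex: "\<exists>k\<in>{1..6}. 9 * l * k mod 7 = 1" if "l \<in> L" for l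
  proof -
    have "l mod 7 \<noteq> 0"
    proof
      assume "l mod 7 = 0"
      then have "7 dvd l" by presburger
      moreover have "prime (7::int)" by simp
      ultimately have "7 = l" using that primes_dvd_imp_eq unfolding L_def by blast
      then show False using that by (simp add: L_def)
    qed
    then have "l mod 7 \<in> {1, 2, 3, 4, 5, 6}" using pos_mod_bound[of 7 l] pos_mod_sign[of 7 l] by auto
    \<comment> \<open>As 9 is 2 modulo 7, the witnesses 4, 2, 6, 1, 5, 3 are the inverses of
      \<open>2 * r\<close> for the residues \<open>r\<close> from 1 to 6.\<close>
    then have "\<exists>k\<in>{1..6}. 9 * (l mod 7) * k mod 7 = 1"
      using bexI[of "\<lambda>k. 9 * (l mod 7) * k mod 7 = 1" 4 "{1..6}"]
        bexI[of "\<lambda>k. 9 * (l mod 7) * k mod 7 = 1" 2 "{1..6}"]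
        bexI[of "\<lambda>k. 9 * (l mod 7) * k mod 7 = 1" 6 "{1..6}"]
        bexI[of "\<lambda>k. 9 * (l mod 7) * k mod 7 = 1" 1 "{1..6}"]
        bexI[of "\<lambda>k. 9 * (l mod 7) * k mod 7 = 1" 5 "{1..6}"]
        bexI[of "\<lambda>k. 9 * (l mod 7) * k mod 7 = 1" 3 "{1..6}"]
      by (elim insertE) simp_all
    moreover have "9 * l * k mod 7 = 9 * (l mod 7) * k mod 7" for k
      by (metis mod_mult_left_eq mod_mult_right_eq)
    ultimately show ?thesis by simp
  qed
  then obtain k where k: "\<And>l. l \<in> L \<Longrightarrow> k l \<in> {1..6}" "\<And>l. l \<in> L \<Longrightarrow> 9 * l * k l mod 7 = 1" by metis
  \<comment> \<open>The factor 9 starts the 3-adic argument, \<open>k l\<close> adjusts the residue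
    modulo 7 to 1, and \<open>l\<close> divides \<open>t l\<close> exactly once because
    \<open>l > 7\<close> exceeds \<open>k l\<close> and differs from 3.\<close>
  define t where "t l = 9 * l * k l" for l
  define F where "F l = t l * (1 + t l) * (1 + t l + t l ^ 2)" for l
  define s where "s l = complex_of_real (sqrt (real_of_int (F l)))" for l
  have tpos: "t l > 0" if "l \<in> L" for l using that k(1)[OF that] by (simp add: t_def L_def)
  have Fpos: "F l > 0" if "l \<in> L" for l
    unfolding F_def using tpos[OF that] by (intro mult_pos_pos) (simp_all add: add_pos_pos)
  have s2: "s l ^ 2 = of_int (F l)" if "l \<in> L" for l
  proof -
    have "sqrt (real_of_int (F l)) ^ 2 = real_of_int (F l)" using Fpos[OF that] by simp
    then show ?thesis unfolding s_def by (metis of_real_of_int_eq of_real_power)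
  qed
  have tr: "quadratic_extension (s l)"
    "infinite {T. \<exists>a b c. T = {a, b, c} \<and> diophantine_triple (quadratic_extension.K (s l)) a b c \<and>
       torsion_Z2_Z12 (quadratic_extension.K (s l)) a b c}" if l: "l \<in> L" for l
  proof -
    have "7 dvd t l - 1" using k(2)[OF l] unfolding t_def by presburger
    then have 7: "P7.pcong (of_int (t l)) 1" using P7.pcong_of_int[of "t l" 1] by simp
    have "3 ^ 2 dvd t l" by (simp add: t_def)
    then have 3: "of_int (t l) \<in> padic 3 2" using P3.of_int_padic_iff by blast
    have q: "s l ^ 2 = triple_quartic (of_int (t l))"
      unfolding s2[OF l] by (simp add: F_def triple_quartic_def)
    show "quadratic_extension (s l)"
      "infinite {T. \<exists>a b c. T = {a, b, c} \<and> diophantine_triple (quadratic_extension.K (s l)) a b c \<and>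
         torsion_Z2_Z12 (quadratic_extension.K (s l)) a b c}"
      using infinite_triples[of "of_int (t l)" "s l"] 7 3 q tpos[OF l] by (simp_all add: s_def)
  qed
  have "(\<lambda>l. quadratic_extension.K (s l)) ` L \<subseteq> ?S"
    using tr quadratic_extension.quadratic_field_K by blast
  moreover have "infinite ((\<lambda>l. quadratic_extension.K (s l)) ` L)"
  proof
    assume "finite ((\<lambda>l. quadratic_extension.K (s l)) ` L)"
    then obtain l where l: "l \<in> L" and
      inf: "infinite {l' \<in> L. quadratic_extension.K (s l') = quadratic_extension.K (s l)}"
      using pigeonhole_infinite[OF \<open>infinite L\<close>] by blast
    \<comment> \<open>Every prime \<open>l'\<close> giving the same field as \<open>l\<close>
      divides the fixed nonzero integer \<open>F l\<close>, because it divides \<open>F l'\<close>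
      exactly once. Only finitely many \<open>l'\<close> can do so, against the pigeonhole choice of
      \<open>l\<close>.\<close>
    have "l' dvd F l" if l': "l' \<in> L" and eq: "quadratic_extension.K (s l') = quadratic_extension.K (s l)" for l'
    proof (rule same_field_divides[OF eq[symmetric] tr(1)[OF l] tr(1)[OF l'] s2[OF l] s2[OF l']])
      have pl: "prime l'" "l' > 7" using l' by (auto simp: L_def)
      show "prime l'" by fact
      have d: "l' dvd t l'" by (simp add: t_def)
      then show "l' dvd F l'" by (simp add: F_def)
      show "\<not> l' ^ 2 dvd F l'"
      proof
        assume "l' ^ 2 dvd F l'"
        moreover have "F l' = l' * (9 * k l' * X)" if "X = (1 + t l') * (1 + t l' + t l' ^ 2)" for X
          unfolding F_def mult.assoc that[symmetric] by (simp add: t_def)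
        ultimately have "l' * l' dvd l' * (9 * k l' * ((1 + t l') * (1 + t l' + t l' ^ 2)))"
          by (simp add: power2_eq_square)
        then have "l' dvd 9 * k l' * ((1 + t l') * (1 + t l' + t l' ^ 2))" using pl by simp
        then have "l' dvd 9 \<or> l' dvd k l' \<or> l' dvd 1 + t l' \<or> l' dvd 1 + t l' + t l' ^ 2"
          using pl(1) by (simp add: prime_dvd_mult_iff)
        moreover have "\<not> l' dvd 9"
        proof
          assume "l' dvd 9"
          then have "l' dvd 3 * 3" by simp
          then have "l' dvd 3" using pl(1) prime_dvd_multD by blast
          then show False using pl zdvd_imp_le[of l' 3] by simp
        qed
        moreover have "\<not> l' dvd k l'" using zdvd_imp_le[of l' "k l'"] k(1)[OF l'] pl(2) by auto
        moreover have "\<not> l' dvd 1 + t l'" using d pl(1) dvd_add_left_iff[of l' "t l'" 1] not_prime_unit by blast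
        moreover have "\<not> l' dvd 1 + t l' + t l' ^ 2"
        proof
          assume "l' dvd 1 + t l' + t l' ^ 2"
          then have "l' dvd 1 + (t l' + t l' ^ 2)" by (simp add: add.assoc)
          moreover have "l' dvd t l' + t l' ^ 2" using d by (simp add: power2_eq_square)
          ultimately have "l' dvd 1" using dvd_add_left_iff by blast
          then show False using pl(1) not_prime_unit by blast
        qed
        ultimately show False by blast
      qed
    qed
    then have "{l' \<in> L. quadratic_extension.K (s l') = quadratic_extension.K (s l)} \<subseteq> {l'. l' dvd F l}" by blast
    moreover have "finite {l'. l' dvd F l}" using Fpos[OF l] by (intro finite_divisors_int) simp
    ultimately show False using inf finite_subset by blast
  qed
  ultimately show ?thesis using finite_subset by blast
qed

end
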